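(* Let $r\ge 2$ and let $G$ be a graph consisting of $r$ odd cycles $C_1,\dots,C_r$ glued together at a common vertex. On each edge $e_j$ of $G$ let a real-valued potential $q_j\in L^1(0,1)$ be given, and consider the eigenvalue problem $-y_j''+q_j(x)y_j=\lambda y_j$ on every edge $e_j\cong[0,1]$, with standard (continuity and Kirchhoff) matching conditions at every vertex. Suppose that $\lambda=0$ is the smallest eigenvalue of this problem, and that for infinitely many $k\in\mathbb{Z}^+$ there are $r-1$ eigenvalues (counting multiplicities) such that $\lambda=(2k+1)^2\pi^2+o(1)$. Then $q=0$ almost everywhere on $G$, i.e. $q_j(x)=0$ for a.e. $x\in[0,1]$ for every edge $e_j$.
   Context: Graph. Let $r\ge2$ and let $C_1,\dots,C_r$ be cycle graphs with odd cycle lengths $n_1,\dots,n_r$ ($n_j=1$ is allowed, in which case $C_j$ is a single vertex with a loop). Let the vertices of $C_j$ be $v_{j0},v_{j1},\dots,v_{jn_j}=v_{j0}$. The graph $G$ is the union of the $C_j$'s with the vertices $v_{10},\dots,v_{r0}$ identified to one vertex (and no other identifications). $G$ is then called a graph consisting of $r$ odd cycles glued together at a common vertex. Eigenvalue problem. Enumerate the edges as $e_1,\dots,e_{|E|}$, choose an arbitrary orientation of each edge and parametrize each edge by $x\in[0,1]$ (from its starting point $x=0$ to its endpoint $x=1$). A number $\lambda$ is an eigenvalue if there is a nonzero family $(y_j)_j$ of functions on $[0,1]$, with $y_j,y_j'$ absolutely continuous, such that: (i) $-y_j''+q_j(x)y_j=\lambda y_j$ a.e. on $[0,1]$ for all $j$;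 (ii) (continuity) at each vertex $v$, all values $y_j(\kappa)$ at edge ends attached to $v$ coincide, where $\kappa=0$ for edges leaving $v$, $\kappa=1$ for edges entering $v$ (for a loop at $v$ both ends are attached to $v$); (iii) (Kirchhoff) at each vertex $v$, $\sum_{e_j\text{ leaves }v}y_j'(0)=\sum_{e_j\text{ enters }v}y_j'(1)$, where loops are counted on both sides. The multiplicity of an eigenvalue is the dimension of its solution space. Meaning of the asymptotic hypothesis. There is an infinite set $K\subseteq\mathbb{Z}^+$ and, for each $k\in K$, $r-1$ eigenvalues $\lambda_{k,1}\le\dots\le\lambda_{k,r-1}$ (an eigenvalue may be repeated at most as many times as its multiplicity) such that $\max_i|\lambda_{k,i}-(2k+1)^2\pi^2|\to0$ as $k\to\infty$ in $K$. *)

theory Defs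
  imports
    "HOL-Analysis.Analysis"
    "HOL-Library.Function_Algebras"
    "Graph_Theory.Digraph"
begin

text \<open>
  An oriented multigraph is a \<open>pre_digraph\<close>; an arc \<open>e\<close> is an edge parametrized by
  \<open>[0,1]\<close>, with \<open>x = 0\<close> at \<open>tail G e\<close> and \<open>x = 1\<close> at \<open>head G e\<close>.
  The edges \<open>a j 0, \<dots>, a j (n j - 1)\<close> form the \<open>j\<close>-th cycle, which runs through the vertices
  \<open>v j 0, \<dots>, v j (n j) = v j 0\<close>. Comparing unordered pairs of end points leaves the
  orientation of every edge arbitrary. Since \<open>n j\<close> is odd, it is \<open>1\<close> (a loop) or at least \<open>3\<close>.
\<close>

definition odd_cycles_glued :: "nat \<Rightarrow> ('v, 'e) pre_digraph \<Rightarrow> bool" where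
  "odd_cycles_glued r G \<longleftrightarrow>
    (\<exists>(n :: nat \<Rightarrow> nat) (v :: nat \<Rightarrow> nat \<Rightarrow> 'v) (a :: nat \<Rightarrow> nat \<Rightarrow> 'e) (c :: 'v).
      (\<forall>j\<in>{1..r}. odd (n j) \<and> v j 0 = c \<and> v j (n j) = c) \<and>
      (\<forall>j\<in>{1..r}. \<forall>i\<in>{1..<n j}. v j i \<noteq> c) \<and>
      inj_on (\<lambda>(j, i). v j i) (SIGMA j:{1..r}. {1..<n j}) \<and>
      verts G = (\<Union>j\<in>{1..r}. v j ` {0..n j}) \<and>
      bij_betw (\<lambda>(j, i). a j i) (SIGMA j:{1..r}. {0..<n j}) (arcs G) \<and>
      (\<forall>j\<in>{1..r}. \<forall>i\<in>{0..<n j}.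
        {tail G (a j i), head G (a j i)} = {v j i, v j (Suc i)}))"

text \<open>Absolute continuity of a real function on \<open>[a,b]\<close>; the library's
  \<open>absolutely_continuous\<close> is the unrelated notion for measures.\<close>

definition abs_continuous_on :: "real \<Rightarrow> real \<Rightarrow> (real \<Rightarrow> real) \<Rightarrow> bool" where
  "abs_continuous_on a b f \<longleftrightarrow>
    (\<forall>\<epsilon>>0. \<exists>\<delta>>0. \<forall>I :: (real \<times> real) set.
      finite I \<longrightarrow>
      (\<forall>(s, t)\<in>I. a \<le> s \<and> s < t \<and> t \<le> b) \<longrightarrow>
      disjoint_family_on (\<lambda>(s, t). {s<..<t}) I \<longrightarrow>
      (\<Sum>(s, t)\<in>I. t - s) < \<delta> \<longrightarrow>
      (\<Sum>(s, t)\<in>I. \<bar>f t - f s\<bar>) < \<epsilon>)"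

text \<open>The derivative on \<open>[0,1]\<close>, one-sided at the end points.\<close>

definition edge_deriv :: "(real \<Rightarrow> real) \<Rightarrow> real \<Rightarrow> real" where
  "edge_deriv f x = vector_derivative f (at x within {0..1})"

definition edge_solution :: "(real \<Rightarrow> real) \<Rightarrow> real \<Rightarrow> (real \<Rightarrow> real) \<Rightarrow> bool" where
  "edge_solution p \<mu> f \<longleftrightarrow>
    abs_continuous_on 0 1 f \<and>
    (\<forall>x\<in>{0..1}. f differentiable (at x within {0..1})) \<and>
    abs_continuous_on 0 1 (edge_deriv f) \<and>
    (AE x\<in>{0..1} in lebesgue.
      edge_deriv f differentiable (at x within {0..1}) \<and>
      - edge_deriv (edge_deriv f) x + p x * f x = \<mu> * f x)"

definition vertex_continuity :: "('v, 'e) pre_digraph \<Rightarrow> ('e \<Rightarrow> real \<Rightarrow> real) \<Rightarrow> bool" where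
  "vertex_continuity G y \<longleftrightarrow>
    (\<forall>w\<in>verts G. \<exists>c.
      (\<forall>e\<in>out_arcs G w. y e 0 = c) \<and> (\<forall>e\<in>in_arcs G w. y e 1 = c))"

definition vertex_kirchhoff :: "('v, 'e) pre_digraph \<Rightarrow> ('e \<Rightarrow> real \<Rightarrow> real) \<Rightarrow> bool" where
  "vertex_kirchhoff G y \<longleftrightarrow>
    (\<forall>w\<in>verts G.
      (\<Sum>e\<in>out_arcs G w. edge_deriv (y e) 0) = (\<Sum>e\<in>in_arcs G w. edge_deriv (y e) 1))"

text \<open>A family of functions on \<open>[0,1]\<close> indexed by the edges is represented by a total function
  that vanishes elsewhere, so that distinct elements are distinct families.\<close>

definition solution_space ::
    "('v, 'e) pre_digraph \<Rightarrow> ('e \<Rightarrow> real \<Rightarrow> real) \<Rightarrow> real \<Rightarrow> ('e \<Rightarrow> real \<Rightarrow> real) set" where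
  "solution_space G q \<mu> =
    {y. (\<forall>e\<in>arcs G. edge_solution (q e) \<mu> (y e)) \<and>
        vertex_continuity G y \<and> vertex_kirchhoff G y \<and>
        (\<forall>e x. e \<notin> arcs G \<or> x \<notin> {0..1} \<longrightarrow> y e x = 0)}"

definition eigenvalue :: "('v, 'e) pre_digraph \<Rightarrow> ('e \<Rightarrow> real \<Rightarrow> real) \<Rightarrow> real \<Rightarrow> bool" where
  "eigenvalue G q \<mu> \<longleftrightarrow> (\<exists>y\<in>solution_space G q \<mu>. y \<noteq> 0)"

definition scale_family :: "real \<Rightarrow> ('e \<Rightarrow> real \<Rightarrow> real) \<Rightarrow> 'e \<Rightarrow> real \<Rightarrow> real" where
  "scale_family c y = (\<lambda>e x. c * y e x)"

lemma vector_space_scale_family: "vector_space scale_family"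
  by standard (simp_all add: scale_family_def plus_fun_def algebra_simps)

definition eigenvalue_multiplicity ::
    "('v, 'e) pre_digraph \<Rightarrow> ('e \<Rightarrow> real \<Rightarrow> real) \<Rightarrow> real \<Rightarrow> nat" where
  "eigenvalue_multiplicity G q \<mu> = vector_space.dim scale_family (solution_space G q \<mu>)"

text \<open>\<open>\<nu> 1 \<le> \<dots> \<le> \<nu> m\<close> are eigenvalues, each repeated at most as often as its multiplicity.\<close>

definition eigenvalues_with_multiplicity ::
    "('v, 'e) pre_digraph \<Rightarrow> ('e \<Rightarrow> real \<Rightarrow> real) \<Rightarrow> nat \<Rightarrow> (nat \<Rightarrow> real) \<Rightarrow> bool" where
  "eigenvalues_with_multiplicity G q m \<nu> \<longleftrightarrow>
    mono_on {1..m} \<nu> \<and>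
    (\<forall>i\<in>{1..m}. eigenvalue G q (\<nu> i) \<and>
      card {i'\<in>{1..m}. \<nu> i' = \<nu> i} \<le> eigenvalue_multiplicity G q (\<nu> i))"

end

theory Submission
  imports Defs
begin

text \<open>
  Along each cycle the edges are concatenated to one interval, and the problem becomes a family of
  equations \<open>- u'' + Q\<^sub>j u = \<lambda> u\<close> on \<open>[0, n\<^sub>j]\<close> with a common value at all end points and one Kirchhoff
  condition. For \<open>\<lambda> = \<omega>\<^sup>2 + o(1)\<close>, \<open>\<omega> = (2 k + 1) \<pi>\<close>, oddness of \<open>n\<^sub>j\<close> forces \<open>u\<^sub>j = a\<^sub>j sin \<omega>x + O(1/\<omega>)\<close> with
  \<open>\<Sum>a\<^sub>j = O(1/\<omega>)\<close>. Testing with \<open>sin \<omega>x\<close> gives, in the limit, \<open>a\<^sub>j \<integral>Q\<^sub>j\<close> independent of \<open>j\<close>; since \<open>r - 1\<close>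
  orthonormal eigenfunctions exhaust the hyperplane \<open>\<Sum>a\<^sub>j = 0\<close>, this implies \<open>\<Sum>\<integral>Q\<^sub>j = 0\<close>.

  If there is no negative eigenvalue, then a continuation argument in \<open>\<lambda>\<close>, starting near \<open>- \<infinity>\<close>, shows that for
  every \<open>\<lambda> < 0\<close> there are positive solutions \<open>u\<^sub>j\<close> with common value \<open>1\<close> at the end points and
  \<open>\<Sum>[u\<^sub>j'] > 0\<close>. For \<open>v\<^sub>j = u\<^sub>j' / u\<^sub>j\<close> the Riccati equation \<open>v\<^sub>j' = Q\<^sub>j - \<lambda> - v\<^sub>j\<^sup>2\<close> yields
  \<open>\<Sum>\<integral>v\<^sub>j\<^sup>2 < \<bar>\<lambda>\<bar> \<Sum>n\<^sub>j\<close>, and \<open>\<lambda> \<rightarrow> 0\<close> leaves \<open>Q\<^sub>j = 0\<close>.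
\<close>

text \<open>Two obstacles shape the proof. The potentials are merely integrable, so
  \<open>u''\<close> exists only almost everywhere; calculus is done with pairs of an absolutely
  continuous function and its derivative, and the passage to the quasi-derivative
  \<open>z = u' - g u\<close> with \<open>g' = Q\<close> restores continuous coefficients. And no
  variational principle for the smallest eigenvalue is set up: positivity of the
  \<open>u\<^sub>j\<close> comes from the continuation. It can only break down where some
  \<open>u\<^sub>j\<close> degenerates or where the sum of the jumps of \<open>z\<close> reaches
  zero. The first is excluded by Riccati bounds, the second would be an eigenvalue below 0. This is
  where \<open>\<Sum>\<integral>Q\<^sub>j = 0\<close> enters: by it the Kirchhoff sums of
  \<open>u'\<close> and of \<open>z\<close> agree for functions with value 1 at all end points. The
  step from \<open>a\<^sub>j \<integral>Q\<^sub>j\<close> independent of \<open>j\<close> to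
  \<open>\<Sum>\<integral>Q\<^sub>j = 0\<close> is linear algebra: if no
  \<open>\<integral>Q\<^sub>j\<close> vanishes, all amplitude vectors are proportional to the vector
  of reciprocals, so \<open>r = 2\<close> and the two reciprocals sum to 0; if one vanishes, all
  do.\<close>

hide_const (open) Polynomial.content

section \<open>Absolutely continuous functions and their derivatives\<close>

text \<open>The Saks-Henstock lemma bounds the total error of every fine partial division by
  \<open>e * \<delta>\<close>, while each bad interval contributes more than \<open>e\<close> times
  its length; so disjoint bad intervals have total length below \<open>\<delta>\<close>. Vitali's
  theorem picks disjoint bad intervals that cover the exceptional set up to a null set. Intervals
  straddling \<open>x\<close> serve both one-sided derivatives at once.\<close>

lemma straddle_failure_negligible:
  fixes f :: "real \<Rightarrow> real"
  assumes f: "f integrable_on {a..b}" and e: "e > 0"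
  shows "negligible {x\<in>{a<..<b}. \<forall>d>0. \<exists>u v. a \<le> u \<and> u \<le> x \<and> x \<le> v \<and> v \<le> b \<and> u < v \<and> v - u < d \<and>
            e * (v - u) < \<bar>integral {u..v} f - f x * (v - u)\<bar>}" (is "negligible ?E")
  unfolding negligible_outer_le
proof (intro allI impI)
  fix \<delta> :: real assume "\<delta> > 0"
  have "f integrable_on cbox a b" using f by simp
  moreover have "e * \<delta> > 0" using e \<open>\<delta> > 0\<close> by simp
  ultimately obtain \<gamma> where "gauge \<gamma>" and hl: "\<And>p. \<lbrakk>p tagged_partial_division_of cbox a b; \<gamma> fine p\<rbrakk>
      \<Longrightarrow> (\<Sum>(x, k)\<in>p. norm (content k *\<^sub>R f x - integral k f)) < e * \<delta>"
    by (rule Henstock_lemma) blast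
  \<comment> \<open>The point \<open>x\<close> is kept next to its interval because it is the tag in
    the partial division, whereas Vitali's theorem sees the interval only as a ball around its
    midpoint.\<close>
  define K where "K = {(x, u, v). x \<in> ?E \<and> a \<le> u \<and> u \<le> x \<and> x \<le> v \<and> v \<le> b \<and> u < v \<and> {u..v} \<subseteq> \<gamma> x \<and>
            e * (v - u) < \<bar>integral {u..v} f - f x * (v - u)\<bar>}"
  define c where "c = (\<lambda>(x::real, u, v). (u + v) / 2 :: real)"
  define r where "r = (\<lambda>(x::real, u, v). (v - u) / 2 :: real)"
  have cb: "cball (c (x, u, v)) (r (x, u, v)) = {u..v}" for x u v
    by (auto simp: c_def r_def cball_eq_atLeastAtMost field_simps)
  have r0: "0 < r i" if "i \<in> K" for i using that by (auto simp: K_def r_def)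
  have vit: "\<exists>i. i \<in> K \<and> x \<in> cball (c i) (r i) \<and> r i < d" if x: "x \<in> ?E" and d: "0 < d" for x d
  proof -
    have "x \<in> \<gamma> x" "open (\<gamma> x)" using \<open>gauge \<gamma>\<close> by (auto simp: gauge_def)
    then obtain \<eta> where \<eta>: "\<eta> > 0" "ball x \<eta> \<subseteq> \<gamma> x" using open_contains_ball by blast
    have "min d \<eta> > 0" using d \<eta> by simp
    then obtain u v where uv: "a \<le> u" "u \<le> x" "x \<le> v" "v \<le> b" "u < v" "v - u < min d \<eta>"
      "e * (v - u) < \<bar>integral {u..v} f - f x * (v - u)\<bar>"
      using x by blast
    have "{u..v} \<subseteq> ball x \<eta>" using uv by (auto simp: dist_real_def)
    then have "(x, u, v) \<in> K" using uv x \<eta> by (auto simp: K_def)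
    moreover have "r (x, u, v) < d" using uv by (auto simp: r_def)
    ultimately show ?thesis using cb uv by (intro exI[of _ "(x, u, v)"]) auto
  qed
  obtain C where C: "countable C" "C \<subseteq> K"
     "pairwise (\<lambda>i j. disjnt (cball (c i) (r i)) (cball (c j) (r j))) C"
     "negligible (?E - (\<Union>i \<in> C. cball (c i) (r i)))"
    using Vitali_covering_theorem_cballs[of K r ?E c] r0 vit by blast
  let ?B = "\<lambda>i. cball (c i) (r i)"
  \<comment> \<open>Finite subfamilies only, since a tagged partial division is finite. The bound is
    uniform in \<open>D\<close>, so it passes to the countable union.\<close>
  have bound: "measure lebesgue (\<Union>i\<in>D. ?B i) \<le> \<delta>" if D: "D \<subseteq> C" "finite D" for D
  proof -
    define p where "p = (\<lambda>(x, u, v). (x, {u..v})) ` D"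
    have inj: "inj_on (\<lambda>(x::real, u, v). (x, {u..v::real})) D"
    proof (rule inj_onI)
      fix i j assume ij: "i \<in> D" "j \<in> D" "(case i of (x, u, v) \<Rightarrow> (x, {u..v})) = (case j of (x, u, v) \<Rightarrow> (x, {u..v}))"
      obtain x u v x' u' v' where e: "i = (x, u, v)" "j = (x', u', v')" by (cases i, cases j) auto
      then have "u < v" using ij D C by (auto simp: K_def)
      then show "i = j" using ij e by (auto simp: Icc_eq_Icc)
    qed
    have "p tagged_partial_division_of cbox a b"
      unfolding tagged_partial_division_of_def
    proof (intro conjI allI impI)
      show "finite p" using D by (simp add: p_def)
    next
      fix x k assume "(x, k) \<in> p"
      then obtain u v where *: "(x, u, v) \<in> D" "k = {u..v}" by (auto simp: p_def)
      then have "(x, u, v) \<in> K" using D C by blast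
      with * show "x \<in> k" "k \<subseteq> cbox a b" "\<exists>s t. k = cbox s t"
        by (auto simp: K_def)
    next
      fix x1 k1 x2 k2 assume "(x1, k1) \<in> p \<and> (x2, k2) \<in> p \<and> (x1, k1) \<noteq> (x2, k2)"
      then obtain u1 v1 u2 v2 where *: "(x1, u1, v1) \<in> D" "k1 = {u1..v1}" "(x2, u2, v2) \<in> D" "k2 = {u2..v2}"
        "(x1, u1, v1) \<noteq> (x2, u2, v2)"
        by (auto simp: p_def)
      have "disjnt (?B (x1, u1, v1)) (?B (x2, u2, v2))"
        using C(3) * D unfolding pairwise_def by blast
      then show "interior k1 \<inter> interior k2 = {}"
        using * interior_subset unfolding cb disjnt_def by blast
    qed
    moreover have "\<gamma> fine p"
      unfolding fine_def p_def using D C by (auto simp: K_def)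
    ultimately have less: "(\<Sum>(x, k)\<in>p. norm (content k *\<^sub>R f x - integral k f)) < e * \<delta>" by (rule hl)
    have "measure lebesgue (\<Union>i\<in>D. ?B i) = (\<Sum>i\<in>D. measure lebesgue (?B i))"
    proof (rule measure_finite_Union[OF D(2)])
      show "disjoint_family_on ?B D"
        using C(3) D(1) unfolding disjoint_family_on_def pairwise_def disjnt_def by blast
      show "emeasure lebesgue (?B i) \<noteq> \<infinity>" for i
        using lmeasurable_cball[of "c i" "r i"] fmeasurableD2 by fastforce
    qed auto
    also have "\<dots> = (\<Sum>(x, u, v)\<in>D. v - u)"
    proof (rule sum.cong[OF refl])
      fix i assume i: "i \<in> D"
      obtain x u v where ii: "i = (x, u, v)" by (cases i) auto
      then have "(x, u, v) \<in> K" using i D C by blast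
      then show "measure lebesgue (?B i) = (case i of (x, u, v) \<Rightarrow> v - u)"
        unfolding ii cb by (auto simp: K_def)
    qed
    finally have m: "measure lebesgue (\<Union>i\<in>D. ?B i) = (\<Sum>(x, u, v)\<in>D. v - u)" .
    have "e * (\<Sum>(x, u, v)\<in>D. v - u) = (\<Sum>(x, u, v)\<in>D. e * (v - u))"
      by (simp add: sum_distrib_left case_prod_unfold)
    also have "\<dots> \<le> (\<Sum>(x, u, v)\<in>D. norm (content {u..v} *\<^sub>R f x - integral {u..v} f))"
    proof (rule sum_mono)
      fix i assume i: "i \<in> D"
      obtain x u v where ii: "i = (x, u, v)" by (cases i) auto
      then have "(x, u, v) \<in> K" using i D C by blast
      then show "(case i of (x, u, v) \<Rightarrow> e * (v - u))
         \<le> (case i of (x, u, v) \<Rightarrow> norm (content {u..v} *\<^sub>R f x - integral {u..v} f))"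
        unfolding ii by (auto simp: K_def mult.commute abs_minus_commute)
    qed
    also have "\<dots> = (\<Sum>(x, k)\<in>p. norm (content k *\<^sub>R f x - integral k f))"
      unfolding p_def by (subst sum.reindex[OF inj]) (simp add: case_prod_unfold)
    finally have "e * (\<Sum>(x, u, v)\<in>D. v - u) < e * \<delta>" using less by linarith
    then have "(\<Sum>(x, u, v)\<in>D. v - u) < \<delta>" using e by simp
    with m show ?thesis by linarith
  qed
  have U: "(\<Union>i\<in>C. ?B i) \<in> lmeasurable" "measure lebesgue (\<Union>i\<in>C. ?B i) \<le> \<delta>"
    using fmeasurable_UN_bound[OF C(1), of ?B lebesgue \<delta>] measure_UN_bound[OF C(1), of ?B lebesgue \<delta>] bound
    by auto
  let ?N = "?E - (\<Union>i \<in> C. ?B i)"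
  have N: "?N \<in> lmeasurable" "measure lebesgue ?N = 0"
    using C(4) negligible_imp_measurable negligible_imp_measure0 by blast+
  show "\<exists>T. ?E \<subseteq> T \<and> T \<in> lmeasurable \<and> measure lebesgue T \<le> \<delta>"
  proof (intro exI conjI)
    show "?E \<subseteq> ?N \<union> (\<Union>i\<in>C. ?B i)" by blast
    show "?N \<union> (\<Union>i\<in>C. ?B i) \<in> lmeasurable" using N U by blast
    show "measure lebesgue (?N \<union> (\<Union>i\<in>C. ?B i)) \<le> \<delta>"
      using measure_Un_le[of ?N lebesgue "\<Union>i\<in>C. ?B i"] N U by (auto simp: fmeasurableD)
  qed
qed

text \<open>The exceptional set is the union of the straddle failures for the errors
  \<open>1 / (n + 1)\<close>, together with the two end points, which the failure sets do not
  cover.\<close>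

lemma lebesgue_differentiation:
  fixes f :: "real \<Rightarrow> real"
  assumes f: "f integrable_on {a..b}"
  obtains N where "negligible N" and
    "\<And>x. x \<in> {a..b} - N \<Longrightarrow>
       ((\<lambda>x. integral {a..x} f) has_real_derivative f x) (at x within {a..b})"
proof
  define E where "E e = {x\<in>{a<..<b}. \<forall>d>0. \<exists>u v. a \<le> u \<and> u \<le> x \<and> x \<le> v \<and> v \<le> b \<and> u < v \<and> v - u < d \<and>
            e * (v - u) < \<bar>integral {u..v} f - f x * (v - u)\<bar>}" for e
  let ?N = "insert a (insert b (\<Union>n. E (inverse (Suc n))))"
  show "negligible ?N"
    using straddle_failure_negligible[OF f]
    by (auto simp: E_def negligible_insert intro!: negligible_countable_Union)
  fix x assume x: "x \<in> {a..b} - ?N"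
  then have ab: "a < x" "x < b" by auto
  let ?F = "\<lambda>x. integral {a..x} f"
  have split: "?F v - ?F u = integral {u..v} f" if "a \<le> u" "u \<le> v" "v \<le> b" for u v
    using Henstock_Kurzweil_Integration.integral_combine[where f=f and a=a and c=u and b=v] that
      integrable_on_subinterval[OF f, of a v] by auto
  show "(?F has_real_derivative f x) (at x within {a..b})"
    unfolding has_field_derivative_def has_derivative_within_alt
  proof (intro conjI allI impI)
    show "bounded_linear ((*) (f x))" by (rule bounded_linear_mult_right)
    fix e :: real assume "e > 0"
    then obtain n where n: "inverse (real (Suc n)) < e" using reals_Archimedean by blast
    have "x \<notin> E (inverse (Suc n))" using x by blast
    then obtain d where d: "d > 0" and straddle: "\<And>u v. \<lbrakk>a \<le> u; u \<le> x; x \<le> v; v \<le> b; u < v; v - u < d\<rbrakk> \<Longrightarrow>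
       \<bar>integral {u..v} f - f x * (v - u)\<bar> \<le> inverse (Suc n) * (v - u)"
      using ab unfolding E_def by (auto simp: not_less) (metis not_less)
    show "\<exists>d>0. \<forall>y\<in>{a..b}. norm (y - x) < d \<longrightarrow> norm (?F y - ?F x - f x * (y - x)) \<le> e * norm (y - x)"
    proof (intro exI[of _ d] conjI ballI impI d)
      fix y assume y: "y \<in> {a..b}" "norm (y - x) < d"
      consider "y = x" | "y < x" | "y > x" by linarith
      then show "norm (?F y - ?F x - f x * (y - x)) \<le> e * norm (y - x)"
      proof cases
        case 2
        have "\<bar>integral {y..x} f - f x * (x - y)\<bar> \<le> inverse (Suc n) * (x - y)"
          using straddle[of y x] y 2 ab by auto
        also have "\<dots> \<le> e * (x - y)" using n 2 by (intro mult_right_mono) auto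
        finally show ?thesis using split[of y x] y 2 ab by (auto simp: abs_if algebra_simps split: if_splits)
      next
        case 3
        have "\<bar>integral {x..y} f - f x * (y - x)\<bar> \<le> inverse (Suc n) * (y - x)"
          using straddle[of x y] y 3 ab by auto
        also have "\<dots> \<le> e * (y - x)" using n 3 by (intro mult_right_mono) auto
        finally show ?thesis using split[of x y] y 3 ab by (auto simp: algebra_simps)
      qed auto
    qed
  qed
qed

section \<open>Absolute continuity and the fundamental theorem of calculus\<close>

definition ac_modulus :: "real \<Rightarrow> real \<Rightarrow> (real \<Rightarrow> real) \<Rightarrow> real \<Rightarrow> real \<Rightarrow> bool" where
  "ac_modulus a b f \<epsilon> \<delta> \<longleftrightarrow> (\<forall>I :: (real \<times> real) set. finite I \<longrightarrow>
     (\<forall>(s, t)\<in>I. a \<le> s \<and> s < t \<and> t \<le> b) \<longrightarrow> disjoint_family_on (\<lambda>(s, t). {s<..<t}) I \<longrightarrow>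
     (\<Sum>(s, t)\<in>I. t - s) < \<delta> \<longrightarrow> (\<Sum>(s, t)\<in>I. \<bar>f t - f s\<bar>) < \<epsilon>)"

lemma abs_continuous_on_iff_modulus:
  "abs_continuous_on a b f \<longleftrightarrow> (\<forall>\<epsilon>>0. \<exists>\<delta>>0. ac_modulus a b f \<epsilon> \<delta>)"
  by (simp add: abs_continuous_on_def ac_modulus_def)

lemma ac_modulusI:
  assumes "\<And>I :: (real \<times> real) set. \<lbrakk>finite I; \<And>s t. (s, t) \<in> I \<Longrightarrow> a \<le> s \<and> s < t \<and> t \<le> b;
      disjoint_family_on (\<lambda>(s, t). {s<..<t}) I; (\<Sum>(s, t)\<in>I. t - s) < \<delta>\<rbrakk> \<Longrightarrow> (\<Sum>(s, t)\<in>I. \<bar>f t - f s\<bar>) < \<epsilon>"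
  shows "ac_modulus a b f \<epsilon> \<delta>"
  unfolding ac_modulus_def by (intro allI impI, rule assms) auto

lemma ac_modulusD:
  assumes "ac_modulus a b f \<epsilon> \<delta>" "finite I" "\<And>s t. (s, t) \<in> I \<Longrightarrow> a \<le> s \<and> s < t \<and> t \<le> b"
    "disjoint_family_on (\<lambda>(s, t). {s<..<t}) I" "(\<Sum>(s, t)\<in>I. t - s) < \<delta>"
  shows "(\<Sum>(s, t)\<in>I. \<bar>f t - f s\<bar>) < \<epsilon>"
  by (rule assms(1)[unfolded ac_modulus_def, rule_format]) (use assms(2-5) in auto)

lemma sum_length_disjoint_intervals_le:
  fixes I :: "(real \<times> real) set"
  assumes "finite I" "\<And>s t. (s, t) \<in> I \<Longrightarrow> s < t" "disjoint_family_on (\<lambda>(s, t). {s<..<t}) I"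
    and "\<And>s t. (s, t) \<in> I \<Longrightarrow> {s<..<t} \<subseteq> U" "U \<in> lmeasurable"
  shows "(\<Sum>(s, t)\<in>I. t - s) \<le> measure lebesgue U"
proof -
  have "(\<Sum>(s, t)\<in>I. t - s) = (\<Sum>i\<in>I. measure lebesgue (case i of (s, t) \<Rightarrow> {s<..<t}))"
    using assms(2) by (intro sum.cong refl) (force simp: less_imp_le)
  also have "\<dots> = measure lebesgue (\<Union>i\<in>I. case i of (s, t) \<Rightarrow> {s<..<t})"
    using assms(1,3) by (intro measure_finite_Union[symmetric]) (use assms(2) in \<open>force simp: less_imp_le\<close>)+
  also have "\<dots> \<le> measure lebesgue U"
    using assms(4,5) by (intro measure_mono_fmeasurable) (auto intro!: sets.finite_UN assms(1))
  finally show ?thesis .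
qed

text \<open>The gauge absorbs the exceptional set: tags in \<open>N\<close> only meet intervals of small total length,
  on which absolute continuity controls the increments.\<close>

lemma abs_continuous_on_fundamental_theorem:
  fixes f f' :: "real \<Rightarrow> real"
  assumes ab: "a \<le> b" and ac: "abs_continuous_on a b f" and N: "negligible N"
    and deriv: "\<And>x. x \<in> {a..b} - N \<Longrightarrow> (f has_real_derivative f' x) (at x within {a..b})"
  shows "(f' has_integral (f b - f a)) {a..b}"
proof (rule has_integral_spike[OF N])
  define h where "h x = (if x \<in> N then 0 else f' x)" for x
  show "f' x = h x" if "x \<in> {a..b} - N" for x using that by (simp add: h_def)
  show "(h has_integral (f b - f a)) {a..b}"
    unfolding has_integral_real
  proof (intro allI impI)
    fix e :: real assume e: "e > 0"
    \<comment> \<open>Makes the total error at tags outside \<open>N\<close> at most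
      \<open>e / 2\<close>; the summand 1 covers \<open>a = b\<close>.\<close>
    define e' where "e' = e / (2 * (b - a + 1))"
    have e': "e' > 0" "e' * (b - a) \<le> e / 2" using e ab by (auto simp: e'_def field_simps)
    obtain \<delta> where \<delta>: "\<delta> > 0" and ac\<delta>: "ac_modulus a b f (e / 2) \<delta>"
      using ac half_gt_zero[OF e] unfolding abs_continuous_on_iff_modulus by blast
    have Nl: "N \<in> lmeasurable" "measure lebesgue N = 0"
      using N negligible_imp_measurable negligible_imp_measure0 by auto
    then obtain U where U: "open U" "N \<subseteq> U" "U - N \<in> lmeasurable" "emeasure lebesgue (U - N) < ennreal \<delta>"
      using sets_lebesgue_outer_open[OF fmeasurableD[OF Nl(1)] \<delta>] by blast
    have Ueq: "U = N \<union> (U - N)" using U by blast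
    have Ul: "U \<in> lmeasurable" using U(3) Nl by (subst Ueq) blast
    have "measure lebesgue U \<le> measure lebesgue N + measure lebesgue (U - N)"
      by (subst Ueq, rule measure_Un_le) (use U(3) Nl in auto)
    also have "measure lebesgue (U - N) < \<delta>"
      using U(3,4) \<delta> by (metis emeasure_eq_measure2 ennreal_less_iff measure_nonneg)
    finally have Um: "measure lebesgue U < \<delta>" using Nl by simp
    have "\<exists>\<eta>>0. \<forall>y\<in>{a..b}. \<bar>y - x\<bar> < \<eta> \<longrightarrow> \<bar>f y - f x - f' x * (y - x)\<bar> \<le> e' * \<bar>y - x\<bar>" if "x \<in> {a..b} - N" for x
      using deriv[OF that] e' unfolding has_field_derivative_def has_derivative_within_alt real_norm_def by blast
    then obtain \<eta> where \<eta>: "\<And>x. x \<in> {a..b} - N \<Longrightarrow> \<eta> x > 0"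
      and lin: "\<And>x y. \<lbrakk>x \<in> {a..b} - N; y \<in> {a..b}; \<bar>y - x\<bar> < \<eta> x\<rbrakk> \<Longrightarrow> \<bar>f y - f x - f' x * (y - x)\<bar> \<le> e' * \<bar>y - x\<bar>"
      by metis
    define \<gamma> where "\<gamma> x = (if x \<in> N then U else if x \<in> {a..b} then ball x (\<eta> x) else ball x 1)" for x
    have gauge: "gauge \<gamma>" unfolding gauge_def \<gamma>_def using U \<eta> by auto
    have main: "norm ((\<Sum>(x, k)\<in>p. content k *\<^sub>R h x) - (f b - f a)) < e"
      if p: "p tagged_division_of {a..b}" and fine: "\<gamma> fine p" for p
    proof -
      note pD = tagged_division_ofD[OF p]
      define D where "D = (\<lambda>(x, k). content k *\<^sub>R h x - (f (Sup k) - f (Inf k)))"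
      have box: "\<exists>s t. k = {s..t} \<and> s \<le> x \<and> x \<le> t \<and> a \<le> s \<and> t \<le> b" if "(x, k) \<in> p" for x k
        using pD(2,3,4)[OF that] by fastforce
      have "(\<Sum>(x, k)\<in>p. content k *\<^sub>R h x) - (f b - f a) = (\<Sum>xk\<in>p. D xk)"
        using additive_tagged_division_1[OF ab p, of f]
        by (simp add: D_def sum_subtractf case_prod_unfold)
      also have "\<bar>\<dots>\<bar> \<le> (\<Sum>xk\<in>p. \<bar>D xk\<bar>)" by (rule sum_abs)
      also have "\<dots> = (\<Sum>xk\<in>{xk\<in>p. fst xk \<notin> N}. \<bar>D xk\<bar>) + (\<Sum>xk\<in>{xk\<in>p. fst xk \<in> N}. \<bar>D xk\<bar>)"
        by (subst sum.union_disjoint[symmetric]) (use pD(1) in \<open>auto intro: sum.cong\<close>)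
      also have "(\<Sum>xk\<in>{xk\<in>p. fst xk \<notin> N}. \<bar>D xk\<bar>) \<le> (\<Sum>xk\<in>{xk\<in>p. fst xk \<notin> N}. e' * content (snd xk))"
      proof (rule sum_mono, clarify)
        fix x k assume xk: "(x, k) \<in> p" "fst (x, k) \<notin> N"
        obtain s t where st: "k = {s..t}" "s \<le> x" "x \<le> t" "a \<le> s" "t \<le> b" using box[OF xk(1)] by blast
        have "k \<subseteq> \<gamma> x" using fine xk by (auto simp: fine_def)
        then have "k \<subseteq> ball x (\<eta> x)" using xk st by (auto simp: \<gamma>_def)
        moreover have "s \<in> k" "t \<in> k" using st by auto
        ultimately have sub: "s \<in> ball x (\<eta> x)" "t \<in> ball x (\<eta> x)" by blast+
        then have "\<bar>f s - f x - f' x * (s - x)\<bar> \<le> e' * \<bar>s - x\<bar>" "\<bar>f t - f x - f' x * (t - x)\<bar> \<le> e' * \<bar>t - x\<bar>"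
          using st xk lin[of x s] lin[of x t] by (auto simp: dist_real_def abs_minus_commute)
        moreover have "e' * \<bar>s - x\<bar> + e' * \<bar>t - x\<bar> = e' * (t - s)" using st by (simp add: algebra_simps)
        moreover have "D (x, k) = (f s - f x - f' x * (s - x)) - (f t - f x - f' x * (t - x))"
          using st xk by (simp add: D_def h_def algebra_simps)
        ultimately show "\<bar>D (x, k)\<bar> \<le> e' * content (snd (x, k))" using st by simp
      qed
      also have "\<dots> \<le> (\<Sum>xk\<in>p. e' * content (snd xk))"
        using pD(1) e' by (intro sum_mono2) auto
      also have "\<dots> = e' * (b - a)"
        using additive_content_tagged_division[of p a b] p ab
        by (simp add: sum_distrib_left[symmetric] case_prod_unfold)
      also have "\<dots> \<le> e / 2" by (rule e')
      \<comment> \<open>Degenerate intervals are dropped: they contribute nothing,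
        \<open>ac_modulus\<close> only admits pairs with \<open>s < t\<close>, and the interior
        argument for injectivity below relies on proper intervals.\<close>
      also have "(\<Sum>xk\<in>{xk\<in>p. fst xk \<in> N}. \<bar>D xk\<bar>) = (\<Sum>xk\<in>{xk\<in>p. fst xk \<in> N \<and> content (snd xk) > 0}. \<bar>D xk\<bar>)"
      proof (rule sum.mono_neutral_right)
        show "\<forall>i\<in>{xk \<in> p. fst xk \<in> N} - {xk \<in> p. fst xk \<in> N \<and> content (snd xk) > 0}. \<bar>D i\<bar> = 0"
        proof
          fix i assume i: "i \<in> {xk \<in> p. fst xk \<in> N} - {xk \<in> p. fst xk \<in> N \<and> content (snd xk) > 0}"
          obtain x k where e: "i = (x, k)" by (cases i)
          then have xk: "(x, k) \<in> p" "\<not> content k > 0" using i by auto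
          obtain s t where k: "k = {s..t}" "s \<le> x" "x \<le> t" using box[OF xk(1)] by blast
          with xk have "s = t" by auto
          with k e show "\<bar>D i\<bar> = 0" by (simp add: D_def)
        qed
      qed (use pD(1) in auto)
      also have "\<dots> = (\<Sum>(s, t)\<in>(\<lambda>(x, k). (Inf k, Sup k)) ` {xk\<in>p. fst xk \<in> N \<and> content (snd xk) > 0}. \<bar>f t - f s\<bar>)"
        (is "_ = sum _ ?I")
      proof (subst sum.reindex)
        show "inj_on (\<lambda>(x, k). (Inf k, Sup k)) {xk \<in> p. fst xk \<in> N \<and> content (snd xk) > 0}"
        proof (rule inj_onI)
          fix i j assume ij: "i \<in> {xk \<in> p. fst xk \<in> N \<and> content (snd xk) > 0}"
            "j \<in> {xk \<in> p. fst xk \<in> N \<and> content (snd xk) > 0}"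
            "(case i of (x, k) \<Rightarrow> (Inf k, Sup k)) = (case j of (x, k) \<Rightarrow> (Inf k, Sup k))"
          obtain x k x' k' where e: "i = (x, k)" "j = (x', k')" by (cases i, cases j) auto
          have *: "(x, k) \<in> p" "(x', k') \<in> p" "content k > 0" "content k' > 0" "Inf k = Inf k'" "Sup k = Sup k'"
            using ij e by auto
          obtain s t where st: "k = {s..t}" "s \<le> x" "x \<le> t" using box[OF *(1)] by blast
          obtain s' t' where st': "k' = {s'..t'}" "s' \<le> x'" "x' \<le> t'" using box[OF *(2)] by blast
          have "k = k'" "s < t" using * st st' by (auto split: if_splits)
          then have "interior k \<inter> interior k' \<noteq> {}" using st by auto
          then show "i = j" using pD(5)[OF *(1,2)] e by blast
        qed
        show "(\<Sum>xk\<in>{xk \<in> p. fst xk \<in> N \<and> content (snd xk) > 0}. \<bar>D xk\<bar>) =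
          sum ((\<lambda>(s, t). \<bar>f t - f s\<bar>) \<circ> (\<lambda>(x, k). (Inf k, Sup k))) {xk \<in> p. fst xk \<in> N \<and> 0 < content (snd xk)}"
          by (intro sum.cong refl) (auto simp: D_def h_def)
      qed
      also have "\<dots> < e / 2"
      proof (rule ac_modulusD[OF ac\<delta>])
        have I: "\<exists>x. (x, {s..t}) \<in> p \<and> x \<in> N \<and> s < t \<and> a \<le> s \<and> t \<le> b" if "(s, t) \<in> ?I" for s t
        proof -
          from that obtain i where i: "i \<in> p" "fst i \<in> N" "content (snd i) > 0"
            "(s, t) = (case i of (x, k) \<Rightarrow> (Inf k, Sup k))" by blast
          obtain x k where "i = (x, k)" by (cases i)
          with i have xk: "(x, k) \<in> p" "x \<in> N" "content k > 0" "s = Inf k" "t = Sup k" by auto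
          obtain s' t' where st: "k = {s'..t'}" "s' \<le> x" "x \<le> t'" "a \<le> s'" "t' \<le> b" using box[OF xk(1)] by blast
          then have eq: "s' = s" "t' = t" using xk by auto
          have "s' < t'" using xk(3) st by (auto split: if_splits)
          then show ?thesis using xk(1,2) st(1,4,5) unfolding eq by blast
        qed
        show fin: "finite ?I" using pD(1) by simp
        show I': "a \<le> s \<and> s < t \<and> t \<le> b" if "(s, t) \<in> ?I" for s t using I[OF that] by blast
        show disj: "disjoint_family_on (\<lambda>(s, t). {s<..<t}) ?I"
          unfolding disjoint_family_on_def
        proof (intro ballI impI)
          fix m n assume mn: "m \<in> ?I" "n \<in> ?I" "m \<noteq> n"
          obtain s t s' t' where st: "m = (s, t)" "n = (s', t')" by (cases m, cases n) auto
          have "(s, t) \<in> ?I" "(s', t') \<in> ?I" using mn(1,2) unfolding st by blast+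
          then obtain x x' where *: "(x, {s..t}) \<in> p" "(x', {s'..t'}) \<in> p" "s < t" "s' < t'"
            using I by meson
          have "(x, {s..t}) \<noteq> (x', {s'..t'})" using mn(3) * unfolding st by (auto simp: Icc_eq_Icc)
          then have "interior {s..t} \<inter> interior {s'..t'} = {}" using pD(5)[OF *(1,2)] by blast
          then show "(case m of (s, t) \<Rightarrow> {s<..<t}) \<inter> (case n of (s, t) \<Rightarrow> {s<..<t}) = {}"
            using st by simp
        qed
        have "(\<Sum>(s, t)\<in>?I. t - s) \<le> measure lebesgue U"
        proof (rule sum_length_disjoint_intervals_le[OF fin _ disj _ Ul])
          show "s < t" if "(s, t) \<in> ?I" for s t using I'[OF that] by blast
          show "{s<..<t} \<subseteq> U" if st: "(s, t) \<in> ?I" for s t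
          proof -
            obtain x where x: "(x, {s..t}) \<in> p" "x \<in> N" using I[OF st] by blast
            then have "{s..t} \<subseteq> \<gamma> x" using fine by (auto simp: fine_def)
            moreover have "\<gamma> x = U" using x by (simp add: \<gamma>_def)
            moreover have "{s<..<t} \<subseteq> {s..t}" by auto
            ultimately show ?thesis by blast
          qed
        qed
        then show "(\<Sum>(s, t)\<in>?I. t - s) < \<delta>" using Um by linarith
      qed
      finally show ?thesis by simp
    qed
    show "\<exists>\<gamma>. gauge \<gamma> \<and> (\<forall>p. p tagged_division_of {a..b} \<and> \<gamma> fine p \<longrightarrow>
        norm ((\<Sum>(x, k)\<in>p. content k *\<^sub>R h x) - (f b - f a)) < e)"
      using gauge by (intro exI[of _ \<gamma>] conjI allI impI main) simp_all
  qed
qed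

lemma absolutely_integrable_on_imp_integrable_on:
  fixes f :: "'a::euclidean_space \<Rightarrow> 'b::euclidean_space"
  shows "f absolutely_integrable_on S \<Longrightarrow> f integrable_on S"
  by (simp add: absolutely_integrable_on_def)

text \<open>At most one of the open intervals contains a given \<open>x\<close>, so the sum of the
  restrictions of \<open>h\<close> to them stays below \<open>h\<close>. Closed intervals could
  share end points.\<close>

lemma integral_disjoint_intervals_le:
  fixes h :: "real \<Rightarrow> real"
  assumes h: "h integrable_on {a..b}" "\<And>x. x \<in> {a..b} \<Longrightarrow> 0 \<le> h x"
    and I: "finite I" "\<And>s t. (s, t) \<in> I \<Longrightarrow> a \<le> s \<and> s < t \<and> t \<le> b" "disjoint_family_on (\<lambda>(s, t). {s<..<t}) I"
  shows "(\<Sum>(s, t)\<in>I. integral {s..t} h) \<le> integral {a..b} h"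
proof (rule has_integral_le)
  show "((\<lambda>x. \<Sum>i\<in>I. if x \<in> {fst i<..<snd i} then h x else 0) has_integral (\<Sum>(s, t)\<in>I. integral {s..t} h)) {a..b}"
  proof (rule has_integral_sum[OF I(1)])
    fix i assume i: "i \<in> I"
    obtain s t where st: "i = (s, t)" by (cases i)
    have "(h has_integral integral {s..t} h) {s..t}"
      using I(2)[of s t] i st integrable_on_subinterval[OF h(1), of s t] by auto
    then have "(h has_integral integral {s..t} h) {s<..<t}"
      by (simp add: has_integral_Icc_iff_Ioo)
    then show "((\<lambda>x. if x \<in> {fst i<..<snd i} then h x else 0) has_integral
        (case i of (s, t) \<Rightarrow> integral {s..t} h)) {a..b}"
      using I(2)[of s t] i st by (subst has_integral_restrict) auto
  qed
  show "(h has_integral integral {a..b} h) {a..b}" using h by auto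
  fix x assume x: "x \<in> {a..b}"
  show "(\<Sum>i\<in>I. if x \<in> {fst i<..<snd i} then h x else 0) \<le> h x"
  proof (cases "\<exists>i\<in>I. x \<in> {fst i<..<snd i}")
    case True
    then obtain i where i: "i \<in> I" "x \<in> {fst i<..<snd i}" by blast
    have "(if x \<in> {fst j<..<snd j} then h x else 0) = 0" if "j \<in> I - {i}" for j
    proof -
      have "j \<in> I" "i \<noteq> j" using that by auto
      then have "{fst i<..<snd i} \<inter> {fst j<..<snd j} = {}"
        using I(3) i(1) unfolding disjoint_family_on_def case_prod_unfold by blast
      then have "x \<notin> {fst j<..<snd j}" using i(2) by blast
      then show ?thesis by (rule if_not_P)
    qed
    then have "(\<Sum>j\<in>I. if x \<in> {fst j<..<snd j} then h x else 0) = h x"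
      using sum.remove[OF I(1) i(1), of "\<lambda>j. if x \<in> {fst j<..<snd j} then h x else 0"] i by simp
    then show ?thesis by simp
  next
    case False
    then have "(\<Sum>j\<in>I. if x \<in> {fst j<..<snd j} then h x else 0) = 0"
      by (intro sum.neutral) auto
    then show ?thesis using h(2)[OF x] by simp
  qed
qed

text \<open>Split \<open>\<bar>f\<bar> \<le> n + h n\<close> with \<open>h n\<close> the excess of
  \<open>\<bar>f\<bar>\<close> over \<open>n\<close>. Dominated convergence makes the integral of
  the excess smaller than \<open>\<epsilon> / 2\<close>, and the bounded part is then controlled by
  the total length alone.\<close>

lemma abs_continuous_on_integral:
  fixes f :: "real \<Rightarrow> real"
  assumes f: "f absolutely_integrable_on {a..b}"
  shows "abs_continuous_on a b (\<lambda>x. integral {a..x} f)"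
  unfolding abs_continuous_on_iff_modulus
proof (intro allI impI)
  fix \<epsilon> :: real assume "\<epsilon> > 0"
  define h where "h n x = max 0 (\<bar>f x\<bar> - real n)" for n x
  have absf: "(\<lambda>x. \<bar>f x\<bar>) absolutely_integrable_on {a..b}"
    using absolutely_integrable_norm[OF f] by (simp add: o_def)
  have hint: "h n integrable_on {a..b}" for n
  proof -
    have "(\<lambda>x. \<bar>f x\<bar> - real n) absolutely_integrable_on {a..b}"
      by (intro set_integral_diff absf) auto
    then have "(\<lambda>x. max 0 (\<bar>f x\<bar> - real n)) absolutely_integrable_on {a..b}"
      by (intro absolutely_integrable_max_1) auto
    then show ?thesis unfolding h_def by (rule absolutely_integrable_on_imp_integrable_on)
  qed
  have "(\<lambda>n. integral {a..b} (h n)) \<longlonglongrightarrow> integral {a..b} (\<lambda>x. 0::real)"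
  proof (rule dominated_convergence(2)[where h = "\<lambda>x. \<bar>f x\<bar>"])
    show "(\<lambda>x. \<bar>f x\<bar>) integrable_on {a..b}" using absf absolutely_integrable_on_imp_integrable_on by auto
    show "norm (h n x) \<le> \<bar>f x\<bar>" for n x by (auto simp: h_def)
    show "(\<lambda>n. h n x) \<longlonglongrightarrow> 0" for x
    proof (rule tendsto_eventually)
      obtain N where "\<bar>f x\<bar> \<le> real N" using real_arch_simple by blast
      then show "\<forall>\<^sub>F n in sequentially. h n x = 0"
        unfolding eventually_sequentially h_def by (intro exI[of _ N]) auto
    qed
  qed (rule hint)
  then have "\<forall>\<^sub>F n in sequentially. integral {a..b} (h n) < \<epsilon> / 2"
    using order_tendstoD(2)[of _ 0 _ "\<epsilon> / 2"] \<open>\<epsilon> > 0\<close> by simp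
  then obtain n where n: "integral {a..b} (h n) < \<epsilon> / 2"
    using eventually_happens'[OF sequentially_bot] by blast
  define \<delta> where "\<delta> = \<epsilon> / (2 * (real n + 1))"
  have \<delta>: "\<delta> > 0" "real n * \<delta> \<le> \<epsilon> / 2" using \<open>\<epsilon> > 0\<close> by (auto simp: \<delta>_def field_simps)
  have fi: "f integrable_on {a..b}" using f absolutely_integrable_on_imp_integrable_on by auto
  show "\<exists>\<delta>>0. ac_modulus a b (\<lambda>x. integral {a..x} f) \<epsilon> \<delta>"
  proof (intro exI[of _ \<delta>] conjI ac_modulusI \<delta>)
    fix I :: "(real \<times> real) set"
    assume fin: "finite I" and st: "\<And>s t. (s, t) \<in> I \<Longrightarrow> a \<le> s \<and> s < t \<and> t \<le> b"
      and disj: "disjoint_family_on (\<lambda>(s, t). {s<..<t}) I" and len: "(\<Sum>(s, t)\<in>I. t - s) < \<delta>"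
    have "(\<Sum>(s, t)\<in>I. \<bar>integral {a..t} f - integral {a..s} f\<bar>)
        \<le> (\<Sum>(s, t)\<in>I. real n * (t - s) + integral {s..t} (h n))"
    proof (rule sum_mono, clarify)
      fix s t assume "(s, t) \<in> I"
      note * = st[OF this]
      have le: "\<bar>f x\<bar> \<le> real n + h n x" for x by (simp add: h_def)
      have "integral {a..t} f - integral {a..s} f = integral {s..t} f"
        using Henstock_Kurzweil_Integration.integral_combine[where f=f and a=a and c=s and b=t]
          integrable_on_subinterval[OF fi, of a t] * by auto
      moreover have "norm (integral {s..t} f) \<le> integral {s..t} (\<lambda>x. real n + h n x)"
        using * integrable_on_subinterval[OF fi, of s t] integrable_on_subinterval[OF hint, of s t]
        by (intro integral_norm_bound_integral integrable_add) (auto simp: le)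
      moreover have "integral {s..t} (\<lambda>x. real n + h n x) = real n * (t - s) + integral {s..t} (h n)"
        using * integrable_on_subinterval[OF hint, of s t]
        by (subst integral_add) auto
      ultimately show "\<bar>integral {a..t} f - integral {a..s} f\<bar> \<le> real n * (t - s) + integral {s..t} (h n)"
        by simp
    qed
    also have "\<dots> = real n * (\<Sum>(s, t)\<in>I. t - s) + (\<Sum>(s, t)\<in>I. integral {s..t} (h n))"
      by (simp add: sum.distrib sum_distrib_left case_prod_unfold)
    also have "(\<Sum>(s, t)\<in>I. integral {s..t} (h n)) \<le> integral {a..b} (h n)"
      by (rule integral_disjoint_intervals_le[OF hint _ fin st disj]) (auto simp: h_def)
    also have "real n * (\<Sum>(s, t)\<in>I. t - s) \<le> real n * \<delta>"
      using len by (intro mult_left_mono) auto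
    finally show "(\<Sum>(s, t)\<in>I. \<bar>integral {a..t} f - integral {a..s} f\<bar>) < \<epsilon>"
      using n \<delta> by linarith
  qed
qed

section \<open>Closure properties of absolute continuity\<close>

lemma abs_continuous_on_imp_continuous_on:
  assumes "abs_continuous_on a b f"
  shows "continuous_on {a..b} f"
  unfolding continuous_on_iff
proof (intro ballI allI impI)
  fix x \<epsilon> :: real assume x: "x \<in> {a..b}" "\<epsilon> > 0"
  obtain \<delta> where \<delta>: "\<delta> > 0" "ac_modulus a b f \<epsilon> \<delta>"
    using assms x(2) unfolding abs_continuous_on_iff_modulus by blast
  have single: "\<bar>f t - f s\<bar> < \<epsilon>" if "a \<le> s" "s < t" "t \<le> b" "t - s < \<delta>" for s t
    using ac_modulusD[OF \<delta>(2), of "{(s, t)}"] that by (auto simp: disjoint_family_on_def)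
  show "\<exists>d>0. \<forall>x'\<in>{a..b}. dist x' x < d \<longrightarrow> dist (f x') (f x) < \<epsilon>"
  proof (intro exI[of _ \<delta>] conjI ballI impI \<delta>(1))
    fix y assume "y \<in> {a..b}" "dist y x < \<delta>"
    then show "dist (f y) (f x) < \<epsilon>"
      using single[of x y] single[of y x] x
      by (cases x y rule: linorder_cases) (auto simp: dist_real_def abs_minus_commute)
  qed
qed

lemma abs_continuous_on_cong:
  assumes "abs_continuous_on a b f" "\<And>x. x \<in> {a..b} \<Longrightarrow> f x = g x"
  shows "abs_continuous_on a b g"
proof -
  have "ac_modulus a b g \<epsilon> \<delta>" if m: "ac_modulus a b f \<epsilon> \<delta>" for \<epsilon> \<delta>
  proof (rule ac_modulusI)
    fix I :: "(real \<times> real) set"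
    assume *: "finite I" "\<And>s t. (s, t) \<in> I \<Longrightarrow> a \<le> s \<and> s < t \<and> t \<le> b"
      "disjoint_family_on (\<lambda>(s, t). {s<..<t}) I" "(\<Sum>(s, t)\<in>I. t - s) < \<delta>"
    have "(\<Sum>(s, t)\<in>I. \<bar>g t - g s\<bar>) = (\<Sum>(s, t)\<in>I. \<bar>f t - f s\<bar>)"
    proof (rule sum.cong[OF refl], clarify)
      fix s t assume "(s, t) \<in> I"
      from *(2)[OF this] show "\<bar>g t - g s\<bar> = \<bar>f t - f s\<bar>" by (simp add: assms(2)[symmetric])
    qed
    also have "\<dots> < \<epsilon>" by (rule ac_modulusD[OF m *])
    finally show "(\<Sum>(s, t)\<in>I. \<bar>g t - g s\<bar>) < \<epsilon>" .
  qed
  then show ?thesis using assms(1) unfolding abs_continuous_on_iff_modulus by meson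
qed

lemma abs_continuous_on_subinterval:
  assumes "abs_continuous_on a b f" "a \<le> c" "d \<le> b"
  shows "abs_continuous_on c d f"
proof -
  have "ac_modulus c d f \<epsilon> \<delta>" if m: "ac_modulus a b f \<epsilon> \<delta>" for \<epsilon> \<delta>
  proof (rule ac_modulusI)
    fix I :: "(real \<times> real) set"
    assume *: "finite I" "\<And>s t. (s, t) \<in> I \<Longrightarrow> c \<le> s \<and> s < t \<and> t \<le> d"
      "disjoint_family_on (\<lambda>(s, t). {s<..<t}) I" "(\<Sum>(s, t)\<in>I. t - s) < \<delta>"
    have "a \<le> s \<and> s < t \<and> t \<le> b" if "(s, t) \<in> I" for s t using *(2)[OF that] assms(2,3) by linarith
    then show "(\<Sum>(s, t)\<in>I. \<bar>f t - f s\<bar>) < \<epsilon>" by (rule ac_modulusD[OF m *(1) _ *(3,4)])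
  qed
  then show ?thesis using assms(1) unfolding abs_continuous_on_iff_modulus by meson
qed

lemma abs_continuous_on_mult:
  assumes f: "abs_continuous_on a b f" and g: "abs_continuous_on a b g"
  shows "abs_continuous_on a b (\<lambda>x. f x * g x)"
  unfolding abs_continuous_on_iff_modulus
proof (intro allI impI)
  fix \<epsilon> :: real assume \<epsilon>: "\<epsilon> > 0"
  have "\<exists>B>0. \<forall>x\<in>{a..b}. \<bar>h x\<bar> \<le> B" if "abs_continuous_on a b h" for h
  proof -
    have "bounded (h ` {a..b})"
      using abs_continuous_on_imp_continuous_on[OF that] by (intro compact_imp_bounded compact_continuous_image) auto
    then show ?thesis by (auto simp: bounded_pos)
  qed
  then obtain B C where B: "B > 0" "\<And>x. x \<in> {a..b} \<Longrightarrow> \<bar>f x\<bar> \<le> B" and C: "C > 0" "\<And>x. x \<in> {a..b} \<Longrightarrow> \<bar>g x\<bar> \<le> C"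
    using f g by metis
  have "\<epsilon> / (2 * C) > 0" "\<epsilon> / (2 * B) > 0" using \<epsilon> B C by auto
  obtain \<delta>1 where \<delta>1: "\<delta>1 > 0" "ac_modulus a b f (\<epsilon> / (2 * C)) \<delta>1"
    using f \<open>\<epsilon> / (2 * C) > 0\<close> unfolding abs_continuous_on_iff_modulus by blast
  obtain \<delta>2 where \<delta>2: "\<delta>2 > 0" "ac_modulus a b g (\<epsilon> / (2 * B)) \<delta>2"
    using g \<open>\<epsilon> / (2 * B) > 0\<close> unfolding abs_continuous_on_iff_modulus by blast
  show "\<exists>\<delta>>0. ac_modulus a b (\<lambda>x. f x * g x) \<epsilon> \<delta>"
  proof (intro exI[of _ "min \<delta>1 \<delta>2"] conjI ac_modulusI)
    show "min \<delta>1 \<delta>2 > 0" using \<delta>1 \<delta>2 by simp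
    fix I :: "(real \<times> real) set"
    assume *: "finite I" "\<And>s t. (s, t) \<in> I \<Longrightarrow> a \<le> s \<and> s < t \<and> t \<le> b"
      "disjoint_family_on (\<lambda>(s, t). {s<..<t}) I" "(\<Sum>(s, t)\<in>I. t - s) < min \<delta>1 \<delta>2"
    have "(\<Sum>(s, t)\<in>I. \<bar>f t * g t - f s * g s\<bar>) \<le> (\<Sum>(s, t)\<in>I. B * \<bar>g t - g s\<bar> + C * \<bar>f t - f s\<bar>)"
    proof (rule sum_mono, clarify)
      fix s t assume "(s, t) \<in> I"
      from *(2)[OF this] have st: "s \<in> {a..b}" "t \<in> {a..b}" by auto
      have "\<bar>f t * g t - f s * g s\<bar> = \<bar>f t * (g t - g s) + (f t - f s) * g s\<bar>" by (simp add: algebra_simps)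
      also have "\<dots> \<le> \<bar>f t\<bar> * \<bar>g t - g s\<bar> + \<bar>g s\<bar> * \<bar>f t - f s\<bar>"
        by (metis abs_mult abs_triangle_ineq mult.commute)
      also have "\<dots> \<le> B * \<bar>g t - g s\<bar> + C * \<bar>f t - f s\<bar>"
        using B C st by (intro add_mono mult_right_mono) auto
      finally show "\<bar>f t * g t - f s * g s\<bar> \<le> B * \<bar>g t - g s\<bar> + C * \<bar>f t - f s\<bar>" .
    qed
    also have "\<dots> = B * (\<Sum>(s, t)\<in>I. \<bar>g t - g s\<bar>) + C * (\<Sum>(s, t)\<in>I. \<bar>f t - f s\<bar>)"
      by (simp add: sum.distrib sum_distrib_left case_prod_unfold)
    also have "\<dots> < B * (\<epsilon> / (2 * B)) + C * (\<epsilon> / (2 * C))"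
      using B C ac_modulusD[OF \<delta>1(2) *(1,2,3)] ac_modulusD[OF \<delta>2(2) *(1,2,3)] *(4)
      by (intro add_strict_mono mult_strict_left_mono) auto
    also have "\<dots> = \<epsilon>" using B C by simp
    finally show "(\<Sum>(s, t)\<in>I. \<bar>f t * g t - f s * g s\<bar>) < \<epsilon>" .
  qed
qed

text \<open>For \<open>a \<le> b\<close> equivalent to: \<open>F\<close> is absolutely continuous on
  \<open>{a..b}\<close>, with \<open>F' = h\<close> almost everywhere and \<open>h\<close> Lebesgue
  integrable. Carrying the derivative as explicit data turns most later computations into algebra
  with integral identities.\<close>

definition primitive :: "real \<Rightarrow> real \<Rightarrow> (real \<Rightarrow> real) \<Rightarrow> (real \<Rightarrow> real) \<Rightarrow> bool" where
  "primitive a b F h \<longleftrightarrow> h absolutely_integrable_on {a..b} \<and>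
     (\<forall>x\<in>{a..b}. (h has_integral (F x - F a)) {a..x})"

lemma primitive_integral_eq:
  assumes "primitive a b F h" "x \<in> {a..b}"
  shows "F x = F a + integral {a..x} h"
proof -
  have "(h has_integral (F x - F a)) {a..x}" using assms by (auto simp: primitive_def)
  from integral_unique[OF this] show ?thesis by simp
qed

lemma primitive_abs_continuous_on:
  assumes "primitive a b F h"
  shows "abs_continuous_on a b F"
proof (rule abs_continuous_on_cong)
  have "abs_continuous_on a b (\<lambda>x. integral {a..x} h)"
    using assms by (intro abs_continuous_on_integral) (simp add: primitive_def)
  then show "abs_continuous_on a b (\<lambda>x. F a + integral {a..x} h)" by (simp add: abs_continuous_on_def)
  show "F a + integral {a..x} h = F x" if "x \<in> {a..b}" for x
    using primitive_integral_eq[OF assms that] by simp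
qed

lemma primitive_continuous_on:
  "primitive a b F h \<Longrightarrow> continuous_on {a..b} F"
  by (intro abs_continuous_on_imp_continuous_on primitive_abs_continuous_on)

lemma primitive_derivative:
  assumes "primitive a b F h"
  obtains N where "negligible N"
    "\<And>x. x \<in> {a..b} - N \<Longrightarrow> (F has_real_derivative h x) (at x within {a..b})"
proof -
  have "h integrable_on {a..b}"
    using assms absolutely_integrable_on_imp_integrable_on by (auto simp: primitive_def)
  then obtain N where N: "negligible N"
    "\<And>x. x \<in> {a..b} - N \<Longrightarrow> ((\<lambda>x. integral {a..x} h) has_real_derivative h x) (at x within {a..b})"
    using lebesgue_differentiation by blast
  show ?thesis
  proof (rule that[OF N(1)])
    fix x assume x: "x \<in> {a..b} - N"
    have "((\<lambda>x. F a + integral {a..x} h) has_real_derivative h x) (at x within {a..b})"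
      using N(2)[OF x] by (auto intro!: derivative_eq_intros)
    then show "(F has_real_derivative h x) (at x within {a..b})"
      by (rule has_field_derivative_transform_within[where d = 1])
        (use x in \<open>simp_all add: primitive_integral_eq[OF assms, symmetric]\<close>)
  qed
qed

text \<open>The derivative is given off a null set only; absolute continuity of \<open>F\<close> is
  what makes it determine the increments.\<close>

lemma abs_continuous_on_primitive:
  assumes ac: "abs_continuous_on a b F" and h: "h absolutely_integrable_on {a..b}" and N: "negligible N"
    and deriv: "\<And>x. x \<in> {a..b} - N \<Longrightarrow> (F has_real_derivative h x) (at x within {a..b})"
  shows "primitive a b F h"
  unfolding primitive_def
proof (intro conjI ballI h)
  fix x assume x: "x \<in> {a..b}"
  show "(h has_integral (F x - F a)) {a..x}"
  proof (rule abs_continuous_on_fundamental_theorem[OF _ _ N])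
    show "abs_continuous_on a x F" using abs_continuous_on_subinterval[OF ac] x by auto
    show "(F has_real_derivative h y) (at y within {a..x})" if "y \<in> {a..x} - N" for y
      using deriv[of y] that x by (auto intro: DERIV_subset)
  qed (use x in auto)
qed

lemma absolutely_integrable_mult_continuous:
  fixes f g :: "real \<Rightarrow> real"
  assumes "continuous_on {a..b} f" "g absolutely_integrable_on {a..b}"
  shows "(\<lambda>x. f x * g x) absolutely_integrable_on {a..b}"
    "(\<lambda>x. g x * f x) absolutely_integrable_on {a..b}"
proof -
  show "(\<lambda>x. f x * g x) absolutely_integrable_on {a..b}"
  proof (rule absolutely_integrable_bounded_measurable_product_real[OF _ _ _ assms(2)])
    show "f \<in> borel_measurable (lebesgue_on {a..b})"
      using assms(1) by (intro continuous_imp_measurable_on_sets_lebesgue) auto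
    show "bounded (f ` {a..b})"
      using assms(1) by (intro compact_imp_bounded compact_continuous_image) auto
  qed auto
  then show "(\<lambda>x. g x * f x) absolutely_integrable_on {a..b}" by (simp add: mult.commute)
qed

text \<open>The product rule holds off the two null sets that belong to \<open>F\<close> and
  \<open>G\<close>, and absolute continuity of the product turns it into an integral identity. This
  is the integration by parts behind the boundary identities below.\<close>

lemma primitive_mult:
  assumes F: "primitive a b F h" and G: "primitive a b G k"
  shows "primitive a b (\<lambda>x. F x * G x) (\<lambda>x. h x * G x + F x * k x)"
proof -
  obtain M where M: "negligible M" "\<And>x. x \<in> {a..b} - M \<Longrightarrow> (F has_real_derivative h x) (at x within {a..b})"
    using primitive_derivative[OF F] by blast
  obtain N where N: "negligible N" "\<And>x. x \<in> {a..b} - N \<Longrightarrow> (G has_real_derivative k x) (at x within {a..b})"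
    using primitive_derivative[OF G] by blast
  show ?thesis
  proof (rule abs_continuous_on_primitive[where N = "M \<union> N"])
    show "(\<lambda>x. h x * G x + F x * k x) absolutely_integrable_on {a..b}"
      using F G primitive_continuous_on[OF F] primitive_continuous_on[OF G]
      by (intro set_integral_add absolutely_integrable_mult_continuous) (auto simp: primitive_def)
    show "((\<lambda>x. F x * G x) has_real_derivative h x * G x + F x * k x) (at x within {a..b})"
      if "x \<in> {a..b} - (M \<union> N)" for x
      using that by (auto intro!: derivative_eq_intros M(2) N(2) simp: mult.commute)
  qed (use M N F G in \<open>auto intro: abs_continuous_on_mult primitive_abs_continuous_on\<close>)
qed

lemma primitive_add:
  assumes "primitive a b F h" "primitive a b G k"
  shows "primitive a b (\<lambda>x. F x + G x) (\<lambda>x. h x + k x)"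
  using assms unfolding primitive_def
  by (auto intro!: set_integral_add simp: add_diff_add has_integral_add)

lemma primitive_cmult:
  assumes "primitive a b F h"
  shows "primitive a b (\<lambda>x. c * F x) (\<lambda>x. c * h x)"
  using assms unfolding primitive_def
  by (auto intro!: absolutely_integrable_mult_continuous continuous_intros has_integral_mult_right
      simp: right_diff_distrib[symmetric])

lemma primitive_minus:
  "primitive a b F h \<Longrightarrow> primitive a b (\<lambda>x. - F x) (\<lambda>x. - h x)"
  using primitive_cmult[of a b F h "-1"] by simp

lemma primitive_diff:
  assumes "primitive a b F h" "primitive a b G k"
  shows "primitive a b (\<lambda>x. F x - G x) (\<lambda>x. h x - k x)"
  using primitive_add[OF assms(1) primitive_minus[OF assms(2)]] by simp

lemma primitive_cong:
  assumes "primitive a b F h" "\<And>x. x \<in> {a..b} \<Longrightarrow> F x = G x" "\<And>x. x \<in> {a..b} \<Longrightarrow> h x = k x"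
  shows "primitive a b G k"
  unfolding primitive_def
proof (intro conjI ballI)
  show "k absolutely_integrable_on {a..b}"
    by (rule absolutely_integrable_spike[where f = h and S = "{}"]) (use assms(1,3) in \<open>auto simp: primitive_def\<close>)
  fix x assume x: "x \<in> {a..b}"
  then have "(h has_integral (F x - F a)) {a..x}" using assms(1) by (auto simp: primitive_def)
  then have "(k has_integral (F x - F a)) {a..x}"
    by (rule has_integral_eq[rotated]) (use x assms(3) in auto)
  then show "(k has_integral (G x - G a)) {a..x}" using assms(2) x by auto
qed

lemma primitive_has_integral:
  assumes "primitive a b F h" "a \<le> b"
  shows "(h has_integral (F b - F a)) {a..b}"
  using assms by (auto simp: primitive_def)

lemma derivative_primitive:
  assumes "\<And>x. x \<in> {a..b} \<Longrightarrow> (F has_real_derivative h x) (at x within {a..b})" "continuous_on {a..b} h"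
  shows "primitive a b F h"
  unfolding primitive_def
proof (intro conjI ballI)
  show "h absolutely_integrable_on {a..b}" by (rule absolutely_integrable_continuous_real[OF assms(2)])
  fix x assume x: "x \<in> {a..b}"
  show "(h has_integral (F x - F a)) {a..x}"
  proof (rule fundamental_theorem_of_calculus)
    fix t assume "t \<in> {a..x}"
    then have "(F has_real_derivative h t) (at t within {a..x})"
      using x by (intro DERIV_subset[OF assms(1)]) auto
    then show "(F has_vector_derivative h t) (at t within {a..x})"
      by (simp add: has_real_derivative_iff_has_vector_derivative)
  qed (use x in auto)
qed

text \<open>A continuous \<open>h\<close> upgrades the almost-everywhere derivative to one at every
  point, end points included. The first derivative of a solution is of this kind, as
  \<open>edge_solution\<close> demands.\<close>

lemma primitive_continuous_derivative:
  assumes "primitive a b F h" "continuous_on {a..b} h" "x \<in> {a..b}"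
  shows "(F has_real_derivative h x) (at x within {a..b})"
proof -
  have "((\<lambda>x. integral {a..x} h) has_real_derivative h x) (at x within {a..b})"
    using integral_has_real_derivative assms by auto
  then have "((\<lambda>x. F a + integral {a..x} h) has_real_derivative h x) (at x within {a..b})"
    by (auto intro!: derivative_eq_intros)
  then show "(F has_real_derivative h x) (at x within {a..b})"
    by (rule has_field_derivative_transform_within[where d = 1])
        (use assms(3) in \<open>simp_all add: primitive_integral_eq[OF assms(1), symmetric]\<close>)
qed

lemma primitive_combine:
  assumes "primitive a b F h" "primitive b c F h" "a \<le> b" "b \<le> c"
  shows "primitive a c F h"
  unfolding primitive_def
proof (intro conjI ballI)
  show "h absolutely_integrable_on {a..c}"
    using assms set_integrable_Un[of lebesgue "{a..b}" h "{b..c}"]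
    by (auto simp: primitive_def ivl_disj_un)
  fix x assume x: "x \<in> {a..c}"
  show "(h has_integral (F x - F a)) {a..x}"
  proof (cases "x \<le> b")
    case True then show ?thesis using assms x by (auto simp: primitive_def)
  next
    case False
    then have "(h has_integral (F b - F a)) {a..b}" "(h has_integral (F x - F b)) {b..x}"
      using assms x by (auto simp: primitive_def)
    from has_integral_combine[OF _ _ this] show ?thesis using assms False by auto
  qed
qed

lemma primitive_subinterval:
  assumes "primitive a b F h" "a \<le> c" "c \<le> d" "d \<le> b"
  shows "primitive c d F h"
  unfolding primitive_def
proof (intro conjI ballI)
  show "h absolutely_integrable_on {c..d}"
    using assms by (auto simp: primitive_def intro: absolutely_integrable_on_subinterval)
  fix x assume x: "x \<in> {c..d}"
  have hi: "h integrable_on {a..x}" using assms x by (auto simp: primitive_def has_integral_integrable)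
  have "integral {a..c} h + integral {c..x} h = integral {a..x} h"
    using Henstock_Kurzweil_Integration.integral_combine[where f=h and a=a and c=c and b=x] assms x hi by auto
  moreover have "F x = F a + integral {a..x} h"
    by (rule primitive_integral_eq[OF assms(1)]) (use x assms in auto)
  moreover have "F c = F a + integral {a..c} h"
    by (rule primitive_integral_eq[OF assms(1)]) (use assms in auto)
  ultimately have "F x - F c = integral {c..x} h" by linarith
  moreover have "(h has_integral integral {c..x} h) {c..x}"
    using integrable_on_subinterval[OF hi, of c x] assms x by auto
  ultimately show "(h has_integral (F x - F c)) {c..x}" by simp
qed

section \<open>Bessel's inequality and the Riemann-Lebesgue lemma\<close>

lemma bessel_inequality:
  fixes e :: "nat \<Rightarrow> real \<Rightarrow> real"
  assumes c: "c > 0"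
    and orth: "\<And>i j. i \<noteq> j \<Longrightarrow> ((\<lambda>x. e i x * e j x) has_integral 0) S"
    and norm: "\<And>i. ((\<lambda>x. e i x * e i x) has_integral c) S"
    and f: "((\<lambda>x. f x * f x) has_integral A) S"
    and coef: "\<And>i. ((\<lambda>x. f x * e i x) has_integral \<alpha> i) S"
  shows "(\<Sum>i<n. (\<alpha> i)\<^sup>2) \<le> c * A"
proof -
  \<comment> \<open>\<open>R\<close> is \<open>f\<close> minus its projections on the first
    \<open>n\<close> functions: each projection lowers the square norm, and the later coefficients
    are unchanged by orthogonality. The common square norm \<open>c\<close> saves normalizing the
    cosines.\<close>
  have "\<exists>R. ((\<lambda>x. R x * R x) has_integral (A - (\<Sum>i<n. (\<alpha> i)\<^sup>2) / c)) S \<and>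
      (\<forall>m\<ge>n. ((\<lambda>x. R x * e m x) has_integral \<alpha> m) S)"
  proof (induction n)
    case 0
    then show ?case using f coef by auto
  next
    case (Suc n)
    then obtain R where R: "((\<lambda>x. R x * R x) has_integral (A - (\<Sum>i<n. (\<alpha> i)\<^sup>2) / c)) S"
      "\<And>m. m \<ge> n \<Longrightarrow> ((\<lambda>x. R x * e m x) has_integral \<alpha> m) S" by blast
    let ?R = "\<lambda>x. R x - \<alpha> n / c * e n x"
    have 1: "((\<lambda>x. R x * R x + (- 2 * \<alpha> n / c) * (R x * e n x) + (\<alpha> n / c)\<^sup>2 * (e n x * e n x)) has_integral
        (A - (\<Sum>i<n. (\<alpha> i)\<^sup>2) / c) + (- 2 * \<alpha> n / c) * \<alpha> n + (\<alpha> n / c)\<^sup>2 * c) S"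
      by (intro has_integral_add has_integral_mult_right R norm order_refl)
    have 2: "(A - (\<Sum>i<n. (\<alpha> i)\<^sup>2) / c) + (- 2 * \<alpha> n / c) * \<alpha> n + (\<alpha> n / c)\<^sup>2 * c
        = A - (\<Sum>i<Suc n. (\<alpha> i)\<^sup>2) / c"
      using c by (simp add: field_simps power2_eq_square)
    have 3: "(\<lambda>x. R x * R x + (- 2 * \<alpha> n / c) * (R x * e n x) + (\<alpha> n / c)\<^sup>2 * (e n x * e n x)) = (\<lambda>x. ?R x * ?R x)"
      by (simp add: algebra_simps power2_eq_square)
    have 4: "((\<lambda>x. ?R x * e m x) has_integral \<alpha> m) S" if "m \<ge> Suc n" for m
    proof -
      have "((\<lambda>x. R x * e m x + (- \<alpha> n / c) * (e n x * e m x)) has_integral (\<alpha> m + (- \<alpha> n / c) * 0)) S"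
        using that by (intro has_integral_add has_integral_mult_right R orth) auto
      then show ?thesis by (simp add: algebra_simps)
    qed
    show ?case using 1[unfolded 2 3] 4 by (intro exI[of _ ?R] conjI allI impI)
  qed
  then obtain R where "((\<lambda>x. R x * R x) has_integral (A - (\<Sum>i<n. (\<alpha> i)\<^sup>2) / c)) S" by blast
  then have "0 \<le> A - (\<Sum>i<n. (\<alpha> i)\<^sup>2) / c" by (rule has_integral_nonneg) simp
  then show ?thesis using c by (simp add: field_simps)
qed

lemma cos_even_multiple_has_integral:
  fixes m :: int
  assumes "m \<noteq> 0"
  shows "((\<lambda>x. cos (2 * of_int m * pi * x)) has_integral 0) {0..real n}"
proof -
  have "((\<lambda>x. cos (2 * of_int m * pi * x)) has_integral
      (sin (2 * of_int m * pi * real n) / (2 * of_int m * pi) - sin (2 * of_int m * pi * 0) / (2 * of_int m * pi))) {0..real n}"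
    using assms by (intro fundamental_theorem_of_calculus)
      (auto intro!: derivative_eq_intros simp: has_real_derivative_iff_has_vector_derivative[symmetric])
  moreover have "sin (2 * of_int m * pi * real n) = sin (of_int (2 * m * int n) * pi)"
    by (simp add: mult_ac)
  moreover have "sin (of_int (2 * m * int n) * pi) = 0"
    by (metis mult.commute sin_integer_2pi sin_npi_int mult.assoc)
  ultimately show ?thesis by simp
qed

lemma cos_odd_orthogonal:
  "((\<lambda>x. cos (2 * (2 * real i + 1) * pi * x) * cos (2 * (2 * real j + 1) * pi * x)) has_integral
     (if i = j then real n / 2 else 0)) {0..real n}"
proof -
  let ?p = "int (2 * i + 1) + int (2 * j + 1)" and ?m = "int (2 * i + 1) - int (2 * j + 1)"
  have eq: "cos (2 * (2 * real i + 1) * pi * x) * cos (2 * (2 * real j + 1) * pi * x) =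
      1/2 * cos (2 * of_int ?m * pi * x) + 1/2 * cos (2 * of_int ?p * pi * x)" for x
    by (simp add: cos_times_cos algebra_simps)
  have p: "((\<lambda>x. cos (2 * of_int ?p * pi * x)) has_integral 0) {0..real n}"
    by (rule cos_even_multiple_has_integral) simp
  have m: "((\<lambda>x. cos (2 * of_int ?m * pi * x)) has_integral (if i = j then real n else 0)) {0..real n}"
  proof (cases "i = j")
    case True
    then show ?thesis using has_integral_const_real[of "1::real" 0 "real n"] by simp
  next
    case False
    then have "?m \<noteq> 0" by simp
    then show ?thesis using cos_even_multiple_has_integral[of ?m n] False by presburger
  qed
  show ?thesis unfolding eq
    using has_integral_add[OF has_integral_mult_right[OF m, of "1/2"] has_integral_mult_right[OF p, of "1/2"]]
    by (auto split: if_splits)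
qed

text \<open>Bessel's inequality asks for square integrability, which an integrable \<open>q\<close>
  may lack; so it is applied to the truncations \<open>t N\<close>, which converge to
  \<open>q\<close> in mean. The frequencies are twice \<open>(2 k + 1) \<pi>\<close>, as they arise
  from squared sines.\<close>

lemma riemann_lebesgue_cos:
  fixes q :: "real \<Rightarrow> real"
  assumes n: "n > 0" and q: "q absolutely_integrable_on {0..real n}"
  shows "(\<lambda>k. integral {0..real n} (\<lambda>x. q x * cos (2 * (2 * real k + 1) * pi * x))) \<longlonglongrightarrow> 0"
proof -
  let ?S = "{0..real n}"
  define e where "e k x = cos (2 * (2 * real k + 1) * pi * x)" for k x
  have ce: "continuous_on ?S (e k)" for k by (auto simp: e_def intro!: continuous_intros)
  define t where "t N x = max (- real N) (min (real N) (q x))" for N x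
  have tai: "t N absolutely_integrable_on ?S" for N
    unfolding t_def by (intro absolutely_integrable_max_1 absolutely_integrable_min_1 q) auto
  have t0: "(\<lambda>k. integral ?S (\<lambda>x. t N x * e k x)) \<longlonglongrightarrow> 0" for N
  proof -
    have "t N \<in> borel_measurable (lebesgue_on ?S)"
      using tai by (simp add: absolutely_integrable_measurable)
    moreover have "bounded (t N ` ?S)"
      unfolding bounded_iff by (intro exI[of _ "real N"]) (auto simp: t_def)
    ultimately have "(\<lambda>x. t N x * t N x) absolutely_integrable_on ?S"
      by (intro absolutely_integrable_bounded_measurable_product_real tai) auto
    then obtain A where A: "((\<lambda>x. t N x * t N x) has_integral A) ?S"
      using absolutely_integrable_on_imp_integrable_on by (auto simp: integrable_on_def)
    have co: "((\<lambda>x. t N x * e i x) has_integral integral ?S (\<lambda>x. t N x * e i x)) ?S" for i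
      using absolutely_integrable_mult_continuous(2)[OF ce tai] absolutely_integrable_on_imp_integrable_on by blast
    have "(\<Sum>i<m. (integral ?S (\<lambda>x. t N x * e i x))\<^sup>2) \<le> real n / 2 * A" for m
    proof (rule bessel_inequality[OF _ _ _ A co])
      show "((\<lambda>x. e i x * e j x) has_integral 0) ?S" if "i \<noteq> j" for i j
        using cos_odd_orthogonal[of i j n] that by (simp add: e_def)
      show "((\<lambda>x. e i x * e i x) has_integral real n / 2) ?S" for i
        using cos_odd_orthogonal[of i i n] by (simp add: e_def)
    qed (use n in auto)
    then have "summable (\<lambda>i. (integral ?S (\<lambda>x. t N x * e i x))\<^sup>2)"
      by (intro summableI_nonneg_bounded[where x = "real n / 2 * A"]) auto
    then have "(\<lambda>i. (integral ?S (\<lambda>x. t N x * e i x))\<^sup>2) \<longlonglongrightarrow> 0" by (rule summable_LIMSEQ_zero)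
    then have "(\<lambda>i. sqrt ((integral ?S (\<lambda>x. t N x * e i x))\<^sup>2)) \<longlonglongrightarrow> sqrt 0" by (rule tendsto_real_sqrt)
    then show ?thesis by (simp add: tendsto_rabs_zero_iff)
  qed
  have d0: "(\<lambda>N. integral ?S (\<lambda>x. \<bar>q x - t N x\<bar>)) \<longlonglongrightarrow> integral ?S (\<lambda>x. 0::real)"
  proof (rule dominated_convergence(2)[where h = "\<lambda>x. \<bar>q x\<bar>"])
    show "(\<lambda>x. \<bar>q x - t N x\<bar>) integrable_on ?S" for N
      using set_integral_diff(1)[OF q tai[of N]] by (simp add: absolutely_integrable_on_def)
    show "(\<lambda>x. \<bar>q x\<bar>) integrable_on ?S" using q by (simp add: absolutely_integrable_on_def)
    show "norm \<bar>q x - t N x\<bar> \<le> \<bar>q x\<bar>" for N x by (auto simp: t_def)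
    show "(\<lambda>N. \<bar>q x - t N x\<bar>) \<longlonglongrightarrow> 0" for x
    proof (rule tendsto_eventually)
      obtain N where "\<bar>q x\<bar> \<le> real N" using real_arch_simple by blast
      then show "\<forall>\<^sub>F n in sequentially. \<bar>q x - t n x\<bar> = 0"
        unfolding eventually_sequentially t_def by (intro exI[of _ N]) auto
    qed
  qed
  show ?thesis unfolding LIMSEQ_iff e_def[symmetric]
  proof (intro allI impI)
    fix \<epsilon> :: real assume \<epsilon>: "\<epsilon> > 0"
    have "\<forall>\<^sub>F N in sequentially. integral ?S (\<lambda>x. \<bar>q x - t N x\<bar>) < \<epsilon> / 2"
      using order_tendstoD(2)[OF d0, of "\<epsilon> / 2"] \<epsilon> by simp
    then obtain N where N: "integral ?S (\<lambda>x. \<bar>q x - t N x\<bar>) < \<epsilon> / 2"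
      using eventually_happens'[OF sequentially_bot] by blast
    obtain M where M: "\<And>k. k \<ge> M \<Longrightarrow> \<bar>integral ?S (\<lambda>x. t N x * e k x)\<bar> < \<epsilon> / 2"
      using t0[of N, unfolded LIMSEQ_iff, rule_format, of "\<epsilon> / 2"] \<epsilon> by auto
    show "\<exists>M. \<forall>k\<ge>M. norm (integral ?S (\<lambda>x. q x * e k x) - 0) < \<epsilon>"
    proof (intro exI[of _ M] allI impI)
      fix k assume k: "k \<ge> M"
      have qt: "(\<lambda>x. q x - t N x) absolutely_integrable_on ?S" by (rule set_integral_diff(1)[OF q tai])
      have i1: "(\<lambda>x. t N x * e k x) integrable_on ?S" "(\<lambda>x. (q x - t N x) * e k x) integrable_on ?S"
        using absolutely_integrable_mult_continuous(2)[OF ce tai] absolutely_integrable_mult_continuous(2)[OF ce qt]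
          absolutely_integrable_on_imp_integrable_on by blast+
      have "integral ?S (\<lambda>x. q x * e k x) = integral ?S (\<lambda>x. t N x * e k x) + integral ?S (\<lambda>x. (q x - t N x) * e k x)"
        by (subst integral_add[OF i1, symmetric]) (simp add: algebra_simps)
      moreover have "norm (integral ?S (\<lambda>x. (q x - t N x) * e k x)) \<le> integral ?S (\<lambda>x. \<bar>q x - t N x\<bar>)"
        using qt i1 by (intro integral_norm_bound_integral)
          (auto simp: absolutely_integrable_on_def abs_mult e_def intro!: mult_left_le)
      ultimately show "norm (integral ?S (\<lambda>x. q x * e k x) - 0) < \<epsilon>"
        using M[OF k] N by simp
    qed
  qed
qed

section \<open>The Hill system\<close>

lemma picard_increment_bound:
  fixes e :: "real \<Rightarrow> 'a::banach"
  assumes e: "\<And>t. t \<in> {0..x} \<Longrightarrow> norm (e t) \<le> M * (C * (M * t) ^ n / fact n)" and "continuous_on {0..x} e" "0 \<le> x"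
  shows "norm (integral {0..x} e) \<le> C * (M * x) ^ Suc n / fact (Suc n)"
proof -
  have "((\<lambda>t. M * (C * (M * t) ^ n / fact n)) has_integral
      (C * (M * x) ^ Suc n / fact (Suc n) - C * (M * 0) ^ Suc n / fact (Suc n))) {0..x}"
  proof (rule fundamental_theorem_of_calculus)
    fix t
    have "((\<lambda>t. C * (M * t) ^ Suc n / fact (Suc n)) has_real_derivative
        C * (real (Suc n) * (M * t) ^ n * M) / fact (Suc n)) (at t within {0..x})"
      by (auto intro!: derivative_eq_intros simp del: power_Suc)
    moreover have "C * (real (Suc n) * (M * t) ^ n * M) / fact (Suc n) = M * (C * (M * t) ^ n / fact n)"
      by (simp add: field_simps del: of_nat_Suc)
    ultimately show "((\<lambda>t. C * (M * t) ^ Suc n / fact (Suc n)) has_vector_derivative M * (C * (M * t) ^ n / fact n)) (at t within {0..x})"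
      by (simp only: has_real_derivative_iff_has_vector_derivative)
  qed (use assms in auto)
  then have hi: "((\<lambda>t. M * (C * (M * t) ^ n / fact n)) has_integral C * (M * x) ^ Suc n / fact (Suc n)) {0..x}"
    by simp
  have "norm (integral {0..x} e) \<le> integral {0..x} (\<lambda>t. M * (C * (M * t) ^ n / fact n))"
    using assms(1,2) has_integral_integrable[OF hi]
    by (intro integral_norm_bound_integral integrable_continuous_real[of _ _ e])
  then show ?thesis using integral_unique[OF hi] by simp
qed

text \<open>A global Lipschitz constant lets the Picard iterates converge on all of
  \<open>{0..L}\<close> at once: by induction the increments are dominated by the terms of the
  series of \<open>exp (M * L)\<close>, so the Weierstrass test applies.\<close>

lemma lipschitz_ode_exists:
  fixes A :: "real \<Rightarrow> 'a::banach \<Rightarrow> 'a"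
  assumes "0 \<le> L" "0 \<le> M"
    and lip: "\<And>x u v. x \<in> {0..L} \<Longrightarrow> norm (A x u - A x v) \<le> M * norm (u - v)"
    and cont: "\<And>X. continuous_on {0..L} X \<Longrightarrow> continuous_on {0..L} (\<lambda>x. A x (X x))"
  obtains X where "X 0 = x0"
    "\<And>x. x \<in> {0..L} \<Longrightarrow> (X has_vector_derivative A x (X x)) (at x within {0..L})"
proof -
  define P where "P = rec_nat (\<lambda>_. x0) (\<lambda>_ X x. x0 + integral {0..x} (\<lambda>t. A t (X t)))"
  have P0: "P 0 = (\<lambda>_. x0)" and PS: "P (Suc n) = (\<lambda>x. x0 + integral {0..x} (\<lambda>t. A t (P n t)))" for n
    by (simp_all add: P_def)
  have intcont: "continuous_on {0..L} (\<lambda>x. x0 + integral {0..x} (\<lambda>t. A t (X t)))" if "continuous_on {0..L} X" for X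
    using cont[OF that] by (intro continuous_intros indefinite_integral_continuous_1 integrable_continuous_real)
  have Pc: "continuous_on {0..L} (P n)" for n
    by (induction n) (simp_all add: P0 PS intcont)
  have "bounded ((\<lambda>x. P (Suc 0) x - P 0 x) ` {0..L})"
    using Pc by (intro compact_imp_bounded compact_continuous_image continuous_intros) auto
  then obtain C where C: "C > 0" "\<And>x. x \<in> {0..L} \<Longrightarrow> norm (P (Suc 0) x - P 0 x) \<le> C"
    by (auto simp: bounded_pos)
  have incr: "norm (P (Suc n) x - P n x) \<le> C * (M * x) ^ n / fact n" if "x \<in> {0..L}" for n x
    using that
  proof (induction n arbitrary: x)
    case 0
    then show ?case using C by simp
  next
    case (Suc n)
    have c: "continuous_on {0..x} (\<lambda>t. A t (P k t))" for k
      by (rule continuous_on_subset[OF cont[OF Pc]]) (use Suc.prems in auto)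
    have "P (Suc (Suc n)) x - P (Suc n) x = integral {0..x} (\<lambda>t. A t (P (Suc n) t)) - integral {0..x} (\<lambda>t. A t (P n t))"
      by (subst (1 2) PS) simp
    also have "\<dots> = integral {0..x} (\<lambda>t. A t (P (Suc n) t) - A t (P n t))"
      using c by (intro integral_diff[symmetric] integrable_continuous_real)
    finally have "norm (P (Suc (Suc n)) x - P (Suc n) x) = norm (integral {0..x} (\<lambda>t. A t (P (Suc n) t) - A t (P n t)))"
      by simp
    also have "\<dots> \<le> C * (M * x) ^ Suc n / fact (Suc n)"
    proof (rule picard_increment_bound)
      fix t assume t: "t \<in> {0..x}"
      then have tL: "t \<in> {0..L}" using Suc.prems by auto
      have "norm (A t (P (Suc n) t) - A t (P n t)) \<le> M * norm (P (Suc n) t - P n t)" by (rule lip[OF tL])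
      also have "\<dots> \<le> M * (C * (M * t) ^ n / fact n)" using Suc.IH[OF tL] assms by (intro mult_left_mono) auto
      finally show "norm (A t (P (Suc n) t) - A t (P n t)) \<le> M * (C * (M * t) ^ n / fact n)" .
    qed (use c Suc.prems in \<open>auto intro: continuous_intros\<close>)
    finally show ?case .
  qed
  define X where "X x = x0 + (\<Sum>n. P (Suc n) x - P n x)" for x
  have "uniform_limit {0..L} (\<lambda>n x. \<Sum>i<n. P (Suc i) x - P i x) (\<lambda>x. \<Sum>n. P (Suc n) x - P n x) sequentially"
  proof (rule Weierstrass_m_test)
    show "norm (P (Suc n) x - P n x) \<le> C * ((M * L) ^ n / fact n)" if "x \<in> {0..L}" for n x
    proof -
      have "C * (M * x) ^ n / fact n \<le> C * (M * L) ^ n / fact n"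
        using that C assms by (intro divide_right_mono mult_left_mono power_mono) (auto intro: mult_left_mono)
      then show ?thesis using incr[OF that, of n] by simp
    qed
    show "summable (\<lambda>n. C * ((M * L) ^ n / fact n))"
      using summable_exp_generic[of "M * L"] by (intro summable_mult) (simp add: divide_inverse mult.commute)
  qed
  then have "uniform_limit {0..L} (\<lambda>n x. x0 + (\<Sum>i<n. P (Suc i) x - P i x)) X sequentially"
    unfolding X_def by (intro uniform_limit_intros)
  moreover have "x0 + (\<Sum>i<n. P (Suc i) x - P i x) = P n x" for n x
    using sum_lessThan_telescope[of "\<lambda>i. P i x" n] by (simp add: P0)
  ultimately have ul: "uniform_limit {0..L} P X sequentially" by simp
  have Xc: "continuous_on {0..L} X"
    by (rule uniform_limit_theorem[OF _ ul]) (auto simp: Pc)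
  have fixp: "X x = x0 + integral {0..x} (\<lambda>t. A t (X t))" if x: "x \<in> {0..L}" for x
  proof (rule LIMSEQ_unique)
    show "(\<lambda>n. P (Suc n) x) \<longlonglongrightarrow> X x"
      using tendsto_uniform_limitI[OF ul x] by (rule LIMSEQ_Suc)
    show "(\<lambda>n. P (Suc n) x) \<longlonglongrightarrow> x0 + integral {0..x} (\<lambda>t. A t (X t))"
      unfolding LIMSEQ_iff
    proof (intro allI impI)
      fix \<epsilon> :: real assume \<epsilon>: "\<epsilon> > 0"
      \<comment> \<open>Chosen for \<open>M * L * \<eta> < \<epsilon>\<close>; the summand 1 covers
        \<open>M * L = 0\<close>.\<close>
      define \<eta> where "\<eta> = \<epsilon> / (M * L + 1)"
      have prod_nonneg: "M * L \<ge> 0" using assms by simp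
      have \<eta>: "\<eta> > 0" using \<epsilon> prod_nonneg by (auto simp: \<eta>_def)
      have "M * L * \<eta> < (M * L + 1) * \<eta>" using \<eta> by (simp add: algebra_simps)
      also have "\<dots> = \<epsilon>" using prod_nonneg by (simp add: \<eta>_def)
      finally have \<eta>': "M * L * \<eta> < \<epsilon>" .
      obtain N where "\<forall>n\<ge>N. \<forall>t\<in>{0..L}. dist (P n t) (X t) < \<eta>"
        using uniform_limitD[OF ul \<eta>] unfolding eventually_sequentially by blast
      then have N: "norm (P n t - X t) < \<eta>" if "n \<ge> N" "t \<in> {0..L}" for n t
        using that by (simp add: dist_norm)
      show "\<exists>N. \<forall>n\<ge>N. norm (P (Suc n) x - (x0 + integral {0..x} (\<lambda>t. A t (X t)))) < \<epsilon>"
      proof (intro exI[of _ N] allI impI)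
        fix n assume n: "n \<ge> N"
        have c: "continuous_on {0..x} (\<lambda>t. A t (P n t))" "continuous_on {0..x} (\<lambda>t. A t (X t))"
          by (rule continuous_on_subset[OF cont[OF Pc]], use x in force)
            (rule continuous_on_subset[OF cont[OF Xc]], use x in force)
        have "P (Suc n) x - (x0 + integral {0..x} (\<lambda>t. A t (X t))) = integral {0..x} (\<lambda>t. A t (P n t) - A t (X t))"
          using c by (subst integral_diff) (auto intro: integrable_continuous_real simp: PS)
        also have "norm \<dots> \<le> (M * \<eta>) * (x - 0)"
        proof (rule integral_bound)
          fix t assume "t \<in> {0..x}"
          then have t: "t \<in> {0..L}" using x by auto
          show "norm (A t (P n t) - A t (X t)) \<le> M * \<eta>"
            using order_trans[OF lip[OF t] mult_left_mono[OF less_imp_le[OF N[OF n t]] assms(2)]] .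
        qed (use x c in \<open>auto intro: continuous_intros\<close>)
        also have "\<dots> \<le> (M * \<eta>) * L" using x assms \<eta> by (intro mult_left_mono) auto
        also have "\<dots> < \<epsilon>" using \<eta>' by (simp add: mult_ac)
        finally show "norm (P (Suc n) x - (x0 + integral {0..x} (\<lambda>t. A t (X t)))) < \<epsilon>" .
      qed
    qed
  qed
  show ?thesis
  proof (rule that[of X])
    show "X 0 = x0" using fixp[of 0] assms by simp
    fix x assume x: "x \<in> {0..L}"
    have "((\<lambda>u. integral {0..u} (\<lambda>t. A t (X t))) has_vector_derivative A x (X x)) (at x within {0..L})"
      using integral_has_vector_derivative[OF cont[OF Xc] x] .
    then have "((\<lambda>u. x0 + integral {0..u} (\<lambda>t. A t (X t))) has_vector_derivative A x (X x)) (at x within {0..L})"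
      by (auto intro!: derivative_eq_intros)
    then show "(X has_vector_derivative A x (X x)) (at x within {0..L})"
      by (rule has_vector_derivative_transform[OF x, rotated]) (use fixp in auto)
  qed
qed

lemma deriv_nonneg_within_imp_mono:
  fixes f f' :: "real \<Rightarrow> real"
  assumes d: "\<And>x. x \<in> {a..b} \<Longrightarrow> (f has_real_derivative f' x) (at x within {a..b})"
    and n: "\<And>x. x \<in> {a..b} \<Longrightarrow> 0 \<le> f' x" and "a \<le> x" "x \<le> y" "y \<le> b"
  shows "f x \<le> f y"
proof (rule DERIV_nonneg_imp_increasing_open[OF \<open>x \<le> y\<close>])
  fix t assume t: "x < t" "t < y"
  then show "\<exists>s. DERIV f t :> s \<and> 0 \<le> s"
    using d[of t] n[of t] assms by (auto simp: at_within_Icc_at)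
next
  have "continuous_on {a..b} f" using d DERIV_continuous continuous_on_eq_continuous_within by blast
  then show "continuous_on {x..y} f" by (rule continuous_on_subset) (use assms in auto)
qed

lemma deriv_pos_within_imp_strict_mono:
  fixes f f' :: "real \<Rightarrow> real"
  assumes d: "\<And>x. x \<in> {a..b} \<Longrightarrow> (f has_real_derivative f' x) (at x within {a..b})"
    and n: "\<And>x. x \<in> {a..b} \<Longrightarrow> 0 < f' x" and "a \<le> x" "x < y" "y \<le> b"
  shows "f x < f y"
proof (rule DERIV_pos_imp_increasing_open[OF \<open>x < y\<close>])
  fix t assume t: "x < t" "t < y"
  then show "\<exists>s. DERIV f t :> s \<and> 0 < s"
    using d[of t] n[of t] assms by (auto simp: at_within_Icc_at)
next
  have "continuous_on {a..b} f" using d DERIV_continuous continuous_on_eq_continuous_within by blast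
  then show "continuous_on {x..y} f" by (rule continuous_on_subset) (use assms in auto)
qed

text \<open>With \<open>g\<close> an antiderivative of the potential \<open>q\<close> and \<open>z = y' - g y\<close> the equation
  \<open>- y'' + q y = \<lambda> y\<close> becomes a first order system with continuous coefficients.\<close>

definition hill_solution :: "real \<Rightarrow> (real \<Rightarrow> real) \<Rightarrow> real \<Rightarrow> (real \<Rightarrow> real) \<Rightarrow> (real \<Rightarrow> real) \<Rightarrow> bool" where
  "hill_solution L g lam y z \<longleftrightarrow> (\<forall>x\<in>{0..L}.
     (y has_real_derivative g x * y x + z x) (at x within {0..L}) \<and>
     (z has_real_derivative - (lam + (g x)\<^sup>2) * y x - g x * z x) (at x within {0..L}))"

lemma hill_solutionD:
  assumes "hill_solution L g lam y z" "x \<in> {0..L}"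
  shows "(y has_real_derivative g x * y x + z x) (at x within {0..L})"
    and "(z has_real_derivative - (lam + (g x)\<^sup>2) * y x - g x * z x) (at x within {0..L})"
  using assms by (auto simp: hill_solution_def)

lemma hill_solution_continuous_on:
  assumes "hill_solution L g lam y z"
  shows "continuous_on {0..L} y" "continuous_on {0..L} z"
  using hill_solutionD[OF assms] DERIV_continuous continuous_on_eq_continuous_within by blast+

lemma hill_solution_exists:
  assumes L: "0 \<le> L" and g: "continuous_on {0..L} g"
  obtains y z where "hill_solution L g lam y z" "y 0 = y0" "z 0 = z0"
proof -
  have "bounded (g ` {0..L})" using g by (intro compact_imp_bounded compact_continuous_image) auto
  then obtain B where B: "B > 0" "\<And>x. x \<in> {0..L} \<Longrightarrow> \<bar>g x\<bar> \<le> B" by (auto simp: bounded_pos)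
  define A where "A x = (\<lambda>(y, z). (g x * y + z, - (lam + (g x)\<^sup>2) * y - g x * z))" for x
  \<comment> \<open>Total of the coefficient bounds of the two components: \<open>B + 1\<close> from
    the first, \<open>\<bar>lam\<bar> + B\<^sup>2 + B\<close> from the second.\<close>
  define M where "M = 2 * B + 1 + \<bar>lam\<bar> + B\<^sup>2"
  have "norm (A x u - A x v) \<le> M * norm (u - v)" if x: "x \<in> {0..L}" for x u v
  proof -
    obtain y1 z1 y2 z2 where uv: "u = (y1, z1)" "v = (y2, z2)" by (cases u, cases v) auto
    define y z where "y = y1 - y2" and "z = z1 - z2"
    have eq: "A x u - A x v = (g x * y + z, - (lam + (g x)\<^sup>2) * y - g x * z)"
      by (simp add: A_def uv y_def z_def algebra_simps)
    have yz: "\<bar>y\<bar> \<le> norm (u - v)" "\<bar>z\<bar> \<le> norm (u - v)"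
      using norm_fst_le[of y z] norm_snd_le[of z y] by (simp_all add: uv y_def z_def)
    have g1: "\<bar>g x\<bar> \<le> B" "(g x)\<^sup>2 \<le> B\<^sup>2" using B x by (auto intro: abs_le_square_iff[THEN iffD1] power2_mono simp: abs_le_square_iff[symmetric])
    have "norm (A x u - A x v) \<le> \<bar>g x * y + z\<bar> + \<bar>- (lam + (g x)\<^sup>2) * y - g x * z\<bar>"
      unfolding eq using norm_Pair_le[of "g x * y + z" "- (lam + (g x)\<^sup>2) * y - g x * z"]
      by (simp only: real_norm_def)
    also have "\<dots> \<le> (\<bar>g x\<bar> * \<bar>y\<bar> + \<bar>z\<bar>) + ((\<bar>lam\<bar> + (g x)\<^sup>2) * \<bar>y\<bar> + \<bar>g x\<bar> * \<bar>z\<bar>)"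
    proof (intro add_mono)
      show "\<bar>g x * y + z\<bar> \<le> \<bar>g x\<bar> * \<bar>y\<bar> + \<bar>z\<bar>" by (metis abs_mult abs_triangle_ineq)
      have "\<bar>- (lam + (g x)\<^sup>2) * y - g x * z\<bar> \<le> \<bar>lam + (g x)\<^sup>2\<bar> * \<bar>y\<bar> + \<bar>g x\<bar> * \<bar>z\<bar>"
        by (metis abs_minus_cancel abs_mult abs_triangle_ineq4)
      also have "\<dots> \<le> (\<bar>lam\<bar> + (g x)\<^sup>2) * \<bar>y\<bar> + \<bar>g x\<bar> * \<bar>z\<bar>"
        using abs_triangle_ineq[of lam "(g x)\<^sup>2"] by (intro add_right_mono mult_right_mono) auto
      finally show "\<bar>- (lam + (g x)\<^sup>2) * y - g x * z\<bar> \<le> (\<bar>lam\<bar> + (g x)\<^sup>2) * \<bar>y\<bar> + \<bar>g x\<bar> * \<bar>z\<bar>" .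
    qed
    also have "\<dots> \<le> (B * norm (u - v) + norm (u - v)) + ((\<bar>lam\<bar> + B\<^sup>2) * norm (u - v) + B * norm (u - v))"
      using yz g1 B by (intro add_mono mult_mono) auto
    also have "\<dots> = M * norm (u - v)" by (simp add: M_def algebra_simps)
    finally show ?thesis .
  qed
  moreover have "continuous_on {0..L} (\<lambda>x. A x (X x))" if "continuous_on {0..L} X" for X
    unfolding A_def case_prod_unfold using that g by (intro continuous_intros)
  moreover have "0 \<le> M" using B by (simp add: M_def)
  ultimately obtain X where X: "X 0 = (y0, z0)"
    "\<And>x. x \<in> {0..L} \<Longrightarrow> (X has_vector_derivative A x (X x)) (at x within {0..L})"
    using lipschitz_ode_exists[OF L, of M A "(y0, z0)"] by blast
  show ?thesis
  proof (rule that[of "\<lambda>x. fst (X x)" "\<lambda>x. snd (X x)"])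
    show "hill_solution L g lam (\<lambda>x. fst (X x)) (\<lambda>x. snd (X x))"
      unfolding hill_solution_def has_real_derivative_iff_has_vector_derivative
    proof
      fix x assume x: "x \<in> {0..L}"
      have "((\<lambda>x. fst (X x)) has_vector_derivative fst (A x (X x))) (at x within {0..L})"
        "((\<lambda>x. snd (X x)) has_vector_derivative snd (A x (X x))) (at x within {0..L})"
        using bounded_linear.has_vector_derivative[OF bounded_linear_fst X(2)[OF x]]
          bounded_linear.has_vector_derivative[OF bounded_linear_snd X(2)[OF x]] .
      then show "((\<lambda>x. fst (X x)) has_vector_derivative g x * fst (X x) + snd (X x)) (at x within {0..L}) \<and>
         ((\<lambda>x. snd (X x)) has_vector_derivative - (lam + (g x)\<^sup>2) * fst (X x) - g x * snd (X x)) (at x within {0..L})"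
        by (simp add: A_def case_prod_unfold)
    qed
  qed (simp_all add: X)
qed

text \<open>Gronwall's inequality for \<open>d\<^sup>2 + e\<^sup>2\<close>, where
  \<open>(d, e)\<close> solves the Hill system with zero initial values and the forcing
  \<open>- \<delta> * r\<close>. The bound is quadratic in \<open>\<delta>\<close>, which will yield
  Lipschitz dependence on the spectral parameter.\<close>

lemma hill_energy_bound:
  assumes L: "0 \<le> L"
    and d: "\<And>x. x \<in> {0..L} \<Longrightarrow> (d has_real_derivative g x * d x + e x) (at x within {0..L})"
    and e: "\<And>x. x \<in> {0..L} \<Longrightarrow> (e has_real_derivative - (lam + (g x)\<^sup>2) * d x - g x * e x - \<delta> * r x) (at x within {0..L})"
    and init: "d 0 = 0" "e 0 = 0"
    and bounds: "\<And>x. x \<in> {0..L} \<Longrightarrow> \<bar>g x\<bar> \<le> B" "\<And>x. x \<in> {0..L} \<Longrightarrow> \<bar>r x\<bar> \<le> R" "\<bar>lam\<bar> \<le> \<Lambda>"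
    and x: "x \<in> {0..L}"
  shows "(d x)\<^sup>2 + (e x)\<^sup>2 \<le> exp ((2 * B + 2 + \<Lambda> + B\<^sup>2) * L) * (\<delta>\<^sup>2 * R\<^sup>2 * L)"
proof -
  \<comment> \<open>\<open>2 * B\<close> comes from the diagonal coefficients \<open>g\<close> and
    \<open>- g\<close>, \<open>1 + \<Lambda> + B\<^sup>2\<close> from the cross term in
    \<open>d\<close> and \<open>e\<close>, and another 1 from splitting off the forcing.\<close>
  define \<kappa> where "\<kappa> = 2 * B + 2 + \<Lambda> + B\<^sup>2"
  have B0: "0 \<le> B" using bounds(1)[of 0] L by auto
  have \<kappa>: "\<kappa> \<ge> 0" using B0 bounds(3) by (simp add: \<kappa>_def)
  define E where "E x = (d x)\<^sup>2 + (e x)\<^sup>2" for x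
  define E' where "E' x = 2 * d x * (g x * d x + e x) + 2 * e x * (- (lam + (g x)\<^sup>2) * d x - g x * e x - \<delta> * r x)" for x
  have E'_le: "E' x \<le> \<kappa> * E x + \<delta>\<^sup>2 * R\<^sup>2" if x: "x \<in> {0..L}" for x
  proof -
    have g1: "\<bar>g x\<bar> \<le> B" using bounds x by auto
    then have g2: "(g x)\<^sup>2 \<le> B\<^sup>2" using abs_le_square_iff[of "g x" B] B0 by simp
    have r2: "(r x)\<^sup>2 \<le> R\<^sup>2" using abs_le_square_iff[of "r x" R] bounds(2)[OF x] by force
    have a: "2 * g x * ((d x)\<^sup>2 - (e x)\<^sup>2) \<le> 2 * B * E x"
    proof -
      have "2 * g x * ((d x)\<^sup>2 - (e x)\<^sup>2) \<le> 2 * (\<bar>g x\<bar> * \<bar>(d x)\<^sup>2 - (e x)\<^sup>2\<bar>)"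
        by (metis abs_ge_self abs_mult mult.assoc mult_left_mono zero_le_numeral)
      also have "\<dots> \<le> 2 * (B * E x)"
        using g1 B0 by (intro mult_left_mono mult_mono) (auto simp: E_def abs_le_iff)
      finally show ?thesis by simp
    qed
    have b: "2 * d x * e x * (1 - lam - (g x)\<^sup>2) \<le> (1 + \<Lambda> + B\<^sup>2) * E x"
    proof -
      have "2 * d x * e x * (1 - lam - (g x)\<^sup>2) \<le> \<bar>2 * d x * e x\<bar> * \<bar>1 - lam - (g x)\<^sup>2\<bar>"
        by (metis abs_ge_self abs_mult)
      also have "\<bar>2 * d x * e x\<bar> \<le> E x"
        using sum_squares_bound[of "\<bar>d x\<bar>" "\<bar>e x\<bar>"] by (simp add: E_def abs_mult)
      also have "E x * \<bar>1 - lam - (g x)\<^sup>2\<bar> \<le> E x * (1 + \<Lambda> + B\<^sup>2)"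
      proof (rule mult_left_mono)
        have "0 \<le> (g x)\<^sup>2" by simp
        then show "\<bar>1 - lam - (g x)\<^sup>2\<bar> \<le> 1 + \<Lambda> + B\<^sup>2" using g2 bounds(3) by linarith
      qed (simp add: E_def)
      finally show ?thesis by (simp add: mult.commute mult_right_mono)
    qed
    have c: "- 2 * e x * (\<delta> * r x) \<le> E x + \<delta>\<^sup>2 * R\<^sup>2"
    proof -
      have "0 \<le> (e x + \<delta> * r x)\<^sup>2" by simp
      then have "- 2 * e x * (\<delta> * r x) \<le> (e x)\<^sup>2 + \<delta>\<^sup>2 * (r x)\<^sup>2"
        by (simp add: power2_sum power_mult_distrib)
      also have "\<dots> \<le> E x + \<delta>\<^sup>2 * R\<^sup>2" using r2 by (intro add_mono mult_left_mono) (auto simp: E_def)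
      finally show ?thesis .
    qed
    have "E' x = 2 * g x * ((d x)\<^sup>2 - (e x)\<^sup>2) + 2 * d x * e x * (1 - lam - (g x)\<^sup>2) + (- 2 * e x * (\<delta> * r x))"
      by (simp add: E'_def algebra_simps power2_eq_square)
    also have "\<dots> \<le> 2 * B * E x + (1 + \<Lambda> + B\<^sup>2) * E x + (E x + \<delta>\<^sup>2 * R\<^sup>2)"
      using a b c by (intro add_mono)
    also have "\<dots> = \<kappa> * E x + \<delta>\<^sup>2 * R\<^sup>2" by (simp add: \<kappa>_def algebra_simps)
    finally show ?thesis .
  qed
  \<comment> \<open>Nondecreasing because
    \<open>E' \<le> \<kappa> * E + \<delta>\<^sup>2 * R\<^sup>2\<close>; comparing its values at 0
    and \<open>x\<close> is Gronwall's inequality.\<close>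
  define h where "h x = \<delta>\<^sup>2 * R\<^sup>2 * x - exp (- \<kappa> * x) * E x" for x
  have "h 0 \<le> h x"
  proof (rule deriv_nonneg_within_imp_mono[where f = h and a = 0 and b = L])
    fix x assume x: "x \<in> {0..L}"
    show "(h has_real_derivative \<delta>\<^sup>2 * R\<^sup>2 - (exp (- \<kappa> * x) * E' x - \<kappa> * exp (- \<kappa> * x) * E x)) (at x within {0..L})"
      unfolding h_def E_def E'_def using d[OF x] e[OF x]
      by (auto intro!: derivative_eq_intros simp: algebra_simps)
    have "exp (- \<kappa> * x) * (E' x - \<kappa> * E x) \<le> exp (- \<kappa> * x) * (\<delta>\<^sup>2 * R\<^sup>2)"
      using E'_le[OF x] by (intro mult_left_mono) auto
    also have "\<dots> \<le> 1 * (\<delta>\<^sup>2 * R\<^sup>2)" using x \<kappa> by (intro mult_right_mono) auto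
    finally show "0 \<le> \<delta>\<^sup>2 * R\<^sup>2 - (exp (- \<kappa> * x) * E' x - \<kappa> * exp (- \<kappa> * x) * E x)"
      by (simp add: algebra_simps)
  qed (use x in auto)
  then have "exp (- \<kappa> * x) * E x \<le> \<delta>\<^sup>2 * R\<^sup>2 * x" by (simp add: h_def E_def init)
  then have "exp (\<kappa> * x) * (exp (- \<kappa> * x) * E x) \<le> exp (\<kappa> * x) * (\<delta>\<^sup>2 * R\<^sup>2 * x)" by (intro mult_left_mono) auto
  then have "E x \<le> exp (\<kappa> * x) * (\<delta>\<^sup>2 * R\<^sup>2 * x)" by (simp add: mult.assoc[symmetric] exp_add[symmetric])
  also have "\<dots> \<le> exp (\<kappa> * L) * (\<delta>\<^sup>2 * R\<^sup>2 * L)"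
    using x \<kappa> by (intro mult_mono) (auto intro: mult_left_mono)
  finally show ?thesis by (simp add: E_def \<kappa>_def)
qed

text \<open>The difference of the solutions for \<open>\<mu>\<close> and \<open>lam\<close> with
  equal initial values solves the system for \<open>\<mu>\<close> with the forcing
  \<open>- (\<mu> - lam) * y lam\<close>. Restricting to
  \<open>\<bar>\<mu> - lam\<bar> \<le> 1\<close> provides one bound \<open>\<Lambda>\<close> for all
  \<open>\<mu>\<close> involved.\<close>

lemma hill_solution_lipschitz_in_parameter:
  assumes L: "0 \<le> L" and g: "continuous_on {0..L} g"
    and sol: "\<And>\<mu>. hill_solution L g \<mu> (y \<mu>) (z \<mu>)" and init: "\<And>\<mu>. y \<mu> 0 = y0" "\<And>\<mu>. z \<mu> 0 = z0"
  obtains K where "K > 0" "\<And>\<mu> x. \<bar>\<mu> - lam\<bar> \<le> 1 \<Longrightarrow> x \<in> {0..L} \<Longrightarrow>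
     \<bar>y \<mu> x - y lam x\<bar> \<le> K * \<bar>\<mu> - lam\<bar> \<and> \<bar>z \<mu> x - z lam x\<bar> \<le> K * \<bar>\<mu> - lam\<bar>"
proof -
  have "bounded (g ` {0..L})" using g by (intro compact_imp_bounded compact_continuous_image) auto
  then obtain B where B: "B > 0" "\<And>x. x \<in> {0..L} \<Longrightarrow> \<bar>g x\<bar> \<le> B" by (auto simp: bounded_pos)
  have "bounded (y lam ` {0..L})"
    using hill_solution_continuous_on[OF sol] by (intro compact_imp_bounded compact_continuous_image) auto
  then obtain R where R: "R > 0" "\<And>x. x \<in> {0..L} \<Longrightarrow> \<bar>y lam x\<bar> \<le> R" by (auto simp: bounded_pos)
  define \<Lambda> where "\<Lambda> = \<bar>lam\<bar> + 1"
  define C where "C = exp ((2 * B + 2 + \<Lambda> + B\<^sup>2) * L) * (R\<^sup>2 * L)"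
  have C0: "C \<ge> 0" using L by (simp add: C_def)
  have *: "(y \<mu> x - y lam x)\<^sup>2 + (z \<mu> x - z lam x)\<^sup>2 \<le> (sqrt C * \<bar>\<mu> - lam\<bar>)\<^sup>2"
    if \<mu>: "\<bar>\<mu> - lam\<bar> \<le> 1" and x: "x \<in> {0..L}" for \<mu> x
  proof -
    have "(y \<mu> x - y lam x)\<^sup>2 + (z \<mu> x - z lam x)\<^sup>2 \<le> exp ((2 * B + 2 + \<Lambda> + B\<^sup>2) * L) * ((\<mu> - lam)\<^sup>2 * R\<^sup>2 * L)"
    proof (rule hill_energy_bound[where d = "\<lambda>x. y \<mu> x - y lam x" and e = "\<lambda>x. z \<mu> x - z lam x" and r = "y lam" and lam = \<mu> and g = g])
      fix x assume x: "x \<in> {0..L}"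
      show "((\<lambda>x. y \<mu> x - y lam x) has_real_derivative g x * (y \<mu> x - y lam x) + (z \<mu> x - z lam x)) (at x within {0..L})"
        using DERIV_diff[OF hill_solutionD(1)[OF sol x] hill_solutionD(1)[OF sol x]] by (simp add: algebra_simps)
      show "((\<lambda>x. z \<mu> x - z lam x) has_real_derivative
          - (\<mu> + (g x)\<^sup>2) * (y \<mu> x - y lam x) - g x * (z \<mu> x - z lam x) - (\<mu> - lam) * y lam x) (at x within {0..L})"
        using DERIV_diff[OF hill_solutionD(2)[OF sol x] hill_solutionD(2)[OF sol x]] by (simp add: algebra_simps)
    qed (use L B R init x \<mu> in \<open>auto simp: \<Lambda>_def\<close>)
    also have "\<dots> = (sqrt C * \<bar>\<mu> - lam\<bar>)\<^sup>2" using C0 by (simp add: power_mult_distrib C_def mult_ac)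
    finally show ?thesis .
  qed
  show ?thesis
  proof (rule that[of "sqrt C + 1"])
    show "sqrt C + 1 > 0" using C0 by (simp add: add_nonneg_pos)
    fix \<mu> x assume \<mu>: "\<bar>\<mu> - lam\<bar> \<le> 1" and x: "x \<in> {0..L}"
    have s: "0 \<le> sqrt C * \<bar>\<mu> - lam\<bar>" using C0 by simp
    have "(y \<mu> x - y lam x)\<^sup>2 \<le> (sqrt C * \<bar>\<mu> - lam\<bar>)\<^sup>2" "(z \<mu> x - z lam x)\<^sup>2 \<le> (sqrt C * \<bar>\<mu> - lam\<bar>)\<^sup>2"
      using *[OF \<mu> x] by (smt (verit) zero_le_power2)+
    then have "\<bar>y \<mu> x - y lam x\<bar> \<le> sqrt C * \<bar>\<mu> - lam\<bar>" "\<bar>z \<mu> x - z lam x\<bar> \<le> sqrt C * \<bar>\<mu> - lam\<bar>"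
      using s by (simp_all add: abs_le_square_iff[symmetric])
    then show "\<bar>y \<mu> x - y lam x\<bar> \<le> (sqrt C + 1) * \<bar>\<mu> - lam\<bar> \<and> \<bar>z \<mu> x - z lam x\<bar> \<le> (sqrt C + 1) * \<bar>\<mu> - lam\<bar>"
      by (simp add: distrib_right add_increasing2)
  qed
qed

text \<open>The coefficient matrix of the Hill system has trace \<open>g - g = 0\<close>, so the
  determinant formed by two solutions is constant.\<close>

lemma hill_wronskian:
  assumes s1: "hill_solution L g lam y1 z1" and s2: "hill_solution L g lam y2 z2" and x: "x \<in> {0..L}"
  shows "y1 x * z2 x - z1 x * y2 x = y1 0 * z2 0 - z1 0 * y2 0"
proof -
  have "((\<lambda>x. y1 x * z2 x - z1 x * y2 x) has_real_derivative 0) (at x within {0..L})" if "x \<in> {0..L}" for x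
    by (rule derivative_eq_intros hill_solutionD[OF s1 that] hill_solutionD[OF s2 that] refl)+
      (simp add: algebra_simps power2_eq_square)
  then obtain c where "\<And>x. x \<in> {0..L} \<Longrightarrow> y1 x * z2 x - z1 x * y2 x = c"
    using has_field_derivative_zero_constant[of "{0..L}" "\<lambda>x. y1 x * z2 x - z1 x * y2 x"] by auto
  then show ?thesis using x by auto
qed

section \<open>Positive solutions below the spectrum\<close>

lemma hill_solution_lincomb:
  assumes "hill_solution L g lam y1 z1" "hill_solution L g lam y2 z2"
  shows "hill_solution L g lam (\<lambda>x. y1 x + c * y2 x) (\<lambda>x. z1 x + c * z2 x)"
  unfolding hill_solution_def
proof (intro ballI conjI)
  fix x assume x: "x \<in> {0..L}"
  note d = hill_solutionD[OF assms(1) x] hill_solutionD[OF assms(2) x]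
  show "((\<lambda>x. y1 x + c * y2 x) has_real_derivative g x * (y1 x + c * y2 x) + (z1 x + c * z2 x)) (at x within {0..L})"
    by (rule DERIV_cong[OF DERIV_add[OF d(1) DERIV_cmult[OF d(3)]]]) (simp add: algebra_simps)
  show "((\<lambda>x. z1 x + c * z2 x) has_real_derivative
      - (lam + (g x)\<^sup>2) * (y1 x + c * y2 x) - g x * (z1 x + c * z2 x)) (at x within {0..L})"
    by (rule DERIV_cong[OF DERIV_add[OF d(2) DERIV_cmult[OF d(4)]]]) (simp add: algebra_simps)
qed

text \<open>\<open>(y z)' = z\<^sup>2 - (lam + g\<^sup>2) y\<^sup>2\<close> is positive once
  \<open>lam\<close> lies below \<open>- g\<^sup>2\<close> everywhere. This supplies the starting
  point of the continuation: it excludes a second zero of a solution and, if \<open>y\<close> is 1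
  at both ends, gives the sign of the jump of \<open>z\<close>.\<close>

lemma hill_product_strict_mono:
  assumes sol: "hill_solution L g lam y z"
    and neg: "\<And>x. x \<in> {0..L} \<Longrightarrow> lam + (g x)\<^sup>2 < 0"
    and nontriv: "\<And>x. x \<in> {0..L} \<Longrightarrow> y x \<noteq> 0 \<or> z x \<noteq> 0"
    and "0 \<le> a" "a < b" "b \<le> L"
  shows "y a * z a < y b * z b"
proof (rule deriv_pos_within_imp_strict_mono[where f = "\<lambda>x. y x * z x" and a = 0 and b = L])
  fix x assume x: "x \<in> {0..L}"
  show "((\<lambda>x. y x * z x) has_real_derivative (z x)\<^sup>2 - (lam + (g x)\<^sup>2) * (y x)\<^sup>2) (at x within {0..L})"
    by (rule DERIV_cong[OF DERIV_mult[OF hill_solutionD[OF sol x]]]) (simp add: algebra_simps power2_eq_square)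
  have n: "0 < - (lam + (g x)\<^sup>2)" using neg[OF x] by linarith
  show "0 < (z x)\<^sup>2 - (lam + (g x)\<^sup>2) * (y x)\<^sup>2"
  proof (cases "y x = 0")
    case True
    then show ?thesis using nontriv[OF x] by simp
  next
    case False
    then have "0 < - (lam + (g x)\<^sup>2) * (y x)\<^sup>2" using n by (intro mult_pos_pos) auto
    moreover have "0 \<le> (z x)\<^sup>2" by simp
    ultimately show ?thesis by (simp only: mult_minus_left)
  qed
qed (use assms in auto)

text \<open>\<open>y z\<close> increases strictly, so it has at most one zero; \<open>y\<close> starts and ends at \<open>1\<close>, so it cannot
  vanish, since a single zero would be a minimum and hence a common zero of \<open>y\<close> and \<open>z\<close>.\<close>

lemma hill_solution_positive:
  assumes L: "0 < L" and sol: "hill_solution L g lam y z"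
    and neg: "\<And>x. x \<in> {0..L} \<Longrightarrow> lam + (g x)\<^sup>2 < 0"
    and nontriv: "\<And>x. x \<in> {0..L} \<Longrightarrow> y x \<noteq> 0 \<or> z x \<noteq> 0"
    and ends: "y 0 = 1" "y L = 1" and x: "x \<in> {0..L}"
  shows "0 < y x"
proof (rule ccontr)
  assume nx: "\<not> 0 < y x"
  have yc: "continuous_on {0..L} y" using hill_solution_continuous_on[OF sol] by blast
  obtain m where m: "m \<in> {0..L}" "\<And>t. t \<in> {0..L} \<Longrightarrow> y m \<le> y t"
    using continuous_attains_inf[OF _ _ yc] L by auto
  have ym: "y m \<le> 0" using m(2)[OF x] nx by linarith
  then have m01: "0 < m" "m < L" using m(1) ends by (auto simp: less_le)
  have "(y has_real_derivative g m * y m + z m) (at m)"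
    using hill_solutionD(1)[OF sol m(1)] m01 by (simp add: at_within_Icc_at)
  then have dm: "g m * y m + z m = 0"
  proof (rule DERIV_local_min)
    show "0 < min m (L - m)" using m01 by simp
    show "\<forall>t. \<bar>m - t\<bar> < min m (L - m) \<longrightarrow> y m \<le> y t" by (auto intro!: m(2))
  qed
  show False
  proof (cases "y m = 0")
    case True
    then show False using dm nontriv[OF m(1)] by simp
  next
    case False
    then have "y m < 0" using ym by simp
    obtain a where a: "0 \<le> a" "a \<le> m" "y a = 0"
      using IVT2'[of y m 0 0] ym ends m01 continuous_on_subset[OF yc, of "{0..m}"] by auto
    obtain b where b: "m \<le> b" "b \<le> L" "y b = 0"
      using IVT'[of y m 0 L] ym ends m01 continuous_on_subset[OF yc, of "{m..L}"] by auto
    have "a < b" using a b False by (cases "a = b") auto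
    then have "y a * z a < y b * z b"
      using a b by (intro hill_product_strict_mono[OF sol neg nontriv]) auto
    then show False using a b by simp
  qed
qed

lemma uniform_limit_of_lipschitz:
  fixes f :: "real \<Rightarrow> real \<Rightarrow> real"
  assumes K: "K > 0" and lip: "\<And>\<mu> x. \<bar>\<mu> - lam\<bar> \<le> 1 \<Longrightarrow> x \<in> S \<Longrightarrow> \<bar>f \<mu> x - f lam x\<bar> \<le> K * \<bar>\<mu> - lam\<bar>"
  shows "uniform_limit S f (f lam) (nhds lam)"
proof (rule uniform_limitI)
  fix e :: real assume e: "e > 0"
  show "\<forall>\<^sub>F \<mu> in nhds lam. \<forall>x\<in>S. dist (f \<mu> x) (f lam x) < e"
    unfolding eventually_nhds_metric
  proof (intro exI[of _ "min 1 (e / K)"] conjI allI impI ballI)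
    show "0 < min 1 (e / K)" using e K by simp
    fix \<mu> x assume \<mu>: "dist \<mu> lam < min 1 (e / K)" and x: "x \<in> S"
    then have "\<bar>f \<mu> x - f lam x\<bar> \<le> K * \<bar>\<mu> - lam\<bar>" by (intro lip) (auto simp: dist_real_def)
    also have "\<dots> < K * (e / K)" using \<mu> K by (intro mult_strict_left_mono) (auto simp: dist_real_def)
    finally show "dist (f \<mu> x) (f lam x) < e" using K by (simp add: dist_real_def)
  qed
qed

text \<open>\<open>th\<close> and \<open>ph\<close> are the fundamental solutions at 0,
  \<open>p lam = ph lam L\<close>, and \<open>Y = th + c ph\<close> with
  \<open>c = (1 - th lam L) / p lam\<close> has the value 1 at both ends. The zeros of
  \<open>p\<close> are thus the Dirichlet eigenvalues. The lower bound on \<open>p\<close> keeps the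
  continuation away from them: as long as \<open>Y\<close> is positive and bounded,
  \<open>p lam\<close> is the integral of \<open>1 / Y\<^sup>2\<close>.\<close>

lemma hill_boundary_family:
  assumes L: "0 < L" and g: "continuous_on {0..L} g"
  obtains Y Z p \<Lambda> where
    "\<And>lam. isCont p lam"
    "\<And>lam. p lam \<noteq> 0 \<Longrightarrow> hill_solution L g lam (Y lam) (Z lam) \<and> Y lam 0 = 1 \<and> Y lam L = 1"
    "\<And>lam. p lam \<noteq> 0 \<Longrightarrow> uniform_limit {0..L} Y (Y lam) (nhds lam)"
    "\<And>lam. p lam \<noteq> 0 \<Longrightarrow> uniform_limit {0..L} Z (Z lam) (nhds lam)"
    "\<And>lam C. p lam \<noteq> 0 \<Longrightarrow> (\<And>x. x \<in> {0..L} \<Longrightarrow> 0 < Y lam x \<and> Y lam x \<le> C) \<Longrightarrow> L / C\<^sup>2 \<le> p lam"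
    "\<And>lam. lam \<le> \<Lambda> \<Longrightarrow> p lam \<noteq> 0 \<and> (\<forall>x\<in>{0..L}. 0 < Y lam x) \<and> Z lam 0 < Z lam L"
proof -
  have L0: "0 \<le> L" using L by simp
  have ex: "\<exists>f. \<forall>lam. hill_solution L g lam (fst (f lam)) (snd (f lam)) \<and> fst (f lam) 0 = y0 \<and> snd (f lam) 0 = z0"
    for y0 z0
  proof (rule choice, rule allI)
    fix lam
    obtain y z where "hill_solution L g lam y z" "y 0 = y0" "z 0 = z0"
      by (rule hill_solution_exists[OF L0 g])
    then show "\<exists>yz. hill_solution L g lam (fst yz) (snd yz) \<and> fst yz 0 = y0 \<and> snd yz 0 = z0"
      by (intro exI[of _ "(y, z)"]) simp
  qed
  obtain f1 where f1: "\<forall>lam. hill_solution L g lam (fst (f1 lam)) (snd (f1 lam)) \<and> fst (f1 lam) 0 = 1 \<and> snd (f1 lam) 0 = 0"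
    using ex[of 1 0] by (rule exE)
  obtain f2 where f2: "\<forall>lam. hill_solution L g lam (fst (f2 lam)) (snd (f2 lam)) \<and> fst (f2 lam) 0 = 0 \<and> snd (f2 lam) 0 = 1"
    using ex[of 0 1] by (rule exE)
  define th thz ph phz where "th lam = fst (f1 lam)" and "thz lam = snd (f1 lam)"
    and "ph lam = fst (f2 lam)" and "phz lam = snd (f2 lam)" for lam
  have th: "hill_solution L g lam (th lam) (thz lam)" "th lam 0 = 1" "thz lam 0 = 0"
    and ph: "hill_solution L g lam (ph lam) (phz lam)" "ph lam 0 = 0" "phz lam 0 = 1" for lam
    using f1 f2 by (simp_all add: th_def thz_def ph_def phz_def)
  have ul: "uniform_limit {0..L} y (y lam) (nhds lam)" "uniform_limit {0..L} z (z lam) (nhds lam)"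
    if s: "\<And>\<mu>. hill_solution L g \<mu> (y \<mu>) (z \<mu>)" "\<And>\<mu>. y \<mu> 0 = y0" "\<And>\<mu>. z \<mu> 0 = z0" for y z y0 z0 lam
  proof -
    obtain K where "K > 0" "\<And>\<mu> x. \<bar>\<mu> - lam\<bar> \<le> 1 \<Longrightarrow> x \<in> {0..L} \<Longrightarrow>
     \<bar>y \<mu> x - y lam x\<bar> \<le> K * \<bar>\<mu> - lam\<bar> \<and> \<bar>z \<mu> x - z lam x\<bar> \<le> K * \<bar>\<mu> - lam\<bar>"
      by (rule hill_solution_lipschitz_in_parameter[OF L0 g s]) blast
    then show "uniform_limit {0..L} y (y lam) (nhds lam)" "uniform_limit {0..L} z (z lam) (nhds lam)"
      using uniform_limit_of_lipschitz[of K lam "{0..L}"] by blast+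
  qed
  note ulth = ul[OF th] and ulph = ul[OF ph]
  have Lin: "L \<in> {0..L}" using L by simp
  define p where "p lam = ph lam L" for lam
  define c where "c lam = (1 - th lam L) / p lam" for lam
  define Y where "Y lam x = th lam x + c lam * ph lam x" for lam x
  define Z where "Z lam x = thz lam x + c lam * phz lam x" for lam x
  have ptend: "(p \<longlongrightarrow> p lam) (nhds lam)" for lam
    unfolding p_def using tendsto_uniform_limitI[OF ulph(1) Lin] .
  have thtend: "((\<lambda>lam. th lam L) \<longlongrightarrow> th lam L) (nhds lam)" for lam
    using tendsto_uniform_limitI[OF ulth(1) Lin] .
  have ctend: "(c \<longlongrightarrow> c lam) (nhds lam)" if "p lam \<noteq> 0" for lam
    unfolding c_def by (intro tendsto_intros ptend thtend that)
  have sol: "hill_solution L g lam (Y lam) (Z lam)" for lam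
    unfolding Y_def Z_def by (intro hill_solution_lincomb th ph)
  have Y0: "Y lam 0 = 1" "Z lam 0 = c lam" for lam by (simp_all add: Y_def Z_def th ph)
  have YL: "Y lam L = 1" if "p lam \<noteq> 0" for lam using that by (simp add: Y_def c_def p_def)
  have ulc: "uniform_limit {0..L} (\<lambda>\<mu> x. c \<mu> * f \<mu> x) (\<lambda>x. c lam * f lam x) (nhds lam)"
    if "p lam \<noteq> 0" "uniform_limit {0..L} f (f lam) (nhds lam)" "continuous_on {0..L} (f lam)" for lam f
  proof (rule uniform_lim_mult[OF _ that(2)])
    show "uniform_limit {0..L} (\<lambda>\<mu> x. c \<mu>) (\<lambda>x. c lam) (nhds lam)"
      using tendstoD[OF ctend[OF that(1)]] by (auto intro!: uniform_limitI elim: eventually_mono)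
    show "bounded ((\<lambda>x. c lam) ` {0..L})" by (rule finite_imp_bounded) (simp add: image_constant_conv)
    show "bounded (f lam ` {0..L})"
      using that(3) by (intro compact_imp_bounded compact_continuous_image) auto
  qed
  \<comment> \<open>The Wronskian of \<open>Y\<close> and \<open>ph\<close>. That it is 1 also shows
    that neither of them has a common zero with its quasi-derivative.\<close>
  have wr: "Y lam x * phz lam x - Z lam x * ph lam x = 1" if "x \<in> {0..L}" for lam x
    using hill_wronskian[OF sol ph(1) that, of lam] by (simp add: Y0 ph)
  obtain B where B: "\<And>x. x \<in> {0..L} \<Longrightarrow> \<bar>g x\<bar> \<le> B"
  proof -
    have "bounded (g ` {0..L})" using g by (intro compact_imp_bounded compact_continuous_image) auto
    then obtain b where "\<forall>u\<in>g ` {0..L}. norm u \<le> b" unfolding bounded_iff by blast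
    then show ?thesis by (intro that[of b]) auto
  qed
  show ?thesis
  \<comment> \<open>Below the threshold \<open>- B\<^sup>2 - 1\<close> the inequality
    \<open>lam + (g x)\<^sup>2 < 0\<close> holds on the whole interval.\<close>
  proof (rule that[of p Y Z "- B\<^sup>2 - 1"])
    show "isCont p lam" for lam
      unfolding isCont_def using ptend[of lam] by (simp add: tendsto_at_iff_tendsto_nhds)
    show "hill_solution L g lam (Y lam) (Z lam) \<and> Y lam 0 = 1 \<and> Y lam L = 1" if "p lam \<noteq> 0" for lam
      using sol Y0 YL[OF that] by simp
    show "uniform_limit {0..L} Y (Y lam) (nhds lam)" if "p lam \<noteq> 0" for lam
      unfolding Y_def by (intro uniform_limit_add ulth ulc[OF that] ulph hill_solution_continuous_on[OF ph(1)])
    show "uniform_limit {0..L} Z (Z lam) (nhds lam)" if "p lam \<noteq> 0" for lam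
      unfolding Z_def by (intro uniform_limit_add ulth ulc[OF that] ulph hill_solution_continuous_on[OF ph(1)])
    show "L / C\<^sup>2 \<le> p lam" if nz: "p lam \<noteq> 0" and C: "\<And>x. x \<in> {0..L} \<Longrightarrow> 0 < Y lam x \<and> Y lam x \<le> C" for lam C
    proof -
      have "ph lam 0 / Y lam 0 - 0 / C\<^sup>2 \<le> ph lam L / Y lam L - L / C\<^sup>2"
      proof (rule deriv_nonneg_within_imp_mono[where f = "\<lambda>x. ph lam x / Y lam x - x / C\<^sup>2" and a = 0 and b = L])
        fix x assume x: "x \<in> {0..L}"
        have y0: "Y lam x \<noteq> 0" using C[OF x] by simp
        \<comment> \<open>The numerator in the derivative of \<open>ph / Y\<close> is the Wronskian,
          as the terms with \<open>g\<close> cancel.\<close>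
        have num: "(g x * ph lam x + phz lam x) * Y lam x - ph lam x * (g x * Y lam x + Z lam x) = 1"
          using wr[OF x, of lam] by (simp add: algebra_simps)
        have "((\<lambda>x. ph lam x / Y lam x) has_real_derivative 1 / (Y lam x * Y lam x)) (at x within {0..L})"
          by (rule DERIV_cong[OF DERIV_divide[OF hill_solutionD(1)[OF ph(1) x] hill_solutionD(1)[OF sol x] y0]])
            (simp only: num)
        moreover have "((\<lambda>x. x / C\<^sup>2) has_real_derivative 1 / C\<^sup>2) (at x within {0..L})"
          by (rule DERIV_cdivide[OF DERIV_ident])
        ultimately show "((\<lambda>x. ph lam x / Y lam x - x / C\<^sup>2) has_real_derivative 1 / (Y lam x * Y lam x) - 1 / C\<^sup>2) (at x within {0..L})"
          by (rule DERIV_diff)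
        have "Y lam x * Y lam x \<le> C\<^sup>2" unfolding power2_eq_square using C[OF x] by (intro mult_mono) auto
        then show "0 \<le> 1 / (Y lam x * Y lam x) - 1 / C\<^sup>2" using y0 C[OF x] by (simp add: frac_le)
      qed (use L in auto)
      then show ?thesis using YL[OF nz] by (simp add: ph p_def)
    qed
    show "p lam \<noteq> 0 \<and> (\<forall>x\<in>{0..L}. 0 < Y lam x) \<and> Z lam 0 < Z lam L" if "lam \<le> - B\<^sup>2 - 1" for lam
    proof -
      have neg: "lam + (g x)\<^sup>2 < 0" if "x \<in> {0..L}" for x
      proof -
        have "(g x)\<^sup>2 \<le> B\<^sup>2" using B[OF that] abs_le_square_iff[of "g x" B] by force
        then show ?thesis using \<open>lam \<le> - B\<^sup>2 - 1\<close> by linarith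
      qed
      have ntY: "Y lam x \<noteq> 0 \<or> Z lam x \<noteq> 0" if "x \<in> {0..L}" for x using wr[OF that, of lam] by auto
      have ntph: "ph lam x \<noteq> 0 \<or> phz lam x \<noteq> 0" if "x \<in> {0..L}" for x using wr[OF that, of lam] by auto
      have "ph lam 0 * phz lam 0 < ph lam L * phz lam L"
        using L by (intro hill_product_strict_mono[OF ph(1) neg ntph]) auto
      then have nz: "p lam \<noteq> 0" by (auto simp: p_def ph)
      have "Y lam 0 * Z lam 0 < Y lam L * Z lam L"
        using L by (intro hill_product_strict_mono[OF sol neg ntY]) auto
      then have "Z lam 0 < Z lam L" by (simp add: Y0 YL[OF nz])
      then show ?thesis using hill_solution_positive[OF L sol neg ntY Y0(1) YL[OF nz]] nz by blast
    qed
  qed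
qed

text \<open>For a positive solution \<open>y\<close> the function \<open>v = g + z / y\<close> is the logarithmic derivative of \<open>y\<close> and
  satisfies the Riccati equation \<open>(z / y)' = - \<lambda> - v\<^sup>2\<close>; \<open>V\<close> below is the integral of \<open>v\<^sup>2\<close>.\<close>

lemma hill_riccati_bounds:
  assumes L: "0 < L" and g: "continuous_on {0..L} g" and sol: "hill_solution L g lam y z"
    and pos: "\<And>x. x \<in> {0..L} \<Longrightarrow> 0 < y x" and ends: "y 0 = 1" "y L = 1"
  defines "V \<equiv> - lam * L - (z L - z 0)"
  shows "((\<lambda>x. (g x + z x / y x)\<^sup>2) has_integral V) {0..L}"
    and "\<And>x. x \<in> {0..L} \<Longrightarrow> 0 \<le> - lam * x - (z x / y x - z 0) \<and> - lam * x - (z x / y x - z 0) \<le> V"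
    and "\<And>x. x \<in> {0..L} \<Longrightarrow> exp (- (L + V) / 2) \<le> y x \<and> y x \<le> exp ((L + V) / 2)"
proof -
  \<comment> \<open>By the Riccati equation this is the integral of \<open>v\<^sup>2\<close> from 0
    to \<open>x\<close>.\<close>
  define W where "W x = - lam * x - (z x / y x - z 0)" for x
  define v where "v x = g x + z x / y x" for x
  have W0: "W 0 = 0" "W L = V" using ends by (simp_all add: W_def V_def)
  have dz: "((\<lambda>x. z x / y x) has_real_derivative - lam - (v x)\<^sup>2) (at x within {0..L})" if x: "x \<in> {0..L}" for x
  proof -
    have y0: "y x \<noteq> 0" using pos[OF x] by simp
    show ?thesis
      by (rule DERIV_cong[OF DERIV_divide[OF hill_solutionD(2,1)[OF sol x] y0]])
        (use y0 in \<open>simp add: v_def field_simps power2_eq_square\<close>)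
  qed
  have dW: "(W has_real_derivative (v x)\<^sup>2) (at x within {0..L})" if x: "x \<in> {0..L}" for x
    unfolding W_def by (rule derivative_eq_intros dz[OF x] refl)+ simp
  have "((\<lambda>x. (v x)\<^sup>2) has_integral (W L - W 0)) {0..L}"
    using L dW by (intro fundamental_theorem_of_calculus)
      (auto simp: has_real_derivative_iff_has_vector_derivative[symmetric])
  then show "((\<lambda>x. (g x + z x / y x)\<^sup>2) has_integral V) {0..L}" by (simp add: W0 v_def)
  have Wm: "W a \<le> W b" if "0 \<le> a" "a \<le> b" "b \<le> L" for a b
    using that by (intro deriv_nonneg_within_imp_mono[OF dW]) auto
  show W: "0 \<le> - lam * x - (z x / y x - z 0) \<and> - lam * x - (z x / y x - z 0) \<le> V" if "x \<in> {0..L}" for x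
    unfolding W_def[symmetric] using Wm[of 0 x] Wm[of x L] that L by (simp add: W0)
  have dln: "((\<lambda>x. ln (y x)) has_real_derivative v x) (at x within {0..L})" if x: "x \<in> {0..L}" for x
  proof -
    have y0: "0 < y x" using pos[OF x] by simp
    show ?thesis
      by (rule DERIV_cong[OF DERIV_chain2[OF DERIV_ln[OF y0] hill_solutionD(1)[OF sol x]]])
        (use y0 in \<open>simp add: v_def field_simps\<close>)
  qed
  show "exp (- (L + V) / 2) \<le> y x \<and> y x \<le> exp ((L + V) / 2)" if x: "x \<in> {0..L}" for x
  proof -
    \<comment> \<open>That is \<open>\<bar>v\<bar> \<le> (1 + v\<^sup>2) / 2\<close>. Integrated, it
      bounds \<open>\<bar>ln (y x)\<bar>\<close> by \<open>(x + W x) / 2\<close>, so the two-sided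
      bounds on \<open>y\<close> depend on \<open>L\<close> and \<open>V\<close> only.\<close>
    have sq: "0 \<le> (1 + (v t)\<^sup>2) / 2 - v t" "0 \<le> (1 + (v t)\<^sup>2) / 2 + v t" for t
    proof -
      have e: "(1 + (v t)\<^sup>2) / 2 - v t = (v t - 1)\<^sup>2 / 2" "(1 + (v t)\<^sup>2) / 2 + v t = (v t + 1)\<^sup>2 / 2"
        by (simp_all add: power2_diff power2_sum field_simps)
      show "0 \<le> (1 + (v t)\<^sup>2) / 2 - v t" "0 \<le> (1 + (v t)\<^sup>2) / 2 + v t" unfolding e by simp_all
    qed
    have d1: "((\<lambda>x. (x + W x) / 2) has_real_derivative (1 + (v t)\<^sup>2) / 2) (at t within {0..L})" if "t \<in> {0..L}" for t
      by (intro DERIV_cdivide DERIV_add DERIV_ident dW that)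
    have "(0 + W 0) / 2 - ln (y 0) \<le> (x + W x) / 2 - ln (y x)"
      by (rule deriv_nonneg_within_imp_mono[where f = "\<lambda>x. (x + W x) / 2 - ln (y x)" and a = 0 and b = L, OF DERIV_diff[OF d1 dln]])
        (use sq x in auto)
    moreover have "(0 + W 0) / 2 + ln (y 0) \<le> (x + W x) / 2 + ln (y x)"
      by (rule deriv_nonneg_within_imp_mono[where f = "\<lambda>x. (x + W x) / 2 + ln (y x)" and a = 0 and b = L, OF DERIV_add[OF d1 dln]])
        (use sq x in auto)
    ultimately have "\<bar>ln (y x)\<bar> \<le> (x + W x) / 2" by (simp add: W0 ends abs_le_iff field_simps)
    also have "W x \<le> V" using W[OF x] by (simp add: W_def)
    then have "(x + W x) / 2 \<le> (L + V) / 2" using x by simp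
    finally have "- (L + V) / 2 \<le> ln (y x)" "ln (y x) \<le> (L + V) / 2" by linarith+
    then show ?thesis using pos[OF x] by (metis exp_le_cancel_iff exp_ln)
  qed
qed

text \<open>Shifting by the mean value \<open>m\<close> minimizes the square norm:
  \<open>\<integral>(g + c)\<^sup>2 = \<integral>(g - m)\<^sup>2 + (m + c)\<^sup>2 L\<close>. So the
  variance of \<open>g\<close> is 0, and continuity makes \<open>g\<close> constant.\<close>

lemma L2_distance_to_constants_zero:
  fixes g :: "real \<Rightarrow> real"
  assumes L: "0 < L" and g: "continuous_on {0..L} g"
    and small: "\<And>\<epsilon>. \<epsilon> > 0 \<Longrightarrow> \<exists>c. integral {0..L} (\<lambda>x. (g x + c)\<^sup>2) \<le> \<epsilon>" and x: "x \<in> {0..L}"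
  shows "g x = g 0"
proof -
  define m where "m = integral {0..L} g / L"
  have gi: "(g has_integral m * L) {0..L}"
    using L integrable_integral[OF integrable_continuous_real[OF g]] by (simp add: m_def)
  define A where "A = integral {0..L} (\<lambda>x. (g x - m)\<^sup>2)"
  have Ai: "((\<lambda>x. (g x - m)\<^sup>2) has_integral A) {0..L}"
    unfolding A_def by (intro integrable_integral integrable_continuous_real continuous_intros g)
  have "A \<le> \<epsilon>" if pos: "\<epsilon> > 0" for \<epsilon>
  proof -
    obtain c where c: "integral {0..L} (\<lambda>x. (g x + c)\<^sup>2) \<le> \<epsilon>" using small[OF pos] by blast
    have "((\<lambda>x. (g x - m)\<^sup>2 + 2 * (m + c) * g x + ((c\<^sup>2 - m\<^sup>2))) has_integral
        (A + 2 * (m + c) * (m * L) + ((c\<^sup>2 - m\<^sup>2)) * L)) {0..L}"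
      using has_integral_const_real[of "c\<^sup>2 - m\<^sup>2" 0 L] L
      by (intro has_integral_add has_integral_mult_right Ai gi) (auto simp: mult.commute)
    moreover have "(\<lambda>x. (g x - m)\<^sup>2 + 2 * (m + c) * g x + ((c\<^sup>2 - m\<^sup>2))) = (\<lambda>x. (g x + c)\<^sup>2)"
      by (simp add: fun_eq_iff power2_eq_square algebra_simps)
    ultimately have "integral {0..L} (\<lambda>x. (g x + c)\<^sup>2) = A + 2 * (m + c) * (m * L) + ((c\<^sup>2 - m\<^sup>2)) * L"
      by (simp add: integral_unique)
    also have "\<dots> = A + (m + c)\<^sup>2 * L" by (simp add: power2_eq_square algebra_simps)
    finally show ?thesis using c L by (smt (verit) mult_nonneg_nonneg zero_le_power2)
  qed
  then have "A \<le> 0" using field_le_epsilon[of A 0] by simp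
  moreover have "0 \<le> A" using has_integral_nonneg[OF Ai] by simp
  ultimately have "A = 0" by simp
  moreover have "continuous_on {0..L} (\<lambda>x. (g x - m)\<^sup>2)" by (intro continuous_intros g)
  ultimately have "\<forall>t\<in>{0..L}. (g t - m)\<^sup>2 = 0"
    using integral_eq_0_iff[of 0 L "\<lambda>x. (g x - m)\<^sup>2"] L by (simp add: A_def)
  then have z: "g t = m" if "t \<in> {0..L}" for t using that by simp
  show ?thesis using z[OF x] z[of 0] L by simp
qed

text \<open>The substance is that the set of good parameters is closed in \<open>{..<0}\<close>.
  Three things could fail in a limit: some \<open>p j\<close> tends to 0, some \<open>Y j\<close>
  acquires a zero, or \<open>m\<close> becomes 0. The integrals \<open>V j\<close> of the squared
  logarithmic derivatives are at most \<open>\<bar>lam\<bar> * N\<close>, so the Riccati bounds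
  exclude the first two; \<open>noeig\<close> excludes the third. As \<open>lam\<close> tends to 0,
  the same bound on \<open>V j\<close> brings each \<open>g j\<close> arbitrarily close to a
  constant in square mean.\<close>

theorem no_negative_eigenvalue_imp_primitives_zero:
  fixes L :: "'j \<Rightarrow> real"
  assumes J: "finite J" and L: "\<And>j. j \<in> J \<Longrightarrow> 0 < L j"
    and g: "\<And>j. j \<in> J \<Longrightarrow> continuous_on {0..L j} (g j)"
    and noeig: "\<And>lam y z. lam < 0 \<Longrightarrow> (\<And>j. j \<in> J \<Longrightarrow> hill_solution (L j) (g j) lam (y j) (z j)) \<Longrightarrow>
       (\<And>j. j \<in> J \<Longrightarrow> y j 0 = 1 \<and> y j (L j) = 1) \<Longrightarrow> (\<Sum>j\<in>J. z j (L j) - z j 0) \<noteq> 0"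
    and j: "j \<in> J" and x: "x \<in> {0..L j}"
  shows "g j x = g j 0"
proof -
  \<comment> \<open>Packages what \<open>hill_boundary_family\<close> provides, so that the families
    can be chosen for all \<open>j\<close> at once.\<close>
  define P where "P j Y Z p \<Lambda> \<longleftrightarrow>
    (\<forall>lam. isCont p lam) \<and>
    (\<forall>lam. p lam \<noteq> 0 \<longrightarrow> hill_solution (L j) (g j) lam (Y lam) (Z lam) \<and> Y lam 0 = 1 \<and> Y lam (L j) = 1) \<and>
    (\<forall>lam. p lam \<noteq> 0 \<longrightarrow> uniform_limit {0..L j} Y (Y lam) (nhds lam)) \<and>
    (\<forall>lam. p lam \<noteq> 0 \<longrightarrow> uniform_limit {0..L j} Z (Z lam) (nhds lam)) \<and>
    (\<forall>lam C. p lam \<noteq> 0 \<longrightarrow> (\<forall>x. x \<in> {0..L j} \<longrightarrow> 0 < Y lam x \<and> Y lam x \<le> C) \<longrightarrow> L j / C\<^sup>2 \<le> p lam) \<and>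
    (\<forall>lam. lam \<le> \<Lambda> \<longrightarrow> p lam \<noteq> 0 \<and> (\<forall>x\<in>{0..L j}. 0 < Y lam x) \<and> Z lam 0 < Z lam (L j))"
    for j and Y Z :: "real \<Rightarrow> real \<Rightarrow> real" and p and \<Lambda> :: real
  have "\<exists>Y Z p \<Lambda>. P j Y Z p \<Lambda>" if j: "j \<in> J" for j
  proof (rule hill_boundary_family[OF L[OF j] g[OF j]])
    fix Y Z :: "real \<Rightarrow> real \<Rightarrow> real" and p and \<Lambda> :: real
    assume fam:
      "\<And>lam. isCont p lam"
      "\<And>lam. p lam \<noteq> 0 \<Longrightarrow> hill_solution (L j) (g j) lam (Y lam) (Z lam) \<and> Y lam 0 = 1 \<and> Y lam (L j) = 1"
      "\<And>lam. p lam \<noteq> 0 \<Longrightarrow> uniform_limit {0..L j} Y (Y lam) (nhds lam)"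
      "\<And>lam. p lam \<noteq> 0 \<Longrightarrow> uniform_limit {0..L j} Z (Z lam) (nhds lam)"
      "\<And>lam C. p lam \<noteq> 0 \<Longrightarrow> (\<And>x. x \<in> {0..L j} \<Longrightarrow> 0 < Y lam x \<and> Y lam x \<le> C) \<Longrightarrow> L j / C\<^sup>2 \<le> p lam"
      "\<And>lam. lam \<le> \<Lambda> \<Longrightarrow> p lam \<noteq> 0 \<and> (\<forall>x\<in>{0..L j}. 0 < Y lam x) \<and> Z lam 0 < Z lam (L j)"
    have "P j Y Z p \<Lambda>"
      unfolding P_def by (intro conjI allI impI; (rule fam)?; simp add: fam)
    then show "\<exists>Y Z p \<Lambda>. P j Y Z p \<Lambda>" by blast
  qed
  then obtain Y Z p \<Lambda> where P: "\<And>j. j \<in> J \<Longrightarrow> P j (Y j) (Z j) (p j) (\<Lambda> j)" by metis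
  have pc: "isCont (p j) lam" if "j \<in> J" for j lam using P[OF that] by (simp add: P_def)
  have sol: "hill_solution (L j) (g j) lam (Y j lam) (Z j lam)" "Y j lam 0 = 1" "Y j lam (L j) = 1"
    if "j \<in> J" "p j lam \<noteq> 0" for j lam using P[OF that(1)] that(2) by (auto simp: P_def)
  have ulY: "uniform_limit {0..L j} (Y j) (Y j lam) (nhds lam)" and ulZ: "uniform_limit {0..L j} (Z j) (Z j lam) (nhds lam)"
    if "j \<in> J" "p j lam \<noteq> 0" for j lam using P[OF that(1)] that(2) by (auto simp: P_def)
  have pbound: "L j / C\<^sup>2 \<le> p j lam" if "j \<in> J" "p j lam \<noteq> 0" "\<And>x. x \<in> {0..L j} \<Longrightarrow> 0 < Y j lam x \<and> Y j lam x \<le> C" for j lam C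
    using P[OF that(1)] that(2,3) unfolding P_def by blast
  have base: "p j lam \<noteq> 0 \<and> (\<forall>x\<in>{0..L j}. 0 < Y j lam x) \<and> Z j lam 0 < Z j lam (L j)" if "j \<in> J" "lam \<le> \<Lambda> j" for j lam
    using P[OF that(1)] that(2) unfolding P_def by blast
  define m where "m lam = (\<Sum>j\<in>J. Z j lam (L j) - Z j lam 0)" for lam
  define N where "N = (\<Sum>j\<in>J. L j)"
  have N0: "0 \<le> N" unfolding N_def using L by (intro sum_nonneg) (simp add: less_imp_le)
  define good where "good lam \<longleftrightarrow> (\<forall>j\<in>J. p j lam \<noteq> 0 \<and> (\<forall>x\<in>{0..L j}. 0 < Y j lam x)) \<and> 0 < m lam" for lam
  have Jne: "J \<noteq> {}" using j by blast
  have mtend: "(m \<longlongrightarrow> m lam) (nhds lam)" if "\<forall>j\<in>J. p j lam \<noteq> 0" for lam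
    unfolding m_def using that L
    by (intro tendsto_sum tendsto_diff tendsto_uniform_limitI[OF ulZ]) (auto simp: less_imp_le)
  have ptend: "(p j \<longlongrightarrow> p j lam) (nhds lam)" if "j \<in> J" for j lam
    using pc[OF that, of lam] unfolding isCont_def by (simp add: tendsto_at_iff_tendsto_nhds)
  define V where "V j lam = - lam * L j - (Z j lam (L j) - Z j lam 0)" for j lam
  have Vbound: "0 \<le> V j lam" "V j lam \<le> - lam * N" if "good lam" "j \<in> J" for j lam
  proof -
    have nn: "0 \<le> V i lam" if "i \<in> J" for i
    proof -
      have i: "p i lam \<noteq> 0" "\<And>x. x \<in> {0..L i} \<Longrightarrow> 0 < Y i lam x"
        using \<open>good lam\<close> that unfolding good_def by auto
      have "((\<lambda>x. (g i x + Z i lam x / Y i lam x)\<^sup>2) has_integral V i lam) {0..L i}"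
        unfolding V_def
        by (rule hill_riccati_bounds(1)[OF L[OF that] g[OF that] sol(1)[OF that i(1)] i(2) sol(2,3)[OF that i(1)]])
      then show ?thesis by (rule has_integral_nonneg) simp
    qed
    then show "0 \<le> V j lam" using that by blast
    have "V j lam \<le> (\<Sum>i\<in>J. V i lam)"
      using nn that J by (intro member_le_sum) auto
    \<comment> \<open>The jumps of the \<open>Z i\<close> sum to \<open>m lam\<close>, which is
      positive for good \<open>lam\<close> and can be discarded.\<close>
    also have "\<dots> = - lam * N - m lam"
      by (simp add: V_def N_def m_def sum_subtractf sum_distrib_left sum_negf)
    finally show "V j lam \<le> - lam * N" using \<open>good lam\<close> by (simp add: good_def)
  qed
  have good_open: "\<forall>\<^sub>F \<mu> in nhds lam. good \<mu>" if "good lam" for lam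
  proof -
    have nz: "\<forall>j\<in>J. p j lam \<noteq> 0" using that by (simp add: good_def)
    have "\<forall>\<^sub>F \<mu> in nhds lam. \<forall>j\<in>J. p j \<mu> \<noteq> 0 \<and> (\<forall>x\<in>{0..L j}. 0 < Y j \<mu> x)"
    proof (rule eventually_ball_finite[OF J], rule ballI, rule eventually_conj)
      fix j assume j: "j \<in> J"
      have pj: "p j lam \<noteq> 0" using nz j by simp
      show "\<forall>\<^sub>F \<mu> in nhds lam. p j \<mu> \<noteq> 0"
        using tendsto_imp_eventually_ne[OF ptend[OF j] pj] .
      have cY: "continuous_on {0..L j} (Y j lam)" using hill_solution_continuous_on(1)[OF sol(1)[OF j pj]] .
      obtain t where t: "t \<in> {0..L j}" "\<And>x. x \<in> {0..L j} \<Longrightarrow> Y j lam t \<le> Y j lam x"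
        using continuous_attains_inf[OF _ _ cY] L[OF j] by auto
      have "0 < Y j lam t" using that j t(1) unfolding good_def by blast
      from uniform_limitD[OF ulY[OF j pj] this]
      show "\<forall>\<^sub>F \<mu> in nhds lam. \<forall>x\<in>{0..L j}. 0 < Y j \<mu> x"
      proof (rule eventually_mono, intro ballI)
        fix \<mu> x assume "\<forall>x\<in>{0..L j}. dist (Y j \<mu> x) (Y j lam x) < Y j lam t" and x: "x \<in> {0..L j}"
        then have "\<bar>Y j \<mu> x - Y j lam x\<bar> < Y j lam t" by (auto simp: dist_real_def)
        then show "0 < Y j \<mu> x" using t(2)[OF x] by linarith
      qed
    qed
    moreover have "\<forall>\<^sub>F \<mu> in nhds lam. 0 < m \<mu>"
      using order_tendstoD(1)[OF mtend[OF nz]] that by (simp add: good_def)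
    ultimately show ?thesis unfolding good_def by (rule eventually_conj)
  qed
  have good_closed: "good lam" if lam: "lam < 0" and s: "s \<longlonglongrightarrow> lam" "\<And>n. good (s n)" for lam s
  proof -
    have s': "filterlim s (nhds lam) sequentially" using s(1) .
    have "Bseq s" using s(1) convergent_imp_Bseq convergentI by blast
    then obtain R where R: "R > 0" "\<And>n. \<bar>s n\<bar> \<le> R" by (auto simp: Bseq_def)
    \<comment> \<open>Since \<open>V j (s n) \<le> R * N\<close> along the sequence,
      \<open>C j\<close> and its inverse bound all \<open>Y j (s n)\<close> from above and below,
      independently of \<open>n\<close>.\<close>
    define C where "C j = exp ((L j + R * N) / 2)" for j
    have V: "V j (s n) \<le> R * N" if "j \<in> J" for j n
    proof -
      have "V j (s n) \<le> - s n * N" using Vbound[OF s(2) that] by blast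
      also have "\<dots> \<le> R * N" using R(2)[of n] N0 by (intro mult_right_mono) auto
      finally show ?thesis .
    qed
    have Yb: "inverse (C j) \<le> Y j (s n) x \<and> Y j (s n) x \<le> C j" if j: "j \<in> J" and x: "x \<in> {0..L j}" for j n x
    proof -
      have i: "p j (s n) \<noteq> 0" "\<And>x. x \<in> {0..L j} \<Longrightarrow> 0 < Y j (s n) x"
        using s(2)[of n] j unfolding good_def by auto
      have "exp (- (L j + V j (s n)) / 2) \<le> Y j (s n) x \<and> Y j (s n) x \<le> exp ((L j + V j (s n)) / 2)"
        unfolding V_def
        by (rule hill_riccati_bounds(3)[OF L[OF j] g[OF j] sol(1)[OF j i(1)] i(2) sol(2,3)[OF j i(1)] x])
      moreover have "exp ((L j + V j (s n)) / 2) \<le> C j" using V[OF j, of n] by (simp add: C_def)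
      moreover have "inverse (C j) \<le> exp (- (L j + V j (s n)) / 2)"
      proof -
        have "inverse (C j) = exp (- ((L j + R * N) / 2))" by (simp only: C_def exp_minus)
        moreover have "- ((L j + R * N) / 2) \<le> - (L j + V j (s n)) / 2" using V[OF j, of n] by (simp add: field_simps)
        ultimately show ?thesis by (simp only: exp_le_cancel_iff)
      qed
      ultimately show ?thesis by linarith
    qed
    have C0: "0 < C j" for j by (simp add: C_def)
    have nz: "p j lam \<noteq> 0" if j: "j \<in> J" for j
    proof -
      have "L j / (C j)\<^sup>2 \<le> p j (s n)" for n
      proof (rule pbound[OF j])
        show "p j (s n) \<noteq> 0" using s(2)[of n] j unfolding good_def by auto
        show "0 < Y j (s n) x \<and> Y j (s n) x \<le> C j" if "x \<in> {0..L j}" for x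
          using s(2)[of n] j that Yb[OF j that, of n] unfolding good_def by auto
      qed
      moreover have "(\<lambda>n. p j (s n)) \<longlonglongrightarrow> p j lam" by (rule filterlim_compose[OF ptend[OF j] s'])
      ultimately have "L j / (C j)\<^sup>2 \<le> p j lam" by (intro LIMSEQ_le_const) auto
      moreover have "0 < L j / (C j)\<^sup>2" using L[OF j] C0[of j] by simp
      ultimately show ?thesis by linarith
    qed
    have Ypos: "0 < Y j lam x" if j: "j \<in> J" and x: "x \<in> {0..L j}" for j x
    proof -
      have "(\<lambda>n. Y j (s n) x) \<longlonglongrightarrow> Y j lam x"
        by (rule filterlim_compose[OF tendsto_uniform_limitI[OF ulY[OF j nz[OF j]] x] s'])
      then have "inverse (C j) \<le> Y j lam x" using Yb[OF j x] by (intro LIMSEQ_le_const) auto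
      moreover have "0 < inverse (C j)" using C0[of j] by simp
      ultimately show ?thesis by linarith
    qed
    have "(\<lambda>n. m (s n)) \<longlonglongrightarrow> m lam" using nz by (intro filterlim_compose[OF mtend s']) auto
    then have "0 \<le> m lam" using s(2) by (intro LIMSEQ_le_const) (auto simp: good_def intro: less_imp_le)
    moreover have "m lam \<noteq> 0" unfolding m_def
      by (rule noeig[OF lam, where y = "\<lambda>j. Y j lam" and z = "\<lambda>j. Z j lam"]) (use sol nz in auto)
    ultimately show ?thesis using nz Ypos unfolding good_def by auto
  qed
  have good_all: "good lam" if "lam < 0" for lam
  proof -
    define S where "S = {lam. lam < 0 \<and> good lam}"
    have "open S"
    proof -
      have nb: "\<forall>\<^sub>F \<mu> in nhds lam. \<mu> \<in> S" if "lam \<in> S" for lam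
      proof -
        have "\<forall>\<^sub>F \<mu> in nhds lam. \<mu> < 0"
          using that by (intro eventually_nhds_in_open[of "{..<0}", simplified]) (auto simp: S_def)
        moreover have "\<forall>\<^sub>F \<mu> in nhds lam. good \<mu>" using good_open that by (simp add: S_def)
        ultimately show ?thesis unfolding S_def mem_Collect_eq by (rule eventually_conj)
      qed
      show ?thesis
      proof (rule topological_space_class.openI)
        fix lam assume "lam \<in> S"
        from nb[OF this] obtain T where "open T" "lam \<in> T" "\<forall>\<mu>\<in>T. \<mu> \<in> S"
          unfolding eventually_nhds by blast
        then show "\<exists>T. open T \<and> lam \<in> T \<and> T \<subseteq> S" by blast
      qed
    qed
    have clos: "closure S \<inter> {..<0} \<subseteq> S"
    proof
      fix lam assume lam: "lam \<in> closure S \<inter> {..<0}"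
      then have "\<exists>s. (\<forall>n. s n \<in> S) \<and> s \<longlonglongrightarrow> lam" by (simp add: closure_sequential)
      then obtain s where "\<forall>n. s n \<in> S" "s \<longlonglongrightarrow> lam" by (elim exE conjE)
      then show "lam \<in> S" using good_closed[of lam s] lam by (auto simp: S_def)
    qed
    have "S \<noteq> {}"
    proof -
      \<comment> \<open>Below all thresholds \<open>\<Lambda> i\<close> a parameter is good by
        \<open>base\<close>; the minimum with \<open>-1\<close> makes \<open>l\<close>
        negative.\<close>
      define l where "l = min (-1) (Min (\<Lambda> ` J))"
      have l: "l < 0" "\<And>i. i \<in> J \<Longrightarrow> l \<le> \<Lambda> i" unfolding l_def using J Jne
        by (auto intro: min.coboundedI2)
      have "0 < m l" unfolding m_def using base l(2) by (intro sum_pos J Jne) auto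
      then have "good l" using base l(2) unfolding good_def by blast
      then show ?thesis using l by (auto simp: S_def)
    qed
    moreover have "S \<subseteq> {..<0}" by (auto simp: S_def)
    moreover have "connected {..<(0::real)}" by simp
    ultimately have "- closure S \<inter> {..<0} = {}"
      using connectedD[of "{..<0}" S "- closure S"] \<open>open S\<close> clos closure_subset[of S] by auto
    then show ?thesis using clos that by (auto simp: S_def)
  qed
  show ?thesis
  proof (rule L2_distance_to_constants_zero[OF L[OF j] g[OF j] _ x])
    fix \<epsilon> :: real assume \<epsilon>: "\<epsilon> > 0"
    \<comment> \<open>The final estimate is \<open>2 * V j lam + 8 * \<delta>\<^sup>2 * L j\<close>
      with \<open>V j lam \<le> \<delta> = t * N\<close>; a small \<open>t\<close> brings it below
      \<open>\<epsilon>\<close>.\<close>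
    have cont: "((\<lambda>t. 2 * (t * N) + 8 * (t * N)\<^sup>2 * L j) \<longlongrightarrow> 2 * (0 * N) + 8 * (0 * N)\<^sup>2 * L j) (at_right 0)"
      by (intro tendsto_intros)
    have "\<forall>\<^sub>F t in at_right 0. 2 * (t * N) + 8 * (t * N)\<^sup>2 * L j < \<epsilon>"
      using order_tendstoD(2)[OF cont] \<epsilon> by simp
    then obtain t where t: "0 < t" "2 * (t * N) + 8 * (t * N)\<^sup>2 * L j < \<epsilon>"
      unfolding eventually_at_right_field by (metis dense)
    define lam where "lam = - t"
    have lam: "lam < 0" using t by (simp add: lam_def)
    define \<delta> where "\<delta> = t * N"
    have gd: "good lam" by (rule good_all[OF lam])
    then have i: "p j lam \<noteq> 0" "\<And>x. x \<in> {0..L j} \<Longrightarrow> 0 < Y j lam x" using j unfolding good_def by auto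
    note rb = hill_riccati_bounds[OF L[OF j] g[OF j] sol(1)[OF j i(1)] i(2) sol(2,3)[OF j i(1)], folded V_def]
    have V: "V j lam \<le> \<delta>" using Vbound(2)[OF gd j] by (simp add: lam_def \<delta>_def)
    define c where "c = Z j lam 0"
    have LN: "L j \<le> N" unfolding N_def using j J L by (intro member_le_sum) (auto simp: less_imp_le)
    \<comment> \<open>\<open>g + c = v + w\<close>, where \<open>v\<close> is the logarithmic
      derivative, with square integral \<open>V j lam\<close>, and \<open>w = c - Z / Y\<close> is
      uniformly small by the monotone quantity in the Riccati bounds.\<close>
    have pt: "(g j x + c)\<^sup>2 \<le> 2 * (g j x + Z j lam x / Y j lam x)\<^sup>2 + 8 * \<delta>\<^sup>2" if x: "x \<in> {0..L j}" for x
    proof -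
      define v where "v = g j x + Z j lam x / Y j lam x"
      define w where "w = c - Z j lam x / Y j lam x"
      have tx: "0 \<le> t * x" "t * x \<le> \<delta>" using x t LN by (auto simp: \<delta>_def intro: mult_left_mono)
      have "0 \<le> - lam * x - (Z j lam x / Y j lam x - Z j lam 0)" "- lam * x - (Z j lam x / Y j lam x - Z j lam 0) \<le> \<delta>"
        using rb(2)[of x] x V by auto
      then have "\<bar>w\<bar> \<le> 2 * \<delta>" using tx unfolding w_def c_def lam_def by (simp add: abs_le_iff)
      then have "w\<^sup>2 \<le> (2 * \<delta>)\<^sup>2" using abs_le_square_iff[of w "2 * \<delta>"] by force
      moreover have "(v + w)\<^sup>2 \<le> 2 * v\<^sup>2 + 2 * w\<^sup>2"
        using zero_le_power2[of "v - w"] by (simp add: power2_diff power2_sum)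
      moreover have "g j x + c = v + w" by (simp add: v_def w_def)
      ultimately have "(g j x + c)\<^sup>2 \<le> 2 * v\<^sup>2 + 8 * \<delta>\<^sup>2" by (simp add: power_mult_distrib)
      then show ?thesis by (simp only: v_def)
    qed
    have "integral {0..L j} (\<lambda>x. (g j x + c)\<^sup>2) \<le> 2 * V j lam + 8 * \<delta>\<^sup>2 * L j"
    proof (rule has_integral_le[OF integrable_integral])
      show "(\<lambda>x. (g j x + c)\<^sup>2) integrable_on {0..L j}"
        by (intro integrable_continuous_real continuous_intros g j)
      show "((\<lambda>x. 2 * (g j x + Z j lam x / Y j lam x)\<^sup>2 + 8 * \<delta>\<^sup>2) has_integral 2 * V j lam + 8 * \<delta>\<^sup>2 * L j) {0..L j}"
        using has_integral_const_real[of "8 * \<delta>\<^sup>2" 0 "L j"] L[OF j]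
        by (intro has_integral_add has_integral_mult_right rb(1)) (auto simp: mult.commute)
    qed (rule pt)
    then have "integral {0..L j} (\<lambda>x. (g j x + c)\<^sup>2) \<le> \<epsilon>" using V t by (simp add: \<delta>_def)
    then show "\<exists>c. integral {0..L j} (\<lambda>x. (g j x + c)\<^sup>2) \<le> \<epsilon>" by blast
  qed
qed

section \<open>Cycles glued at a vertex\<close>

lemma has_integral_reflect_shift:
  fixes h :: "real \<Rightarrow> real"
  assumes "(h has_integral I) {a..b}"
  shows "((\<lambda>x. h (c - x)) has_integral I) {c - b..c - a}"
proof -
  have "((\<lambda>x. h (- x)) has_integral I) {- b..- a}" using assms by (simp add: has_integral_reflect_real)
  from has_integral_shift_real_ivl[OF this, of "- c"] show ?thesis by (simp add: algebra_simps)
qed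

lemma primitive_shift:
  assumes "primitive a b F h"
  shows "primitive (a - c) (b - c) (\<lambda>x. F (x + c)) (\<lambda>x. h (x + c))"
  unfolding primitive_def absolutely_integrable_on_def
proof (intro conjI ballI)
  show "(\<lambda>x. h (x + c)) integrable_on {a - c..b - c}" "(\<lambda>x. norm (h (x + c))) integrable_on {a - c..b - c}"
    using assms has_integral_shift_real_ivl[of h _ a b c] has_integral_shift_real_ivl[of "\<lambda>x. norm (h x)" _ a b c]
    unfolding primitive_def absolutely_integrable_on_def integrable_on_def by blast+
  fix x assume x: "x \<in> {a - c..b - c}"
  then have "(h has_integral (F (x + c) - F a)) {a..x + c}" using assms by (auto simp: primitive_def)
  from has_integral_shift_real_ivl[OF this, of c]
  show "((\<lambda>x. h (x + c)) has_integral (F (x + c) - F (a - c + c))) {a - c..x}" by simp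
qed

lemma primitive_reflect:
  assumes "primitive a b F h"
  shows "primitive (c - b) (c - a) (\<lambda>x. F (c - x)) (\<lambda>x. - h (c - x))"
  unfolding primitive_def absolutely_integrable_on_def
proof (intro conjI ballI)
  have i: "h integrable_on {a..b}" "(\<lambda>x. norm (h x)) integrable_on {a..b}"
    using assms by (simp_all add: primitive_def absolutely_integrable_on_def)
  show "(\<lambda>x. - h (c - x)) integrable_on {c - b..c - a}"
    by (rule has_integral_integrable[OF has_integral_neg[OF has_integral_reflect_shift[OF integrable_integral[OF i(1)]]]])
  show "(\<lambda>x. norm (- h (c - x))) integrable_on {c - b..c - a}"
    unfolding norm_minus_cancel
    by (rule has_integral_integrable[OF has_integral_reflect_shift[OF integrable_integral[OF i(2)]]])
  fix x assume x: "x \<in> {c - b..c - a}"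
  have "(h has_integral (F b - F (c - x))) {c - x..b}"
    using x primitive_has_integral[OF primitive_subinterval[OF assms, of "c - x" b]] by auto
  from has_integral_neg[OF has_integral_reflect_shift[OF this, of c]]
  show "((\<lambda>x. - h (c - x)) has_integral (F (c - x) - F (c - (c - b)))) {c - b..x}" by simp
qed

lemma primitive_spike:
  assumes "primitive a b F h" "negligible N" "\<And>x. x \<in> {a..b} - N \<Longrightarrow> k x = h x"
  shows "primitive a b F k"
  unfolding primitive_def
proof (intro conjI ballI)
  show "k absolutely_integrable_on {a..b}"
    by (rule absolutely_integrable_spike[where f = h and S = N]) (use assms in \<open>auto simp: primitive_def\<close>)
  fix x assume x: "x \<in> {a..b}"
  then have "(h has_integral (F x - F a)) {a..x}" using assms(1) by (auto simp: primitive_def)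
  then show "(k has_integral (F x - F a)) {a..x}"
    by (rule has_integral_spike[OF assms(2), rotated]) (use x assms(3) in auto)
qed

text \<open>First order form of \<open>u'' = p u\<close>; in applications \<open>p\<close> is the
  potential minus the spectral parameter. Unlike \<open>edge_solution\<close> it carries
  \<open>u'\<close> as an explicit function \<open>w\<close> and lives on any interval, so edges can
  be reversed and concatenated.\<close>

definition sl_solution :: "real \<Rightarrow> real \<Rightarrow> (real \<Rightarrow> real) \<Rightarrow> (real \<Rightarrow> real) \<Rightarrow> (real \<Rightarrow> real) \<Rightarrow> bool" where
  "sl_solution a b p u w \<longleftrightarrow> primitive a b u w \<and> primitive a b w (\<lambda>x. p x * u x)"

lemma edge_deriv_eq:
  assumes "x \<in> {0..1}" "(f has_real_derivative d) (at x within {0..1})"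
  shows "edge_deriv f x = d"
  unfolding edge_deriv_def
  using assms by (intro vector_derivative_within_closed_interval)
    (auto simp: has_real_derivative_iff_has_vector_derivative[symmetric])

lemma edge_deriv_works:
  assumes "f differentiable (at x within {0..1})"
  shows "(f has_real_derivative edge_deriv f x) (at x within {0..1})"
  using assms unfolding edge_deriv_def has_real_derivative_iff_has_vector_derivative
  by (simp add: vector_derivative_works)

lemma edge_solution_imp_sl_solution:
  assumes q: "q absolutely_integrable_on {0..1}" and sol: "edge_solution q \<mu> f"
  shows "sl_solution 0 1 (\<lambda>x. q x - \<mu>) f (edge_deriv f)"
proof -
  have ac: "abs_continuous_on 0 1 (edge_deriv f)" using sol by (simp add: edge_solution_def)
  then have c: "continuous_on {0..1} (edge_deriv f)" by (rule abs_continuous_on_imp_continuous_on)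
  have df: "(f has_real_derivative edge_deriv f x) (at x within {0..1})" if "x \<in> {0..1}" for x
    using sol that by (intro edge_deriv_works) (auto simp: edge_solution_def)
  have p1: "primitive 0 1 f (edge_deriv f)" by (rule derivative_primitive[OF df c])
  have "AE x in lebesgue. x \<in> {0..1} \<longrightarrow> edge_deriv f differentiable (at x within {0..1}) \<and>
      - edge_deriv (edge_deriv f) x + q x * f x = \<mu> * f x"
    using sol by (simp add: edge_solution_def)
  then obtain N where N: "N \<in> null_sets lebesgue" "{x \<in> space lebesgue. \<not> (x \<in> {0..1} \<longrightarrow>
      edge_deriv f differentiable (at x within {0..1}) \<and> - edge_deriv (edge_deriv f) x + q x * f x = \<mu> * f x)} \<subseteq> N"
    unfolding eventually_ae_filter by blast
  have "primitive 0 1 (edge_deriv f) (\<lambda>x. (q x - \<mu>) * f x)"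
  proof (rule abs_continuous_on_primitive[OF ac])
    show "negligible N" using N(1) by (simp add: negligible_iff_null_sets)
    have "(\<lambda>x. q x - \<mu>) absolutely_integrable_on {0..1}" by (intro set_integral_diff q) auto
    then show "(\<lambda>x. (q x - \<mu>) * f x) absolutely_integrable_on {0..1}"
      by (rule absolutely_integrable_mult_continuous(2)[OF primitive_continuous_on[OF p1]])
    fix x assume x: "x \<in> {0..1} - N"
    then have *: "edge_deriv f differentiable (at x within {0..1})" "- edge_deriv (edge_deriv f) x + q x * f x = \<mu> * f x"
      using N(2) by auto
    have "edge_deriv (edge_deriv f) x = (q x - \<mu>) * f x" using *(2) by (simp add: algebra_simps)
    then show "(edge_deriv f has_real_derivative (q x - \<mu>) * f x) (at x within {0..1})"
      using edge_deriv_works[OF *(1)] by simp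
  qed
  with p1 show ?thesis by (simp add: sl_solution_def)
qed

lemma sl_solution_edge_deriv:
  assumes sol: "sl_solution 0 1 p f w" and x: "x \<in> {0..1}"
  shows "(f has_real_derivative w x) (at x within {0..1})" "edge_deriv f x = w x"
proof -
  show "(f has_real_derivative w x) (at x within {0..1})"
    using sol primitive_continuous_derivative[OF _ _ x, of f w] primitive_continuous_on[of 0 1 w]
    unfolding sl_solution_def by blast
  then show "edge_deriv f x = w x" by (rule edge_deriv_eq[OF x])
qed

text \<open>\<open>w\<close> is continuous, so \<open>f\<close> is differentiable at every point
  with \<open>edge_deriv f = w\<close>; an exceptional null set arises for the second derivative
  only.\<close>

lemma sl_solution_imp_edge_solution:
  assumes sol: "sl_solution 0 1 (\<lambda>x. q x - \<mu>) f w"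
  shows "edge_solution q \<mu> f"
proof -
  note d = sl_solution_edge_deriv[OF sol]
  have p: "primitive 0 1 f w" "primitive 0 1 w (\<lambda>x. (q x - \<mu>) * f x)" using sol by (auto simp: sl_solution_def)
  obtain N where N: "negligible N" "\<And>x. x \<in> {0..1} - N \<Longrightarrow> (w has_real_derivative (q x - \<mu>) * f x) (at x within {0..1})"
    using primitive_derivative[OF p(2)] by blast
  have dd: "(edge_deriv f has_real_derivative (q x - \<mu>) * f x) (at x within {0..1})" if "x \<in> {0..1} - N" for x
    by (rule has_field_derivative_transform_within[OF N(2)[OF that], where d = 1]) (use that d(2) in auto)
  have "AE x in lebesgue. x \<in> {0..1} \<longrightarrow> edge_deriv f differentiable (at x within {0..1}) \<and>
      - edge_deriv (edge_deriv f) x + q x * f x = \<mu> * f x"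
  proof (rule AE_I')
    show "N \<in> null_sets lebesgue" using N(1) by (simp add: negligible_iff_null_sets)
    have "edge_deriv f differentiable (at x within {0..1}) \<and> - edge_deriv (edge_deriv f) x + q x * f x = \<mu> * f x"
      if x: "x \<in> {0..1} - N" for x
    proof
      show "edge_deriv f differentiable (at x within {0..1})"
        using dd[OF x] by (auto simp: real_differentiable_def)
      show "- edge_deriv (edge_deriv f) x + q x * f x = \<mu> * f x"
        using edge_deriv_eq[OF _ dd[OF x]] x by (simp add: algebra_simps)
    qed
    then show "{x \<in> space lebesgue. \<not> (x \<in> {0..1} \<longrightarrow> edge_deriv f differentiable (at x within {0..1}) \<and>
      - edge_deriv (edge_deriv f) x + q x * f x = \<mu> * f x)} \<subseteq> N" by blast
  qed
  moreover have "\<forall>x\<in>{0..1}. f differentiable (at x within {0..1})"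
    using d(1) unfolding real_differentiable_def by blast
  moreover have "abs_continuous_on 0 1 (edge_deriv f)"
    by (rule abs_continuous_on_cong[OF primitive_abs_continuous_on[OF p(2)]]) (simp add: d(2))
  moreover have "abs_continuous_on 0 1 f" by (rule primitive_abs_continuous_on[OF p(1)])
  ultimately show ?thesis unfolding edge_solution_def by blast
qed

lemma sl_solution_reflect:
  assumes "sl_solution 0 1 p u w"
  shows "sl_solution 0 1 (\<lambda>x. p (1 - x)) (\<lambda>x. u (1 - x)) (\<lambda>x. - w (1 - x))"
  using assms primitive_reflect[of 0 1 u w 1] primitive_minus[OF primitive_reflect[of 0 1 w "\<lambda>x. p x * u x" 1]]
  by (simp add: sl_solution_def)

section \<open>Concatenation of functions on unit intervals\<close>

definition piece :: "nat \<Rightarrow> real \<Rightarrow> nat" where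
  "piece n x = min (nat \<lfloor>x\<rfloor>) (n - 1)"

text \<open>Pieces are half-open: at an inner integer point the piece to the right decides. Capping
  the index at \<open>n - 1\<close> in \<open>piece\<close> assigns the right end
  \<open>x = n\<close> to the last piece, at its argument 1.\<close>

definition glue :: "nat \<Rightarrow> (nat \<Rightarrow> real \<Rightarrow> real) \<Rightarrow> real \<Rightarrow> real" where
  "glue n f x = f (piece n x) (x - real (piece n x))"

lemma glue_interior:
  assumes "i < n" "real i \<le> x" "x < real i + 1"
  shows "glue n f x = f i (x - real i)"
proof -
  have "\<lfloor>x\<rfloor> = int i" using assms by (intro floor_unique) auto
  then have "piece n x = i" using assms by (simp add: piece_def)
  then show ?thesis by (simp add: glue_def)
qed

lemma glue_compatible:
  assumes compat: "\<And>i. Suc i < n \<Longrightarrow> f i 1 = f (Suc i) 0" and i: "i < n" and x: "real i \<le> x" "x \<le> real i + 1"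
  shows "glue n f x = f i (x - real i)"
proof (cases "x = real i + 1")
  case True
  show ?thesis
  proof (cases "Suc i < n")
    case True
    then have "glue n f x = f (Suc i) (x - real (Suc i))"
      using \<open>x = real i + 1\<close> by (intro glue_interior) auto
    then show ?thesis using compat[OF True] \<open>x = real i + 1\<close> by simp
  next
    case False
    then have "n = Suc i" using i by simp
    then have "piece n x = i" using \<open>x = real i + 1\<close> by (simp add: piece_def nat_add_distrib)
    then show ?thesis by (simp add: glue_def)
  qed
next
  case False
  then show ?thesis using assms by (intro glue_interior) auto
qed

text \<open>Only the primitives have to match at the integers. The derivatives may jump there, since
  changing \<open>h\<close> at the single point \<open>i + 1\<close> does not affect the
  integral.\<close>

lemma primitive_glue:
  assumes prim: "\<And>i. i < n \<Longrightarrow> primitive 0 1 (F i) (h i)"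
    and compat: "\<And>i. Suc i < n \<Longrightarrow> F i 1 = F (Suc i) 0"
  shows "primitive 0 (real n) (glue n F) (glue n h)"
proof -
  have piece: "primitive (real i) (real i + 1) (glue n F) (glue n h)" if i: "i < n" for i
  proof (rule primitive_spike[where N = "{real i + 1}"])
    have "primitive (real i) (real i + 1) (\<lambda>x. F i (x - real i)) (\<lambda>x. h i (x - real i))"
      using primitive_shift[OF prim[OF i], of "- real i"] by (simp add: add.commute)
    then show "primitive (real i) (real i + 1) (glue n F) (\<lambda>x. h i (x - real i))"
      by (rule primitive_cong) (use glue_compatible[of n F i] compat i in auto)
    show "glue n h x = h i (x - real i)" if "x \<in> {real i..real i + 1} - {real i + 1}" for x
      using that i by (intro glue_interior) auto
  qed simp
  have "primitive 0 (real m) (glue n F) (glue n h)" if "m \<le> n" for m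
    using that
  proof (induction m)
    case 0
    then show ?case by (simp add: primitive_def absolutely_integrable_negligible has_integral_refl)
  next
    case (Suc m)
    then show ?case using primitive_combine[of 0 "real m" _ _ "real m + 1"] piece[of m] by (simp add: add.commute)
  qed
  then show ?thesis by simp
qed

lemma absolutely_integrable_glue:
  assumes "\<And>i. i < n \<Longrightarrow> f i absolutely_integrable_on {0..1}"
  shows "glue n f absolutely_integrable_on {0..real n}"
proof -
  have "glue n f absolutely_integrable_on {0..real m}" if "m \<le> n" for m
    using that
  proof (induction m)
    case 0
    then show ?case by (simp add: absolutely_integrable_negligible)
  next
    case (Suc m)
    have fi: "f m integrable_on {0..1}"
      using assms[of m] Suc.prems by (intro absolutely_integrable_on_imp_integrable_on) simp
    \<comment> \<open>Viewed as the derivative of its indefinite integral, \<open>f m\<close> has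
      its integrability transported by \<open>primitive_shift\<close>.\<close>
    have "primitive 0 1 (\<lambda>x. integral {0..x} (f m)) (f m)"
      using assms[of m] Suc.prems
      unfolding primitive_def by (auto intro!: integrable_integral integrable_on_subinterval[OF fi])
    from primitive_shift[OF this, of "- real m"]
    have "(\<lambda>x. f m (x - real m)) absolutely_integrable_on {real m..real (Suc m)}" by (simp add: primitive_def add.commute)
    then have "glue n f absolutely_integrable_on {real m..real (Suc m)}"
      by (rule absolutely_integrable_spike[where S = "{real (Suc m)}"])
        (use Suc.prems in \<open>auto intro!: glue_interior\<close>)
    moreover have "glue n f absolutely_integrable_on {0..real m}" using Suc by simp
    ultimately have "glue n f absolutely_integrable_on ({0..real m} \<union> {real m..real (Suc m)})"
      by (intro set_integrable_Un) auto
    then show ?case by (simp add: ivl_disj_un)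
  qed
  then show ?thesis by simp
qed

lemma sl_solution_glue:
  assumes "\<And>i. i < n \<Longrightarrow> sl_solution 0 1 (p i) (u i) (w i)"
    and "\<And>i. Suc i < n \<Longrightarrow> u i 1 = u (Suc i) 0" "\<And>i. Suc i < n \<Longrightarrow> w i 1 = w (Suc i) 0"
  shows "sl_solution 0 (real n) (glue n p) (glue n u) (glue n w)"
proof -
  have "glue n (\<lambda>i x. p i x * u i x) = (\<lambda>x. glue n p x * glue n u x)" by (rule ext) (simp add: glue_def)
  then show ?thesis
    using assms primitive_glue[of n u w] primitive_glue[of n w "\<lambda>i x. p i x * u i x"]
    by (simp add: sl_solution_def)
qed

lemma sl_solution_piece:
  assumes "sl_solution 0 (real n) (glue n p) u w" "i < n"
  shows "sl_solution 0 1 (p i) (\<lambda>x. u (real i + x)) (\<lambda>x. w (real i + x))"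
proof -
  have s: "primitive 0 1 (\<lambda>x. F (real i + x)) (\<lambda>x. h (real i + x))" if "primitive 0 (real n) F h" for F h
    using primitive_shift[OF primitive_subinterval[OF that, of "real i" "real i + 1"], of "real i"] assms(2)
    by (simp add: add.commute)
  have "primitive 0 1 (\<lambda>x. w (real i + x)) (\<lambda>x. p i x * u (real i + x))"
  proof (rule primitive_spike[where N = "{1}"])
    show "primitive 0 1 (\<lambda>x. w (real i + x)) (\<lambda>x. glue n p (real i + x) * u (real i + x))"
      using s[of w "\<lambda>x. glue n p x * u x"] assms(1) by (simp add: sl_solution_def)
    show "p i x * u (real i + x) = glue n p (real i + x) * u (real i + x)" if "x \<in> {0..1} - {1}" for x
      using glue_interior[OF assms(2), of "real i + x" p] that by simp
  qed simp
  then show ?thesis using s[of u w] assms(1) by (simp add: sl_solution_def)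
qed

section \<open>Cycle coordinates on the graph and the vertex conditions in them\<close>

locale cycles_at_vertex =
  fixes r :: nat and G :: "('v, 'e) pre_digraph" and n :: "nat \<Rightarrow> nat" and v :: "nat \<Rightarrow> nat \<Rightarrow> 'v"
    and a :: "nat \<Rightarrow> nat \<Rightarrow> 'e" and c :: 'v
  assumes odd_length: "j \<in> {1..r} \<Longrightarrow> odd (n j)"
    and ends: "j \<in> {1..r} \<Longrightarrow> v j 0 = c" "j \<in> {1..r} \<Longrightarrow> v j (n j) = c"
    and inner: "j \<in> {1..r} \<Longrightarrow> i \<in> {1..<n j} \<Longrightarrow> v j i \<noteq> c"
    and inner_inj: "inj_on (\<lambda>(j, i). v j i) (SIGMA j:{1..r}. {1..<n j})"
    and verts: "verts G = (\<Union>j\<in>{1..r}. v j ` {0..n j})"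
    and arcs: "bij_betw (\<lambda>(j, i). a j i) (SIGMA j:{1..r}. {0..<n j}) (arcs G)"
    and incidence: "j \<in> {1..r} \<Longrightarrow> i < n j \<Longrightarrow> {tail G (a j i), head G (a j i)} = {v j i, v j (Suc i)}"
begin

abbreviation index :: "(nat \<times> nat) set" where
  "index \<equiv> SIGMA j:{1..r}. {0..<n j}"

text \<open>True for every loop, whose two ends coincide, so a loop is never reversed. On longer
  cycles \<open>v j i\<close> and \<open>v j (Suc i)\<close> differ, and this is the actual
  orientation of the edge.\<close>

definition forward :: "nat \<Rightarrow> nat \<Rightarrow> bool" where
  "forward j i \<longleftrightarrow> tail G (a j i) = v j i"

definition along_edge :: "('e \<Rightarrow> real \<Rightarrow> real) \<Rightarrow> nat \<Rightarrow> nat \<Rightarrow> real \<Rightarrow> real" where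
  "along_edge y j i x = (if forward j i then y (a j i) x else y (a j i) (1 - x))"

definition deriv_along_edge :: "('e \<Rightarrow> real \<Rightarrow> real) \<Rightarrow> nat \<Rightarrow> nat \<Rightarrow> real \<Rightarrow> real" where
  "deriv_along_edge y j i x =
     (if forward j i then edge_deriv (y (a j i)) x else - edge_deriv (y (a j i)) (1 - x))"

definition along_cycle :: "('e \<Rightarrow> real \<Rightarrow> real) \<Rightarrow> nat \<Rightarrow> real \<Rightarrow> real" where
  "along_cycle y j = glue (n j) (along_edge y j)"

definition deriv_along_cycle :: "('e \<Rightarrow> real \<Rightarrow> real) \<Rightarrow> nat \<Rightarrow> real \<Rightarrow> real" where
  "deriv_along_cycle y j = glue (n j) (deriv_along_edge y j)"

lemma length_pos: "j \<in> {1..r} \<Longrightarrow> 0 < n j"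
  using odd_length[of j] by (cases "n j") auto

lemma tail_head:
  assumes "j \<in> {1..r}" "i < n j"
  shows "forward j i \<Longrightarrow> tail G (a j i) = v j i \<and> head G (a j i) = v j (Suc i)"
    and "\<not> forward j i \<Longrightarrow> tail G (a j i) = v j (Suc i) \<and> head G (a j i) = v j i"
  using incidence[OF assms] by (auto simp: forward_def doubleton_eq_iff)

lemma arcs_eq: "arcs G = (\<lambda>(j, i). a j i) ` index"
  using arcs by (simp add: bij_betw_def)

lemma arc_in_arcs: "j \<in> {1..r} \<Longrightarrow> i < n j \<Longrightarrow> a j i \<in> arcs G"
  unfolding arcs_eq by (rule image_eqI[of _ _ "(j, i)"]) auto

lemma finite_arcs: "finite (arcs G)"
  unfolding arcs_eq by (intro finite_imageI finite_SigmaI) auto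

lemma vertex_cases:
  assumes "w \<in> verts G"
  obtains "w = c" | j i where "j \<in> {1..r}" "Suc i < n j" "w = v j (Suc i)"
proof -
  obtain j i where ji: "j \<in> {1..r}" "i \<le> n j" "w = v j i" using assms verts by auto
  consider "i = 0" | "i = n j" | k where "i = Suc k" "Suc k < n j"
    using ji(2) by (cases i) force+
  then show ?thesis using that ji ends[OF ji(1)] by cases auto
qed

lemma vertex_in_verts: "j \<in> {1..r} \<Longrightarrow> i \<le> n j \<Longrightarrow> v j i \<in> verts G"
  unfolding verts by (rule UN_I[of j]) auto

lemma start_at_centre_iff: "j \<in> {1..r} \<Longrightarrow> i < n j \<Longrightarrow> v j i = c \<longleftrightarrow> i = 0"
  using inner[of j i] ends(1)[of j] by (cases i) auto

lemma end_at_centre_iff: "j \<in> {1..r} \<Longrightarrow> i < n j \<Longrightarrow> v j (Suc i) = c \<longleftrightarrow> Suc i = n j"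
  using inner[of j "Suc i"] ends(2)[of j] by (cases "Suc i = n j") auto

text \<open>An inner vertex occurs exactly once among all cycle positions, hence exactly two edge
  ends meet there.\<close>

lemma inner_vertex_eq_iff:
  assumes "j \<in> {1..r}" "1 \<le> i" "i < n j" "j' \<in> {1..r}" "i' \<le> n j'"
  shows "v j' i' = v j i \<longleftrightarrow> j' = j \<and> i' = i"
proof
  assume eq: "v j' i' = v j i"
  have "v j i \<noteq> c" using inner[of j i] assms by auto
  then have "i' \<noteq> 0" "i' \<noteq> n j'" using eq ends[OF assms(4)] by metis+
  then have "(j', i') \<in> (SIGMA j:{1..r}. {1..<n j})" "(j, i) \<in> (SIGMA j:{1..r}. {1..<n j})"
    using assms by auto
  from inj_onD[OF inner_inj _ this] eq show "j' = j \<and> i' = i" by simp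
qed simp

lemma centre_in_verts: "1 \<le> r \<Longrightarrow> c \<in> verts G"
  using vertex_in_verts[of 1 0] ends(1)[of 1] by simp

text \<open>In the direction of traversal one edge ends and one edge starts at an inner vertex, so
  its condition links two consecutive pieces; the centre alone couples different cycles.\<close>

lemma vertex_continuity_iff:
  assumes r: "1 \<le> r"
  shows "vertex_continuity G y \<longleftrightarrow>
    (\<exists>c0. \<forall>j\<in>{1..r}. along_edge y j 0 0 = c0 \<and> along_edge y j (n j - 1) 1 = c0) \<and>
    (\<forall>j\<in>{1..r}. \<forall>i. Suc i < n j \<longrightarrow> along_edge y j i 1 = along_edge y j (Suc i) 0)"
proof -
  have at: "(\<forall>e\<in>out_arcs G w. y e 0 = d) \<and> (\<forall>e\<in>in_arcs G w. y e 1 = d) \<longleftrightarrow>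
      (\<forall>j\<in>{1..r}. \<forall>i<n j. (v j i = w \<longrightarrow> along_edge y j i 0 = d) \<and> (v j (Suc i) = w \<longrightarrow> along_edge y j i 1 = d))"
    (is "?l w d \<longleftrightarrow> ?r w d") for w d
  proof -
    have "?l w d \<longleftrightarrow> (\<forall>e\<in>arcs G. (tail G e = w \<longrightarrow> y e 0 = d) \<and> (head G e = w \<longrightarrow> y e 1 = d))"
      by (auto simp: out_arcs_def in_arcs_def)
    also have "\<dots> \<longleftrightarrow> (\<forall>j\<in>{1..r}. \<forall>i<n j. (tail G (a j i) = w \<longrightarrow> y (a j i) 0 = d) \<and> (head G (a j i) = w \<longrightarrow> y (a j i) 1 = d))"
      unfolding arcs_eq by auto
    also have "\<dots> \<longleftrightarrow> ?r w d"
    proof (intro ball_cong refl all_cong1 imp_cong)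
      fix j i assume "j \<in> {1..r}" "i < n j"
      then show "((tail G (a j i) = w \<longrightarrow> y (a j i) 0 = d) \<and> (head G (a j i) = w \<longrightarrow> y (a j i) 1 = d)) =
        ((v j i = w \<longrightarrow> along_edge y j i 0 = d) \<and> (v j (Suc i) = w \<longrightarrow> along_edge y j i 1 = d))"
        using tail_head[of j i] by (cases "forward j i") (auto simp: along_edge_def)
    qed
    finally show ?thesis .
  qed
  have centre: "?r c d \<longleftrightarrow> (\<forall>j\<in>{1..r}. along_edge y j 0 0 = d \<and> along_edge y j (n j - 1) 1 = d)" for d
  proof (intro ball_cong refl iffI)
    fix j assume j: "j \<in> {1..r}" and A: "\<forall>i<n j. (v j i = c \<longrightarrow> along_edge y j i 0 = d) \<and> (v j (Suc i) = c \<longrightarrow> along_edge y j i 1 = d)"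
    have np: "0 < n j" by (rule length_pos[OF j])
    show "along_edge y j 0 0 = d \<and> along_edge y j (n j - 1) 1 = d"
      using A[rule_format, of 0] A[rule_format, of "n j - 1"] np ends[OF j] by simp
  next
    fix j assume j: "j \<in> {1..r}" and B: "along_edge y j 0 0 = d \<and> along_edge y j (n j - 1) 1 = d"
    show "\<forall>i<n j. (v j i = c \<longrightarrow> along_edge y j i 0 = d) \<and> (v j (Suc i) = c \<longrightarrow> along_edge y j i 1 = d)"
    proof (intro allI impI conjI)
      fix i assume i: "i < n j"
      show "along_edge y j i 0 = d" if "v j i = c"
        using B start_at_centre_iff[OF j i] that by simp
      show "along_edge y j i 1 = d" if "v j (Suc i) = c"
      proof -
        have "n j - 1 = i" using end_at_centre_iff[OF j i] that by simp
        then show ?thesis using B by simp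
      qed
    qed
  qed
  have inner: "?r (v j (Suc i)) d \<longleftrightarrow> along_edge y j i 1 = d \<and> along_edge y j (Suc i) 0 = d"
    if j: "j \<in> {1..r}" and i: "Suc i < n j" for j i d
  proof
    assume "?r (v j (Suc i)) d"
    then show "along_edge y j i 1 = d \<and> along_edge y j (Suc i) 0 = d" using j i by auto
  next
    assume B: "along_edge y j i 1 = d \<and> along_edge y j (Suc i) 0 = d"
    show "?r (v j (Suc i)) d"
    proof (intro ballI allI impI conjI)
      fix j' i' assume *: "j' \<in> {1..r}" "i' < n j'"
      show "along_edge y j' i' 0 = d" if "v j' i' = v j (Suc i)"
        using inner_vertex_eq_iff[of j "Suc i" j' i'] that * j i B by auto
      show "along_edge y j' i' 1 = d" if "v j' (Suc i') = v j (Suc i)"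
        using inner_vertex_eq_iff[of j "Suc i" j' "Suc i'"] that * j i B by auto
    qed
  qed
  show ?thesis
  proof
    assume vc: "vertex_continuity G y"
    have ex: "\<exists>d. ?r w d" if "w \<in> verts G" for w
      using bspec[OF vc[unfolded vertex_continuity_def] that] unfolding at .
    show "(\<exists>c0. \<forall>j\<in>{1..r}. along_edge y j 0 0 = c0 \<and> along_edge y j (n j - 1) 1 = c0) \<and>
      (\<forall>j\<in>{1..r}. \<forall>i. Suc i < n j \<longrightarrow> along_edge y j i 1 = along_edge y j (Suc i) 0)"
    proof (intro conjI ballI allI impI)
      show "\<exists>c0. \<forall>j\<in>{1..r}. along_edge y j 0 0 = c0 \<and> along_edge y j (n j - 1) 1 = c0"
        using ex[OF centre_in_verts[OF r]] unfolding centre .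
      fix j i assume ji: "j \<in> {1..r}" "Suc i < n j"
      obtain d where "?r (v j (Suc i)) d" using ex[OF vertex_in_verts[of j "Suc i"]] ji by auto
      then show "along_edge y j i 1 = along_edge y j (Suc i) 0" using inner[OF ji, of d] by simp
    qed
  next
    assume A: "(\<exists>c0. \<forall>j\<in>{1..r}. along_edge y j 0 0 = c0 \<and> along_edge y j (n j - 1) 1 = c0) \<and>
      (\<forall>j\<in>{1..r}. \<forall>i. Suc i < n j \<longrightarrow> along_edge y j i 1 = along_edge y j (Suc i) 0)"
    show "vertex_continuity G y"
      unfolding vertex_continuity_def at
    proof
      fix w assume "w \<in> verts G"
      then show "\<exists>d. ?r w d"
      proof (cases rule: vertex_cases)
        case 1
        then show ?thesis using A centre by blast
      next
        case (2 j i)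
        then show ?thesis using A inner[OF 2(1,2)] by blast
      qed
    qed
  qed
qed

lemma vertex_kirchhoff_iff:
  assumes r: "1 \<le> r"
  shows "vertex_kirchhoff G y \<longleftrightarrow>
    (\<Sum>j=1..r. deriv_along_edge y j (n j - 1) 1 - deriv_along_edge y j 0 0) = 0 \<and>
    (\<forall>j\<in>{1..r}. \<forall>i. Suc i < n j \<longrightarrow> deriv_along_edge y j i 1 = deriv_along_edge y j (Suc i) 0)"
proof -
  let ?L = "\<lambda>(j, i). deriv_along_edge y j i 0" and ?R = "\<lambda>(j, i). deriv_along_edge y j i 1"
  \<comment> \<open>Net derivative at \<open>w\<close>, counted by the traversal of the cycles
    instead of by the orientation of the edges. Reversing an edge swaps its ends and changes the
    sign of its derivative, so both counts agree edge by edge.\<close>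
  define D where "D w = (\<Sum>p\<in>index. (if v (fst p) (snd p) = w then ?L p else 0) -
      (if v (fst p) (Suc (snd p)) = w then ?R p else 0))" for w
  have fin: "finite index" by (intro finite_SigmaI) auto
  have at: "(\<Sum>e\<in>out_arcs G w. edge_deriv (y e) 0) - (\<Sum>e\<in>in_arcs G w. edge_deriv (y e) 1) = D w" for w
  proof -
    have "(\<Sum>e\<in>out_arcs G w. edge_deriv (y e) 0) - (\<Sum>e\<in>in_arcs G w. edge_deriv (y e) 1) =
      (\<Sum>e\<in>arcs G. (if tail G e = w then edge_deriv (y e) 0 else 0) - (if head G e = w then edge_deriv (y e) 1 else 0))"
      unfolding sum_subtractf out_arcs_def in_arcs_def by (simp add: sum.inter_filter[OF finite_arcs])
    also have "\<dots> = (\<Sum>p\<in>index. (if tail G (case p of (j, i) \<Rightarrow> a j i) = w then edge_deriv (y (case p of (j, i) \<Rightarrow> a j i)) 0 else 0) -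
       (if head G (case p of (j, i) \<Rightarrow> a j i) = w then edge_deriv (y (case p of (j, i) \<Rightarrow> a j i)) 1 else 0))"
      by (rule sum.reindex_bij_betw[OF arcs, symmetric])
    also have "\<dots> = D w"
      unfolding D_def
    proof (rule sum.cong[OF refl], clarsimp simp only: mem_Sigma_iff split_paired_all fst_conv snd_conv prod.case)
      fix j i assume "j \<in> {1..r}" "i \<in> {0..<n j}"
      then have ji: "j \<in> {1..r}" "i < n j" by auto
      show "(if tail G (a j i) = w then edge_deriv (y (a j i)) 0 else 0) - (if head G (a j i) = w then edge_deriv (y (a j i)) 1 else 0) =
        (if v j i = w then deriv_along_edge y j i 0 else 0) - (if v j (Suc i) = w then deriv_along_edge y j i 1 else 0)"
        using tail_head[OF ji] by (cases "forward j i") (auto simp: deriv_along_edge_def)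
    qed
    finally show ?thesis .
  qed
  have kir: "vertex_kirchhoff G y \<longleftrightarrow> (\<forall>w\<in>verts G. D w = 0)"
    unfolding vertex_kirchhoff_def at[symmetric] by simp
  have centre: "D c = - (\<Sum>j=1..r. deriv_along_edge y j (n j - 1) 1 - deriv_along_edge y j 0 0)"
  proof -
    have "D c = (\<Sum>j=1..r. \<Sum>i=0..<n j. (if v j i = c then deriv_along_edge y j i 0 else 0) -
        (if v j (Suc i) = c then deriv_along_edge y j i 1 else 0))"
      unfolding D_def by (subst sum.Sigma) (auto intro!: sum.cong)
    also have "\<dots> = (\<Sum>j=1..r. deriv_along_edge y j 0 0 - deriv_along_edge y j (n j - 1) 1)"
    proof (rule sum.cong[OF refl])
      fix j assume j: "j \<in> {1..r}"
      have "(\<Sum>i=0..<n j. (if v j i = c then deriv_along_edge y j i 0 else 0) - (if v j (Suc i) = c then deriv_along_edge y j i 1 else 0))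
        = (\<Sum>i=0..<n j. (if i = 0 then deriv_along_edge y j i 0 else 0) - (if i = n j - 1 then deriv_along_edge y j i 1 else 0))"
        using start_at_centre_iff[OF j] end_at_centre_iff[OF j] by (intro sum.cong) auto
      also have "\<dots> = deriv_along_edge y j 0 0 - deriv_along_edge y j (n j - 1) 1"
        using length_pos[OF j] by (simp add: sum_subtractf)
      finally show "(\<Sum>i=0..<n j. (if v j i = c then deriv_along_edge y j i 0 else 0) - (if v j (Suc i) = c then deriv_along_edge y j i 1 else 0))
        = deriv_along_edge y j 0 0 - deriv_along_edge y j (n j - 1) 1" .
    qed
    also have "\<dots> = - (\<Sum>j=1..r. deriv_along_edge y j (n j - 1) 1 - deriv_along_edge y j 0 0)"
      by (simp add: sum_negf[symmetric])
    finally show ?thesis .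
  qed
  have inner: "D (v j (Suc i)) = deriv_along_edge y j (Suc i) 0 - deriv_along_edge y j i 1"
    if j: "j \<in> {1..r}" and i: "Suc i < n j" for j i
  proof -
    have "D (v j (Suc i)) = (\<Sum>p\<in>index. (if p = (j, Suc i) then ?L p else 0) - (if p = (j, i) then ?R p else 0))"
      unfolding D_def
    proof (rule sum.cong[OF refl])
      fix p assume p: "p \<in> index"
      obtain j' i' where pe: "p = (j', i')" by (cases p)
      have e: "v j' i' = v j (Suc i) \<longleftrightarrow> p = (j, Suc i)" "v j' (Suc i') = v j (Suc i) \<longleftrightarrow> p = (j, i)"
        using inner_vertex_eq_iff[of j "Suc i" j' i'] inner_vertex_eq_iff[of j "Suc i" j' "Suc i'"] p pe j i by auto
      show "(if v (fst p) (snd p) = v j (Suc i) then ?L p else 0) - (if v (fst p) (Suc (snd p)) = v j (Suc i) then ?R p else 0) =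
        (if p = (j, Suc i) then ?L p else 0) - (if p = (j, i) then ?R p else 0)"
        using e by (simp add: pe)
    qed
    also have "\<dots> = deriv_along_edge y j (Suc i) 0 - deriv_along_edge y j i 1"
      using j i fin by (simp add: sum_subtractf)
    finally show ?thesis .
  qed
  show ?thesis
    unfolding kir
  proof
    assume A: "\<forall>w\<in>verts G. D w = 0"
    show "(\<Sum>j=1..r. deriv_along_edge y j (n j - 1) 1 - deriv_along_edge y j 0 0) = 0 \<and>
      (\<forall>j\<in>{1..r}. \<forall>i. Suc i < n j \<longrightarrow> deriv_along_edge y j i 1 = deriv_along_edge y j (Suc i) 0)"
    proof (intro conjI ballI allI impI)
      show "(\<Sum>j=1..r. deriv_along_edge y j (n j - 1) 1 - deriv_along_edge y j 0 0) = 0"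
        using A centre_in_verts[OF r] centre by simp
      fix j i assume ji: "j \<in> {1..r}" "Suc i < n j"
      then show "deriv_along_edge y j i 1 = deriv_along_edge y j (Suc i) 0"
        using A vertex_in_verts[of j "Suc i"] inner[OF ji] by simp
    qed
  next
    assume B: "(\<Sum>j=1..r. deriv_along_edge y j (n j - 1) 1 - deriv_along_edge y j 0 0) = 0 \<and>
      (\<forall>j\<in>{1..r}. \<forall>i. Suc i < n j \<longrightarrow> deriv_along_edge y j i 1 = deriv_along_edge y j (Suc i) 0)"
    show "\<forall>w\<in>verts G. D w = 0"
    proof
      fix w assume "w \<in> verts G"
      then show "D w = 0"
      proof (cases rule: vertex_cases)
        case 1
        then show ?thesis using B centre by simp
      next
        case (2 j i)
        then show ?thesis using B inner[OF 2(1,2)] by simp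
      qed
    qed
  qed
qed

end

text \<open>Undoes the passage to the quasi-derivative: differentiating \<open>g u + z\<close>
  produces \<open>Q u\<close>, and all terms with \<open>g\<close> cancel, which leaves
  \<open>(Q - \<mu>) u\<close>.\<close>

lemma hill_solution_imp_sl_solution:
  assumes Q: "Q absolutely_integrable_on {0..L}" and sol: "hill_solution L (\<lambda>x. integral {0..x} Q) \<mu> u z"
  shows "sl_solution 0 L (\<lambda>x. Q x - \<mu>) u (\<lambda>x. integral {0..x} Q * u x + z x)"
proof -
  define g where "g x = integral {0..x} Q" for x
  have Qi: "Q integrable_on {0..L}" by (rule absolutely_integrable_on_imp_integrable_on[OF Q])
  have g: "primitive 0 L g Q"
    unfolding primitive_def g_def using Q by (auto intro!: integrable_integral integrable_on_subinterval[OF Qi])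
  note gc = primitive_continuous_on[OF g] and uc = hill_solution_continuous_on[OF sol[folded g_def]]
  note d = hill_solutionD[OF sol[folded g_def]]
  have u: "primitive 0 L u (\<lambda>x. g x * u x + z x)"
    by (rule derivative_primitive[OF d(1)]) (auto intro!: continuous_intros gc uc)
  have z: "primitive 0 L z (\<lambda>x. - (\<mu> + (g x)\<^sup>2) * u x - g x * z x)"
    by (rule derivative_primitive[OF d(2)]) (auto intro!: continuous_intros gc uc)
  have "primitive 0 L (\<lambda>x. g x * u x + z x)
      (\<lambda>x. (Q x * u x + g x * (g x * u x + z x)) + (- (\<mu> + (g x)\<^sup>2) * u x - g x * z x))"
    by (intro primitive_add primitive_mult g u z)
  then have "primitive 0 L (\<lambda>x. g x * u x + z x) (\<lambda>x. (Q x - \<mu>) * u x)"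
    by (rule primitive_cong) (simp_all add: algebra_simps power2_eq_square)
  with u show ?thesis by (simp add: sl_solution_def g_def)
qed

lemma primitive_zero_imp_AE_zero:
  assumes h: "primitive a b (\<lambda>_. 0) h"
  shows "AE x\<in>{a..b} in lebesgue. h x = 0"
proof -
  obtain N where N: "negligible N" "\<And>x. x \<in> {a..b} - N \<Longrightarrow> ((\<lambda>_. 0) has_real_derivative h x) (at x within {a..b})"
    using primitive_derivative[OF h] by blast
  show ?thesis
  proof (rule AE_I')
    show "insert a (insert b N) \<in> null_sets lebesgue" using N(1) by (simp add: negligible_iff_null_sets[symmetric])
    have "h x = 0" if "x \<in> {a..b}" "x \<notin> insert a (insert b N)" for x
    proof -
      have "((\<lambda>_. 0) has_real_derivative h x) (at x)" using N(2)[of x] that by (auto simp: at_within_Icc_at)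
      then show ?thesis using DERIV_unique DERIV_const by blast
    qed
    then show "{x \<in> space lebesgue. \<not> (x \<in> {a..b} \<longrightarrow> h x = 0)} \<subseteq> insert a (insert b N)" by blast
  qed
qed

lemma absolutely_integrable_reflect_unit:
  fixes f :: "real \<Rightarrow> real"
  assumes "f absolutely_integrable_on {0..1}"
  shows "(\<lambda>x. f (1 - x)) absolutely_integrable_on {0..1}"
proof -
  have i: "f integrable_on {0..1}" "(\<lambda>x. norm (f x)) integrable_on {0..1}"
    using assms by (simp_all add: absolutely_integrable_on_def)
  show ?thesis
    using has_integral_integrable[OF has_integral_reflect_shift[OF integrable_integral[OF i(1)], of 1]]
      has_integral_integrable[OF has_integral_reflect_shift[OF integrable_integral[OF i(2)], of 1]]
    by (simp add: absolutely_integrable_on_def)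
qed

lemma glue_diff_const: "glue n (\<lambda>i x. f i x - \<mu>) = (\<lambda>x. glue n f x - \<mu>)"
  by (simp add: glue_def fun_eq_iff)

section \<open>Translation of eigenfunctions between the graph and its cycles\<close>

context cycles_at_vertex
begin

lemma along_cycle_add: "along_cycle (y + z) j x = along_cycle y j x + along_cycle z j x"
  by (simp add: along_cycle_def glue_def along_edge_def)

lemma along_cycle_scale: "along_cycle (scale_family k y) j x = k * along_cycle y j x"
  by (simp add: along_cycle_def glue_def along_edge_def scale_family_def)

lemma along_cycle_zero: "along_cycle 0 j x = 0"
  by (simp add: along_cycle_def glue_def along_edge_def)

lemma along_edge_absolutely_integrable:
  assumes "q (a j i) absolutely_integrable_on {0..1}"
  shows "along_edge q j i absolutely_integrable_on {0..1}"
proof (cases "forward j i")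
  case True
  then have "along_edge q j i = q (a j i)" by (simp add: along_edge_def fun_eq_iff)
  then show ?thesis using assms by simp
next
  case False
  then have "along_edge q j i = (\<lambda>x. q (a j i) (1 - x))" by (simp add: along_edge_def fun_eq_iff)
  then show ?thesis using absolutely_integrable_reflect_unit[OF assms] by simp
qed

lemma along_cycle_absolutely_integrable:
  assumes "\<And>e. e \<in> arcs G \<Longrightarrow> q e absolutely_integrable_on {0..1}" "j \<in> {1..r}"
  shows "along_cycle q j absolutely_integrable_on {0..real (n j)}"
  unfolding along_cycle_def
  by (intro absolutely_integrable_glue along_edge_absolutely_integrable assms(1) arc_in_arcs assms(2))

lemma along_cycle_ends:
  assumes "j \<in> {1..r}"
  shows "along_cycle y j 0 = along_edge y j 0 0" "along_cycle y j (real (n j)) = along_edge y j (n j - 1) 1"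
    "deriv_along_cycle y j 0 = deriv_along_edge y j 0 0" "deriv_along_cycle y j (real (n j)) = deriv_along_edge y j (n j - 1) 1"
  using length_pos[OF assms]
  by (simp_all add: along_cycle_def deriv_along_cycle_def glue_def piece_def of_nat_diff)

lemma sl_solution_along_edge:
  assumes q: "q (a j i) absolutely_integrable_on {0..1}" and sol: "edge_solution (q (a j i)) \<mu> (y (a j i))"
  shows "sl_solution 0 1 (\<lambda>x. along_edge q j i x - \<mu>) (along_edge y j i) (deriv_along_edge y j i)"
proof -
  note s = edge_solution_imp_sl_solution[OF q sol]
  show ?thesis
  proof (cases "forward j i")
    case True
    then have "along_edge q j i = q (a j i)" "along_edge y j i = y (a j i)" "deriv_along_edge y j i = edge_deriv (y (a j i))"
      by (simp_all add: along_edge_def deriv_along_edge_def fun_eq_iff)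
    then show ?thesis using s by simp
  next
    case False
    then have "along_edge q j i = (\<lambda>x. q (a j i) (1 - x))" "along_edge y j i = (\<lambda>x. y (a j i) (1 - x))"
      "deriv_along_edge y j i = (\<lambda>x. - edge_deriv (y (a j i)) (1 - x))"
      by (simp_all add: along_edge_def deriv_along_edge_def fun_eq_iff)
    then show ?thesis using sl_solution_reflect[OF s] by simp
  qed
qed

lemma solution_along_cycles:
  assumes r: "1 \<le> r" and q: "\<And>e. e \<in> arcs G \<Longrightarrow> q e absolutely_integrable_on {0..1}"
    and y: "y \<in> solution_space G q \<mu>"
  shows "\<And>j. j \<in> {1..r} \<Longrightarrow> sl_solution 0 (real (n j)) (\<lambda>x. along_cycle q j x - \<mu>) (along_cycle y j) (deriv_along_cycle y j)"
    and "\<exists>c0. \<forall>j\<in>{1..r}. along_cycle y j 0 = c0 \<and> along_cycle y j (real (n j)) = c0"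
    and "(\<Sum>j=1..r. deriv_along_cycle y j (real (n j)) - deriv_along_cycle y j 0) = 0"
proof -
  have y': "\<And>e. e \<in> arcs G \<Longrightarrow> edge_solution (q e) \<mu> (y e)" "vertex_continuity G y" "vertex_kirchhoff G y"
    using y by (auto simp: solution_space_def)
  note vc = y'(2)[unfolded vertex_continuity_iff[OF r]] and vk = y'(3)[unfolded vertex_kirchhoff_iff[OF r]]
  show "sl_solution 0 (real (n j)) (\<lambda>x. along_cycle q j x - \<mu>) (along_cycle y j) (deriv_along_cycle y j)" if j: "j \<in> {1..r}" for j
  proof -
    have "sl_solution 0 (real (n j)) (glue (n j) (\<lambda>i x. along_edge q j i x - \<mu>)) (along_cycle y j) (deriv_along_cycle y j)"
      unfolding along_cycle_def deriv_along_cycle_def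
    proof (rule sl_solution_glue)
      fix i assume "i < n j"
      then have "a j i \<in> arcs G" using arc_in_arcs j by blast
      then show "sl_solution 0 1 (\<lambda>x. along_edge q j i x - \<mu>) (along_edge y j i) (deriv_along_edge y j i)"
        using q y'(1) by (intro sl_solution_along_edge)
    qed (use vc vk j in blast)+
    then show ?thesis by (simp add: glue_diff_const along_cycle_def)
  qed
  show "\<exists>c0. \<forall>j\<in>{1..r}. along_cycle y j 0 = c0 \<and> along_cycle y j (real (n j)) = c0"
    using vc by (simp add: along_cycle_ends)
  show "(\<Sum>j=1..r. deriv_along_cycle y j (real (n j)) - deriv_along_cycle y j 0) = 0"
    using vk by (simp add: along_cycle_ends)
qed

text \<open>The cycles cover all edges, and families in \<open>solution_space\<close> vanish
  elsewhere. This will make the inner product on cycles positive definite.\<close>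

lemma along_cycle_eq_zero_imp:
  assumes r: "1 \<le> r" and y: "y \<in> solution_space G q \<mu>"
    and zero: "\<And>j x. j \<in> {1..r} \<Longrightarrow> x \<in> {0..real (n j)} \<Longrightarrow> along_cycle y j x = 0"
  shows "y = 0"
proof (intro ext, simp)
  fix e x
  have vc: "\<forall>j\<in>{1..r}. \<forall>i. Suc i < n j \<longrightarrow> along_edge y j i 1 = along_edge y j (Suc i) 0"
    using y vertex_continuity_iff[OF r, of y] by (simp add: solution_space_def)
  show "y e x = 0"
  proof (cases "e \<in> arcs G \<and> x \<in> {0..1}")
    case False
    then show ?thesis using y by (auto simp: solution_space_def)
  next
    case True
    then obtain j i where ji: "j \<in> {1..r}" "i < n j" "e = a j i" using arcs_eq by auto
    have z: "along_edge y j i t = 0" if t: "t \<in> {0..1}" for t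
    proof -
      have "along_cycle y j (real i + t) = along_edge y j i (real i + t - real i)"
        unfolding along_cycle_def by (rule glue_compatible) (use vc ji t in auto)
      moreover have "real i + t \<le> real (n j)" using ji(2) t by (simp add: of_nat_less_iff[symmetric] del: of_nat_less_iff)
      ultimately show ?thesis using zero[OF ji(1), of "real i + t"] t by simp
    qed
    show ?thesis
      using z[of x] z[of "1 - x"] True ji(3) by (cases "forward j i") (auto simp: along_edge_def)
  qed
qed

text \<open>Converse of \<open>solution_along_cycles\<close>: the \<open>u j\<close> are cut at the
  integers and carried back to the edges, reversed where the orientation demands it. The conditions
  at inner vertices hold because \<open>u j\<close> and \<open>w j\<close> are single functions on
  the whole cycle.\<close>

lemma solution_from_cycles:
  assumes r: "1 \<le> r"
    and sol: "\<And>j. j \<in> {1..r} \<Longrightarrow> sl_solution 0 (real (n j)) (\<lambda>x. along_cycle q j x - \<mu>) (u j) (w j)"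
    and ends: "\<And>j. j \<in> {1..r} \<Longrightarrow> u j 0 = c0 \<and> u j (real (n j)) = c0"
    and kirchhoff: "(\<Sum>j=1..r. w j (real (n j)) - w j 0) = 0"
  obtains y where "y \<in> solution_space G q \<mu>" "\<forall>j\<in>{1..r}. \<forall>i<n j. \<forall>x\<in>{0..1}. along_edge y j i x = u j (real i + x)"
proof -
  \<comment> \<open>The place of an edge in the cycles, well defined since \<open>a\<close> is a
    bijection from \<open>index\<close> onto the edges.\<close>
  define idx where "idx = inv_into index (\<lambda>(j, i). a j i)"
  have idx: "idx (a j i) = (j, i)" if "j \<in> {1..r}" "i < n j" for j i
    unfolding idx_def using inv_into_f_f[of "\<lambda>(j, i). a j i" index "(j, i)"] arcs that by (simp add: bij_betw_def)
  define f where "f e x = (case idx e of (j, i) \<Rightarrow> if forward j i then u j (real i + x) else u j (real i + (1 - x)))" for e x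
  define y where "y e x = (if e \<in> arcs G \<and> x \<in> {0..1} then f e x else 0)" for e x
  have ya: "y (a j i) x = (if forward j i then u j (real i + x) else u j (real i + (1 - x)))"
    if "j \<in> {1..r}" "i < n j" "x \<in> {0..1}" for j i x
    using that arc_in_arcs[OF that(1,2)] by (simp add: y_def f_def idx)
  have along: "along_edge y j i x = u j (real i + x)" if "j \<in> {1..r}" "i < n j" "x \<in> {0..1}" for j i x
    using ya[OF that(1,2), of x] ya[OF that(1,2), of "1 - x"] that(3) by (auto simp: along_edge_def)
  have piece: "sl_solution 0 1 (\<lambda>x. along_edge q j i x - \<mu>) (\<lambda>x. u j (real i + x)) (\<lambda>x. w j (real i + x))"
    if "j \<in> {1..r}" "i < n j" for j i
  proof (rule sl_solution_piece)
    show "sl_solution 0 (real (n j)) (glue (n j) (\<lambda>i x. along_edge q j i x - \<mu>)) (u j) (w j)"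
      using sol[OF that(1)] by (simp add: along_cycle_def glue_diff_const)
  qed (use that in auto)
  have edge: "sl_solution 0 1 (\<lambda>x. q (a j i) x - \<mu>) (y (a j i)) (\<lambda>x. if forward j i then w j (real i + x) else - w j (real i + (1 - x)))"
    if ji: "j \<in> {1..r}" "i < n j" for j i
  proof -
    have cg: "sl_solution 0 1 p V W" if "sl_solution 0 1 p U W" "\<And>x. x \<in> {0..1} \<Longrightarrow> U x = V x" for p U V W
      unfolding sl_solution_def
    proof
      show "primitive 0 1 V W"
        by (rule primitive_cong[of 0 1 U W]) (use that in \<open>auto simp: sl_solution_def\<close>)
      show "primitive 0 1 W (\<lambda>x. p x * V x)"
        by (rule primitive_cong[of 0 1 W "\<lambda>x. p x * U x"]) (use that in \<open>auto simp: sl_solution_def\<close>)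
    qed
    show ?thesis
    proof (cases "forward j i")
      case True
      have "sl_solution 0 1 (\<lambda>x. q (a j i) x - \<mu>) (\<lambda>x. u j (real i + x)) (\<lambda>x. w j (real i + x))"
        using piece[OF ji] by (simp add: along_edge_def True)
      then have "sl_solution 0 1 (\<lambda>x. q (a j i) x - \<mu>) (y (a j i)) (\<lambda>x. w j (real i + x))"
        by (rule cg) (simp add: ya[OF ji] True)
      then show ?thesis by (simp add: True)
    next
      case False
      have "sl_solution 0 1 (\<lambda>x. q (a j i) x - \<mu>) (\<lambda>x. u j (real i + (1 - x))) (\<lambda>x. - w j (real i + (1 - x)))"
        using sl_solution_reflect[OF piece[OF ji]] by (simp add: along_edge_def False)
      then have "sl_solution 0 1 (\<lambda>x. q (a j i) x - \<mu>) (y (a j i)) (\<lambda>x. - w j (real i + (1 - x)))"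
        by (rule cg) (simp add: ya[OF ji] False)
      then show ?thesis by (simp add: False)
    qed
  qed
  have dalong: "deriv_along_edge y j i x = w j (real i + x)" if "j \<in> {1..r}" "i < n j" "x \<in> {0..1}" for j i x
    using sl_solution_edge_deriv(2)[OF edge[OF that(1,2)], of x] sl_solution_edge_deriv(2)[OF edge[OF that(1,2)], of "1 - x"] that(3)
    by (auto simp: deriv_along_edge_def)
  have last: "real (n j - 1) + 1 = real (n j)" "n j - 1 < n j" "0 < n j" if "j \<in> {1..r}" for j
    using length_pos[OF that] by (simp_all add: of_nat_diff)
  have "y \<in> solution_space G q \<mu>"
    unfolding solution_space_def mem_Collect_eq
  proof (intro conjI ballI allI impI)
    fix e assume "e \<in> arcs G"
    then obtain j i where ji: "j \<in> {1..r}" "i < n j" "e = a j i" using arcs_eq by auto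
    then show "edge_solution (q e) \<mu> (y e)" using sl_solution_imp_edge_solution[OF edge[OF ji(1,2)]] by simp
  next
    show "vertex_continuity G y"
      unfolding vertex_continuity_iff[OF r]
      using along last ends by (auto intro!: exI[of _ c0] simp: add.commute)
    have "(\<Sum>j=1..r. deriv_along_edge y j (n j - 1) 1 - deriv_along_edge y j 0 0) = (\<Sum>j=1..r. w j (real (n j)) - w j 0)"
      using dalong last by (intro sum.cong) auto
    then show "vertex_kirchhoff G y"
      unfolding vertex_kirchhoff_iff[OF r]
      using dalong kirchhoff by (auto simp: add.commute)
  next
    fix e and x :: real assume "e \<notin> arcs G \<or> x \<notin> {0..1}"
    then show "y e x = 0" by (auto simp: y_def)
  qed
  then show ?thesis using that along by blast
qed

lemma AE_zero_of_along_cycle_primitive_zero: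
  assumes e: "e \<in> arcs G" and q: "\<And>e. e \<in> arcs G \<Longrightarrow> q e absolutely_integrable_on {0..1}"
    and zero: "\<And>j x. j \<in> {1..r} \<Longrightarrow> x \<in> {0..real (n j)} \<Longrightarrow> integral {0..x} (along_cycle q j) = 0"
  shows "AE x\<in>{0..1} in lebesgue. q e x = 0"
proof -
  obtain j i where ji: "j \<in> {1..r}" "i < n j" "e = a j i" using e arcs_eq by auto
  have ai: "along_cycle q j absolutely_integrable_on {0..real (n j)}"
    by (rule along_cycle_absolutely_integrable[OF q ji(1)])
  have ii: "along_cycle q j integrable_on {0..x}" if "x \<in> {0..real (n j)}" for x
    using integrable_on_subinterval[OF absolutely_integrable_on_imp_integrable_on[OF ai]] that by auto
  have "primitive 0 (real (n j)) (\<lambda>_. 0) (along_cycle q j)"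
    unfolding primitive_def
  proof (intro conjI ballI ai)
    fix x assume x: "x \<in> {0..real (n j)}"
    show "(along_cycle q j has_integral 0 - 0) {0..x}"
      using integrable_integral[OF ii[OF x]] zero[OF ji(1) x] by simp
  qed
  from primitive_shift[OF primitive_subinterval[OF this, of "real i" "real i + 1"], of "real i"]
  have "primitive 0 1 (\<lambda>_. 0) (\<lambda>x. along_cycle q j (x + real i))" using ji(2) by simp
  then have p: "primitive 0 1 (\<lambda>_. 0) (along_edge q j i)"
  proof (rule primitive_spike[where N = "{1}"])
    show "along_edge q j i x = along_cycle q j (x + real i)" if "x \<in> {0..1} - {1}" for x
      unfolding along_cycle_def using glue_interior[OF ji(2), of "x + real i" "along_edge q j"] that by simp
  qed simp
  show ?thesis
  proof (cases "forward j i")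
    case True
    then have "along_edge q j i = q e" by (simp add: along_edge_def fun_eq_iff ji(3))
    then show ?thesis using primitive_zero_imp_AE_zero[OF p] by simp
  next
    case False
    then have eq: "(\<lambda>x. along_edge q j i (1 - x)) = q e" by (simp add: along_edge_def fun_eq_iff ji(3))
    have "primitive 0 1 (\<lambda>_. 0) (q e)"
      using primitive_minus[OF primitive_reflect[OF p, of 1]] by (simp add: eq)
    then show ?thesis by (rule primitive_zero_imp_AE_zero)
  qed
qed

text \<open>The continuation result is applied to \<open>g j\<close>, the antiderivative of the
  potential along the \<open>j\<close>-th cycle. It speaks of the jumps of \<open>z\<close>, the
  Kirchhoff condition of those of \<open>w = g u + z\<close>. For value 1 at the ends the two differ
  by the integral of the potential over the cycle, and these integrals sum to 0; so a vanishing sum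
  of the jumps of \<open>z\<close> would be an eigenfunction.\<close>

theorem nonneg_spectrum_zero_mean_imp_AE_zero:
  assumes r: "1 \<le> r" and q: "\<And>e. e \<in> arcs G \<Longrightarrow> q e absolutely_integrable_on {0..1}"
    and nonneg: "\<And>l. eigenvalue G q l \<Longrightarrow> 0 \<le> l"
    and mean: "(\<Sum>j=1..r. integral {0..real (n j)} (along_cycle q j)) = 0"
    and e: "e \<in> arcs G"
  shows "AE x\<in>{0..1} in lebesgue. q e x = 0"
proof (rule AE_zero_of_along_cycle_primitive_zero[OF e q])
  define g where "g j x = integral {0..x} (along_cycle q j)" for j x
  have ai: "along_cycle q j absolutely_integrable_on {0..real (n j)}" if "j \<in> {1..r}" for j
    by (rule along_cycle_absolutely_integrable[OF q that])
  fix j x assume j: "j \<in> {1..r}" and x: "x \<in> {0..real (n j)}"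
  have "g j x = g j 0"
  proof (rule no_negative_eigenvalue_imp_primitives_zero[where J = "{1..r}" and L = "\<lambda>j. real (n j)" and g = g])
    show "0 < real (n j)" if "j \<in> {1..r}" for j using length_pos[OF that] by simp
    show "continuous_on {0..real (n j)} (g j)" if "j \<in> {1..r}" for j
      unfolding g_def
      by (intro indefinite_integral_continuous_1 absolutely_integrable_on_imp_integrable_on ai that)
    fix lam and u z :: "nat \<Rightarrow> real \<Rightarrow> real"
    assume lam: "lam < 0" and sol: "\<And>j. j \<in> {1..r} \<Longrightarrow> hill_solution (real (n j)) (g j) lam (u j) (z j)"
      and ends: "\<And>j. j \<in> {1..r} \<Longrightarrow> u j 0 = 1 \<and> u j (real (n j)) = 1"
    show "(\<Sum>j=1..r. z j (real (n j)) - z j 0) \<noteq> 0"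
    proof
      assume z0: "(\<Sum>j=1..r. z j (real (n j)) - z j 0) = 0"
      define w where "w j x = g j x * u j x + z j x" for j x
      have "(\<Sum>j=1..r. w j (real (n j)) - w j 0) = (\<Sum>j=1..r. g j (real (n j)) + (z j (real (n j)) - z j 0))"
        using ends by (intro sum.cong) (auto simp: w_def g_def)
      also have "\<dots> = 0" using z0 mean by (simp add: sum.distrib g_def)
      finally have kir: "(\<Sum>j=1..r. w j (real (n j)) - w j 0) = 0" .
      have sl: "sl_solution 0 (real (n j)) (\<lambda>x. along_cycle q j x - lam) (u j) (w j)" if "j \<in> {1..r}" for j
        using hill_solution_imp_sl_solution[OF ai[OF that], of lam "u j" "z j"] sol[OF that]
        unfolding g_def w_def by simp
      obtain y where y: "y \<in> solution_space G q lam"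
        "\<forall>j\<in>{1..r}. \<forall>i<n j. \<forall>x\<in>{0..1}. along_edge y j i x = u j (real i + x)"
        by (rule solution_from_cycles[OF r sl ends kir])
      have "along_edge y 1 0 0 = 1" using bspec[OF y(2), of 1] ends[of 1] length_pos[of 1] r by simp
      then have "y \<noteq> 0" by (auto simp: along_edge_def split: if_splits)
      then have "eigenvalue G q lam" using y(1) by (auto simp: eigenvalue_def)
      then show False using nonneg lam by force
    qed
  qed (use j x in auto)
  then show "integral {0..x} (along_cycle q j) = 0" by (simp add: g_def)
qed

end

section \<open>Orthonormal eigenfunctions\<close>

lemma homogeneous_system_nontrivial_solution:
  fixes M :: "'i \<Rightarrow> 'j \<Rightarrow> real"
  assumes "finite J" "finite I" "card J < card I"
  shows "\<exists>c. (\<exists>i\<in>I. c i \<noteq> 0) \<and> (\<forall>j\<in>J. (\<Sum>i\<in>I. c i * M i j) = 0)"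
  using assms
proof (induction J arbitrary: I M rule: finite_induct)
  case empty
  then have "I \<noteq> {}" by auto
  then show ?case by (intro exI[of _ "\<lambda>_. 1"]) auto
next
  case (insert j J)
  show ?case
  proof (cases "\<forall>i\<in>I. M i j = 0")
    case True
    obtain c where "\<exists>i\<in>I. c i \<noteq> 0" "\<forall>j\<in>J. (\<Sum>i\<in>I. c i * M i j) = 0"
      using insert.IH[OF insert.prems(1), of M] insert.prems(2) insert.hyps by auto
    then show ?thesis using True by (intro exI[of _ c]) auto
  next
    case False
    then obtain i0 where i0: "i0 \<in> I" "M i0 j \<noteq> 0" by blast
    \<comment> \<open>Gaussian elimination: equation \<open>j\<close> is solved for the unknown
      \<open>i0\<close>, with pivot \<open>M i0 j\<close>, and inserted into the remaining
      equations.\<close>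
    define M' where "M' i k = M i k - M i j / M i0 j * M i0 k" for i k
    have "card J < card (I - {i0})" using insert.prems insert.hyps i0 by simp
    then obtain c where c: "\<exists>i\<in>I - {i0}. c i \<noteq> 0" "\<forall>k\<in>J. (\<Sum>i\<in>I - {i0}. c i * M' i k) = 0"
      using insert.IH[of "I - {i0}" M'] insert.prems(1) by blast
    define d where "d i = (if i = i0 then - (\<Sum>i\<in>I - {i0}. c i * M i j) / M i0 j else c i)" for i
    have sum: "(\<Sum>i\<in>I. d i * M i k) = (\<Sum>i\<in>I - {i0}. c i * M' i k)" for k
    proof -
      have "(\<Sum>i\<in>I. d i * M i k) = d i0 * M i0 k + (\<Sum>i\<in>I - {i0}. d i * M i k)"
        by (rule sum.remove[OF insert.prems(1) i0(1)])
      also have "(\<Sum>i\<in>I - {i0}. d i * M i k) = (\<Sum>i\<in>I - {i0}. c i * M i k)"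
        by (intro sum.cong) (auto simp: d_def)
      also have "d i0 * M i0 k = - ((\<Sum>i\<in>I - {i0}. c i * M i j) * (M i0 k / M i0 j))"
        by (simp add: d_def)
      also have "\<dots> = (\<Sum>i\<in>I - {i0}. - (c i * (M i j / M i0 j * M i0 k)))"
        unfolding sum_distrib_right sum_negf by (simp add: mult_ac)
      finally show ?thesis by (simp add: M'_def sum.distrib[symmetric] algebra_simps)
    qed
    show ?thesis
    proof (intro exI[of _ d] conjI ballI)
      show "\<exists>i\<in>I. d i \<noteq> 0" using c(1) by (auto simp: d_def)
      fix k assume "k \<in> insert j J"
      then show "(\<Sum>i\<in>I. d i * M i k) = 0"
        using c(2) i0(2) by (auto simp: sum M'_def)
    qed
  qed
qed

text \<open>The rows of \<open>A\<close> are an orthonormal basis of the hyperplane \<open>\<Sum>x\<^sub>j = 0\<close> that consists of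
  null vectors of the restriction of the form \<open>\<Sum>T\<^sub>j x\<^sub>j y\<^sub>j\<close> to this hyperplane.\<close>

lemma form_vanishing_on_hyperplane_trace_zero:
  fixes A :: "nat \<Rightarrow> nat \<Rightarrow> real" and p T :: "nat \<Rightarrow> real"
  assumes r: "2 \<le> r"
    and orth: "\<And>i k. i \<in> {1..r - 1} \<Longrightarrow> k \<in> {1..r - 1} \<Longrightarrow> (\<Sum>j=1..r. p j * (A i j * A k j)) = (if i = k then 1 else 0)"
    and hyper: "\<And>i. i \<in> {1..r - 1} \<Longrightarrow> (\<Sum>j=1..r. A i j) = 0"
    and const: "\<And>i j k. i \<in> {1..r - 1} \<Longrightarrow> j \<in> {1..r} \<Longrightarrow> k \<in> {1..r} \<Longrightarrow> A i j * T j = A i k * T k"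
  shows "(\<Sum>j=1..r. T j) = 0"
proof (cases "\<exists>j0\<in>{1..r}. T j0 = 0")
  case True
  then obtain j0 where j0: "j0 \<in> {1..r}" "T j0 = 0" by blast
  have "T l = 0" if l: "l \<in> {1..r}" for l
  proof (rule ccontr)
    assume Tl: "T l \<noteq> 0"
    then have lj: "l \<noteq> j0" using j0 by auto
    \<comment> \<open>All rows vanish at \<open>l\<close>, so they lie in the space of vectors with
      \<open>l\<close>-th coordinate 0 and coordinate sum 0, of dimension \<open>r - 2\<close>: too
      small for \<open>r - 1\<close> independent rows.\<close>
    have Al: "A i l = 0" if "i \<in> {1..r - 1}" for i using const[OF that l j0(1)] j0 Tl by simp
    \<comment> \<open>Coordinate \<open>l\<close> is 0 already and \<open>j0\<close> will be
      recovered from the coordinate sum, so \<open>r - 2\<close> equations in \<open>r - 1\<close>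
      unknowns remain.\<close>
    have "card ({1..r} - {l, j0}) = r - 2" using l j0 lj by (simp add: card_Diff_subset)
    then have "card ({1..r} - {l, j0}) < card {1..r - 1}" using r by simp
    then obtain c where c: "\<exists>i\<in>{1..r - 1}. c i \<noteq> 0" "\<forall>j\<in>{1..r} - {l, j0}. (\<Sum>i=1..r - 1. c i * A i j) = 0"
      using homogeneous_system_nontrivial_solution[of "{1..r} - {l, j0}" "{1..r - 1}" A] by auto
    define V where "V j = (\<Sum>i=1..r - 1. c i * A i j)" for j
    have V1: "V j = 0" if "j \<in> {1..r}" "j \<noteq> j0" for j
      using c(2) that Al by (cases "j = l") (auto simp: V_def)
    have "(\<Sum>j=1..r. V j) = (\<Sum>i=1..r - 1. c i * (\<Sum>j=1..r. A i j))"
      unfolding V_def sum_distrib_left by (rule sum.swap)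
    also have "\<dots> = 0" using hyper by simp
    finally have "V j0 = 0" using sum.remove[of "{1..r}" j0 V] j0 V1 by simp
    then have V: "V j = 0" if "j \<in> {1..r}" for j using V1 that by (cases "j = j0") auto
    have "c k = 0" if k: "k \<in> {1..r - 1}" for k
    proof -
      have "0 = (\<Sum>j=1..r. p j * (V j * A k j))" using V by simp
      also have "\<dots> = (\<Sum>j=1..r. \<Sum>i=1..r - 1. c i * (p j * (A i j * A k j)))"
        unfolding V_def by (simp add: sum_distrib_left sum_distrib_right mult_ac)
      also have "\<dots> = (\<Sum>i=1..r - 1. c i * (\<Sum>j=1..r. p j * (A i j * A k j)))"
        unfolding sum_distrib_left by (rule sum.swap)
      also have "\<dots> = (\<Sum>i=1..r - 1. c i * (if i = k then 1 else 0))"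
        using orth[OF _ k] by (intro sum.cong) auto
      also have "\<dots> = c k" using k by (simp add: if_distrib cong: if_cong)
      finally show ?thesis by simp
    qed
    then show False using c(1) by blast
  qed
  then show ?thesis by simp
next
  case False
  then have Tn: "T j \<noteq> 0" if "j \<in> {1..r}" for j using that by blast
  \<comment> \<open>The common value of the products in row \<open>i\<close>; that row is
    \<open>d i\<close> times the vector of the reciprocals \<open>1 / T j\<close>.\<close>
  define d where "d i = A i 1 * T 1" for i
  have d: "A i j * T j = d i" if "i \<in> {1..r - 1}" "j \<in> {1..r}" for i j
    using const[of i j 1] that r by (auto simp: d_def)
  have A: "A i j = d i / T j" if "i \<in> {1..r - 1}" "j \<in> {1..r}" for i j
    using d[OF that] Tn[OF that(2)] by (simp add: field_simps)
  have dn: "d i \<noteq> 0" if "i \<in> {1..r - 1}" for i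
  proof
    assume "d i = 0"
    then have "(\<Sum>j=1..r. p j * (A i j * A i j)) = 0" using A[OF that] by simp
    then show False using orth[OF that that] by simp
  qed
  \<comment> \<open>The rows are all proportional, so orthonormality permits only one of
    them.\<close>
  have "r = 2"
  proof (rule ccontr)
    assume "r \<noteq> 2"
    then have i12: "1 \<in> {1..r - 1}" "2 \<in> {1..r - 1}" using r by auto
    have "0 = d 2 * (\<Sum>j=1..r. p j * (A 1 j * A 1 j)) - d 1 * (\<Sum>j=1..r. p j * (A 2 j * A 1 j))"
      unfolding sum_distrib_left sum_subtractf[symmetric]
      using A[OF i12(1)] A[OF i12(2)] by (intro sum.neutral[symmetric]) (auto simp: algebra_simps)
    then show False using orth[OF i12(1) i12(1)] orth[OF i12(2) i12(1)] dn[OF i12(2)] by simp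
  qed
  have set: "{1..2::nat} = {1, 2}" by auto
  have "A 1 1 + A 1 2 = 0" using hyper[of 1] unfolding \<open>r = 2\<close> set by simp
  then have "d 1 / T 1 + d 1 / T 2 = 0"
    using A[of 1 1] A[of 1 2] \<open>r = 2\<close> by simp
  then have "d 1 * (T 1 + T 2) = 0" using Tn[of 1] Tn[of 2] \<open>r = 2\<close> by (simp add: field_simps)
  then have "T 1 + T 2 = 0" using dn[of 1] \<open>r = 2\<close> by simp
  then show ?thesis unfolding \<open>r = 2\<close> set by simp
qed

lemma bounded_families_convergent_subsequence:
  fixes f :: "nat \<Rightarrow> 'j \<Rightarrow> real"
  assumes "finite J" "\<And>j. j \<in> J \<Longrightarrow> bounded (range (\<lambda>k. f k j))"
  shows "\<exists>s l. strict_mono (s :: nat \<Rightarrow> nat) \<and> (\<forall>j\<in>J. (\<lambda>k. f (s k) j) \<longlonglongrightarrow> l j)"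
  using assms
proof (induction J rule: finite_induct)
  case empty
  then show ?case by (intro exI[of _ "\<lambda>k. k"]) (simp add: strict_mono_def)
next
  case (insert j J)
  then obtain s l where s: "strict_mono (s :: nat \<Rightarrow> nat)" "\<forall>j\<in>J. (\<lambda>k. f (s k) j) \<longlonglongrightarrow> l j" by auto
  have "bounded (range (\<lambda>k. f (s k) j))"
    by (rule bounded_subset[OF insert.prems[of j]]) auto
  then obtain l' t where t: "strict_mono (t :: nat \<Rightarrow> nat)" "((\<lambda>k. f (s k) j) \<circ> t) \<longlonglongrightarrow> l'"
    using bounded_imp_convergent_subsequence by blast
  have "(\<lambda>k. f ((s \<circ> t) k) i) \<longlonglongrightarrow> (l(j := l')) i" if "i \<in> insert j J" for i
  proof (cases "i = j")
    case True
    then show ?thesis using t(2) by (simp add: o_def)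
  next
    case False
    then have "((\<lambda>k. f (s k) i) \<circ> t) \<longlonglongrightarrow> l i" using s(2) t(1) that by (intro LIMSEQ_subseq_LIMSEQ) auto
    then show ?thesis using False by (simp add: o_def)
  qed
  then show ?case using strict_mono_o[OF s(1) t(1)] by blast
qed

section \<open>The solution space as a vector space\<close>

interpretation family: vector_space scale_family
  by (rule vector_space_scale_family)

lemma sl_solution_lincomb:
  assumes "sl_solution a b p u1 w1" "sl_solution a b p u2 w2"
  shows "sl_solution a b p (\<lambda>x. u1 x + k * u2 x) (\<lambda>x. w1 x + k * w2 x)"
proof -
  have "primitive a b (\<lambda>x. u1 x + k * u2 x) (\<lambda>x. w1 x + k * w2 x)"
    using assms unfolding sl_solution_def by (intro primitive_add primitive_cmult) auto
  moreover have "primitive a b (\<lambda>x. w1 x + k * w2 x) (\<lambda>x. p x * u1 x + k * (p x * u2 x))"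
    using assms unfolding sl_solution_def by (intro primitive_add primitive_cmult) auto
  then have "primitive a b (\<lambda>x. w1 x + k * w2 x) (\<lambda>x. p x * (u1 x + k * u2 x))"
    by (rule primitive_cong) (simp_all add: algebra_simps)
  ultimately show ?thesis by (simp add: sl_solution_def)
qed

text \<open>\<open>edge_deriv\<close> rests on a choice and is known to be additive only where
  derivatives exist; \<open>sl_solution\<close> supplies them at every point of
  \<open>{0..1}\<close>.\<close>

lemma solution_space_lincomb:
  assumes q: "\<And>e. e \<in> arcs G \<Longrightarrow> q e absolutely_integrable_on {0..1}"
    and y: "y \<in> solution_space G q \<mu>" and z: "z \<in> solution_space G q \<mu>"
  shows "y + scale_family k z \<in> solution_space G q \<mu>"
proof -
  let ?f = "y + scale_family k z"
  have f: "?f e x = y e x + k * z e x" for e x by (simp add: scale_family_def)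
  have sl: "sl_solution 0 1 (\<lambda>x. q e x - \<mu>) (?f e) (\<lambda>x. edge_deriv (y e) x + k * edge_deriv (z e) x)" if "e \<in> arcs G" for e
  proof -
    have "sl_solution 0 1 (\<lambda>x. q e x - \<mu>) (y e) (edge_deriv (y e))" "sl_solution 0 1 (\<lambda>x. q e x - \<mu>) (z e) (edge_deriv (z e))"
      using y z that by (auto intro!: edge_solution_imp_sl_solution q simp: solution_space_def)
    from sl_solution_lincomb[OF this, of k] show ?thesis
      by (simp add: scale_family_def plus_fun_def)
  qed
  have deriv: "edge_deriv (?f e) x = edge_deriv (y e) x + k * edge_deriv (z e) x" if "e \<in> arcs G" "x \<in> {0..1}" for e x
    by (rule sl_solution_edge_deriv(2)[OF sl[OF that(1)] that(2)])
  show ?thesis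
    unfolding solution_space_def mem_Collect_eq
  proof (intro conjI ballI allI impI)
    show "edge_solution (q e) \<mu> (?f e)" if "e \<in> arcs G" for e
      by (rule sl_solution_imp_edge_solution[OF sl[OF that]])
    have vy: "vertex_continuity G y" and vz: "vertex_continuity G z" using y z by (simp_all add: solution_space_def)
    show "vertex_continuity G ?f"
      unfolding vertex_continuity_def
    proof
      fix w assume w: "w \<in> verts G"
      obtain c where c: "\<forall>e\<in>out_arcs G w. y e 0 = c" "\<forall>e\<in>in_arcs G w. y e 1 = c"
        using vy w unfolding vertex_continuity_def by blast
      obtain d where d: "\<forall>e\<in>out_arcs G w. z e 0 = d" "\<forall>e\<in>in_arcs G w. z e 1 = d"
        using vz w unfolding vertex_continuity_def by blast
      show "\<exists>c. (\<forall>e\<in>out_arcs G w. ?f e 0 = c) \<and> (\<forall>e\<in>in_arcs G w. ?f e 1 = c)"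
        using c d by (intro exI[of _ "c + k * d"]) (simp only: f, simp)
    qed
    show "vertex_kirchhoff G ?f"
      unfolding vertex_kirchhoff_def
    proof
      fix w assume w: "w \<in> verts G"
      have "(\<Sum>e\<in>out_arcs G w. edge_deriv (?f e) 0) = (\<Sum>e\<in>out_arcs G w. edge_deriv (y e) 0) + k * (\<Sum>e\<in>out_arcs G w. edge_deriv (z e) 0)"
        unfolding sum_distrib_left sum.distrib[symmetric] by (intro sum.cong deriv) (auto simp: out_arcs_def)
      also have "\<dots> = (\<Sum>e\<in>in_arcs G w. edge_deriv (y e) 1) + k * (\<Sum>e\<in>in_arcs G w. edge_deriv (z e) 1)"
        using y z w by (simp add: solution_space_def vertex_kirchhoff_def)
      also have "\<dots> = (\<Sum>e\<in>in_arcs G w. edge_deriv (?f e) 1)"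
        unfolding sum_distrib_left sum.distrib[symmetric] by (intro sum.cong deriv[symmetric]) (auto simp: in_arcs_def)
      finally show "(\<Sum>e\<in>out_arcs G w. edge_deriv (?f e) 0) = (\<Sum>e\<in>in_arcs G w. edge_deriv (?f e) 1)" .
    qed
    fix e and x :: real assume "e \<notin> arcs G \<or> x \<notin> {0..1}"
    then show "?f e x = 0" using y z unfolding f by (auto simp: solution_space_def)
  qed
qed

lemma sl_solution_zero: "sl_solution 0 1 p (\<lambda>_. 0) (\<lambda>_. 0)"
  by (simp add: sl_solution_def primitive_def)

lemma subspace_solution_space:
  assumes q: "\<And>e. e \<in> arcs G \<Longrightarrow> q e absolutely_integrable_on {0..1}"
  shows "family.subspace (solution_space G q \<mu>)"
proof -
  have zero: "0 \<in> solution_space G q \<mu>"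
  proof -
    have z: "(0 :: real \<Rightarrow> real) = (\<lambda>_. 0)" by (simp add: fun_eq_iff)
    have es: "edge_solution p \<mu> 0" for p
      unfolding z by (rule sl_solution_imp_edge_solution[OF sl_solution_zero])
    have ed: "edge_deriv 0 x = 0" if "x \<in> {0..1}" for x
      unfolding z by (rule sl_solution_edge_deriv(2)[OF sl_solution_zero that])
    show ?thesis
      by (auto simp: solution_space_def vertex_continuity_def vertex_kirchhoff_def es ed)
  qed
  show ?thesis
  proof (rule family.subspaceI[OF zero])
    fix y z assume yz: "y \<in> solution_space G q \<mu>" "z \<in> solution_space G q \<mu>"
    show "y + z \<in> solution_space G q \<mu>"
      using solution_space_lincomb[where k = 1, OF q yz] by simp
  next
    fix k y assume "y \<in> solution_space G q \<mu>"
    then show "scale_family k y \<in> solution_space G q \<mu>"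
      using solution_space_lincomb[where k = k, OF q zero] by simp
  qed
qed

section \<open>The inner product of the graph in cycle coordinates\<close>

context cycles_at_vertex
begin

definition inner_cycles :: "('e \<Rightarrow> real \<Rightarrow> real) \<Rightarrow> ('e \<Rightarrow> real \<Rightarrow> real) \<Rightarrow> real" where
  "inner_cycles y z = (\<Sum>j=1..r. integral {0..real (n j)} (\<lambda>x. along_cycle y j x * along_cycle z j x))"

text \<open>Serves as the integrability condition under which \<open>inner_cycles\<close> is
  additive.\<close>

definition continuous_family :: "('e \<Rightarrow> real \<Rightarrow> real) \<Rightarrow> bool" where
  "continuous_family y \<longleftrightarrow> (\<forall>j\<in>{1..r}. continuous_on {0..real (n j)} (along_cycle y j))"

lemma inner_cycles_commute: "inner_cycles y z = inner_cycles z y"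
  by (simp add: inner_cycles_def mult.commute)

lemma inner_cycles_add_left:
  assumes "continuous_family x" "continuous_family y" "continuous_family z"
  shows "inner_cycles (x + y) z = inner_cycles x z + inner_cycles y z"
  unfolding inner_cycles_def sum.distrib[symmetric]
proof (rule sum.cong[OF refl])
  fix j assume j: "j \<in> {1..r}"
  have "continuous_on {0..real (n j)} (along_cycle x j)" "continuous_on {0..real (n j)} (along_cycle y j)"
    "continuous_on {0..real (n j)} (along_cycle z j)"
    using assms j by (auto simp: continuous_family_def)
  then show "integral {0..real (n j)} (\<lambda>t. along_cycle (x + y) j t * along_cycle z j t) =
    integral {0..real (n j)} (\<lambda>t. along_cycle x j t * along_cycle z j t) + integral {0..real (n j)} (\<lambda>t. along_cycle y j t * along_cycle z j t)"
    by (subst integral_add[symmetric]) (auto intro!: integrable_continuous_real continuous_intros simp: along_cycle_add algebra_simps)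
qed

lemma inner_cycles_scale_left: "inner_cycles (scale_family k y) z = k * inner_cycles y z"
  by (simp add: inner_cycles_def along_cycle_scale sum_distrib_left mult.assoc)

lemma inner_cycles_scale_right: "inner_cycles z (scale_family k y) = k * inner_cycles z y"
  by (simp add: inner_cycles_commute[of z] inner_cycles_scale_left)

lemma continuous_family_add: "continuous_family x \<Longrightarrow> continuous_family y \<Longrightarrow> continuous_family (x + y)"
  unfolding continuous_family_def along_cycle_add by (auto intro!: continuous_intros simp: along_cycle_add[abs_def] cong: continuous_on_cong)

lemma continuous_family_scale: "continuous_family x \<Longrightarrow> continuous_family (scale_family k x)"
  unfolding continuous_family_def along_cycle_scale by (auto intro!: continuous_intros simp: along_cycle_scale[abs_def] cong: continuous_on_cong)

lemma continuous_family_zero: "continuous_family 0"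
  unfolding continuous_family_def by (auto simp: along_cycle_zero cong: continuous_on_cong)

lemma inner_cycles_zero_left: "inner_cycles 0 z = 0"
  by (simp add: inner_cycles_def along_cycle_zero)

lemma inner_cycles_sum_left:
  assumes "finite I" "\<And>i. i \<in> I \<Longrightarrow> continuous_family (f i)" "continuous_family z"
  shows "continuous_family (\<Sum>i\<in>I. f i) \<and> inner_cycles (\<Sum>i\<in>I. f i) z = (\<Sum>i\<in>I. inner_cycles (f i) z)"
  using assms
  by (induction I rule: finite_induct)
    (auto simp: continuous_family_zero inner_cycles_zero_left inner_cycles_add_left continuous_family_add)

lemma solution_continuous_family:
  assumes r: "1 \<le> r" and q: "\<And>e. e \<in> arcs G \<Longrightarrow> q e absolutely_integrable_on {0..1}"
    and y: "y \<in> solution_space G q \<mu>"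
  shows "continuous_family y"
  using solution_along_cycles(1)[OF r q y] primitive_continuous_on
  unfolding continuous_family_def sl_solution_def by blast

lemma inner_cycles_pos:
  assumes r: "1 \<le> r" and q: "\<And>e. e \<in> arcs G \<Longrightarrow> q e absolutely_integrable_on {0..1}"
    and y: "y \<in> solution_space G q \<mu>" and nz: "y \<noteq> 0"
  shows "0 < inner_cycles y y"
proof -
  have c: "continuous_on {0..real (n j)} (\<lambda>x. along_cycle y j x * along_cycle y j x)" if "j \<in> {1..r}" for j
    using solution_continuous_family[OF r q y] that unfolding continuous_family_def by (intro continuous_intros) auto
  have nn: "0 \<le> integral {0..real (n j)} (\<lambda>x. along_cycle y j x * along_cycle y j x)" if "j \<in> {1..r}" for j
    by (rule integral_nonneg[OF integrable_continuous_real[OF c[OF that]]]) simp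
  have "inner_cycles y y \<noteq> 0"
  proof
    assume "inner_cycles y y = 0"
    then have z: "integral {0..real (n j)} (\<lambda>x. along_cycle y j x * along_cycle y j x) = 0" if "j \<in> {1..r}" for j
      using sum_nonneg_eq_0_iff[of "{1..r}" "\<lambda>j. integral {0..real (n j)} (\<lambda>x. along_cycle y j x * along_cycle y j x)"] nn that
      by (simp add: inner_cycles_def)
    have "along_cycle y j x = 0" if "j \<in> {1..r}" "x \<in> {0..real (n j)}" for j x
      using integral_eq_0_iff[OF c[OF that(1)]] z[OF that(1)] length_pos[OF that(1)] that(2) by auto
    then show False using along_cycle_eq_zero_imp[OF r y] nz by blast
  qed
  moreover have "0 \<le> inner_cycles y y" unfolding inner_cycles_def by (intro sum_nonneg nn)
  ultimately show ?thesis by simp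
qed

text \<open>Lagrange's identity \<open>(u' v - u v')' = (\<nu> - \<mu>) u v\<close> on each cycle.
  The boundary terms are \<open>d\<close> times the jump of \<open>u'\<close> minus \<open>c\<close>
  times the jump of \<open>v'\<close>, where \<open>c\<close> and \<open>d\<close> are the values at
  the centre; the Kirchhoff conditions make both jumps sum to 0.\<close>

lemma solutions_orthogonal:
  assumes r: "1 \<le> r" and q: "\<And>e. e \<in> arcs G \<Longrightarrow> q e absolutely_integrable_on {0..1}"
    and y: "y \<in> solution_space G q \<mu>" and z: "z \<in> solution_space G q \<nu>" and ne: "\<mu> \<noteq> \<nu>"
  shows "inner_cycles y z = 0"
proof -
  have Y2: "\<exists>c0. \<forall>j\<in>{1..r}. along_cycle y j 0 = c0 \<and> along_cycle y j (real (n j)) = c0"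
    and Y3: "(\<Sum>j=1..r. deriv_along_cycle y j (real (n j)) - deriv_along_cycle y j 0) = 0"
    by (rule solution_along_cycles(2,3)[OF r q y]; assumption)+
  have Z2: "\<exists>c0. \<forall>j\<in>{1..r}. along_cycle z j 0 = c0 \<and> along_cycle z j (real (n j)) = c0"
    and Z3: "(\<Sum>j=1..r. deriv_along_cycle z j (real (n j)) - deriv_along_cycle z j 0) = 0"
    by (rule solution_along_cycles(2,3)[OF r q z]; assumption)+
  obtain c where c: "\<forall>j\<in>{1..r}. along_cycle y j 0 = c \<and> along_cycle y j (real (n j)) = c" using Y2 by blast
  obtain d where d: "\<forall>j\<in>{1..r}. along_cycle z j 0 = d \<and> along_cycle z j (real (n j)) = d" using Z2 by blast
  have "(\<nu> - \<mu>) * integral {0..real (n j)} (\<lambda>x. along_cycle y j x * along_cycle z j x) =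
     d * (deriv_along_cycle y j (real (n j)) - deriv_along_cycle y j 0) - c * (deriv_along_cycle z j (real (n j)) - deriv_along_cycle z j 0)"
    if j: "j \<in> {1..r}" for j
  proof -
    let ?u = "along_cycle y j" and ?w = "deriv_along_cycle y j" and ?v = "along_cycle z j" and ?x = "deriv_along_cycle z j"
    let ?Q = "along_cycle q j"
    have p: "primitive 0 (real (n j)) ?u ?w" "primitive 0 (real (n j)) ?w (\<lambda>x. (?Q x - \<mu>) * ?u x)"
      "primitive 0 (real (n j)) ?v ?x" "primitive 0 (real (n j)) ?x (\<lambda>x. (?Q x - \<nu>) * ?v x)"
      using solution_along_cycles(1)[OF r q y j] solution_along_cycles(1)[OF r q z j] by (auto simp: sl_solution_def)
    have "primitive 0 (real (n j)) (\<lambda>x. ?w x * ?v x - ?u x * ?x x)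
        (\<lambda>x. ((?Q x - \<mu>) * ?u x * ?v x + ?w x * ?x x) - (?w x * ?x x + ?u x * ((?Q x - \<nu>) * ?v x)))"
      by (intro primitive_diff primitive_mult p)
    then have "primitive 0 (real (n j)) (\<lambda>x. ?w x * ?v x - ?u x * ?x x) (\<lambda>x. (\<nu> - \<mu>) * (?u x * ?v x))"
      by (rule primitive_cong) (simp_all add: algebra_simps)
    from integral_unique[OF primitive_has_integral[OF this]]
    have "(\<nu> - \<mu>) * integral {0..real (n j)} (\<lambda>x. ?u x * ?v x) =
        ?w (real (n j)) * ?v (real (n j)) - ?u (real (n j)) * ?x (real (n j)) - (?w 0 * ?v 0 - ?u 0 * ?x 0)" by simp
    also have "\<dots> = d * (?w (real (n j)) - ?w 0) - c * (?x (real (n j)) - ?x 0)"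
      using c d j by (simp add: algebra_simps)
    finally show ?thesis .
  qed
  then have "(\<nu> - \<mu>) * inner_cycles y z = (\<Sum>j=1..r. d * (deriv_along_cycle y j (real (n j)) - deriv_along_cycle y j 0) - c * (deriv_along_cycle z j (real (n j)) - deriv_along_cycle z j 0))"
    unfolding inner_cycles_def sum_distrib_left by (intro sum.cong) auto
  also have "\<dots> = 0" using Y3 Z3 by (simp add: sum_subtractf sum_distrib_left[symmetric])
  finally show ?thesis using ne by simp
qed

text \<open>Gram-Schmidt, one eigenvalue at a time. Earlier functions with a different eigenvalue
  are orthogonal automatically; those with the same one number fewer than the multiplicity, so the
  eigenspace contains an element outside their span.\<close>

lemma orthonormal_eigenfunctions:
  assumes r: "1 \<le> r" and q: "\<And>e. e \<in> arcs G \<Longrightarrow> q e absolutely_integrable_on {0..1}"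
    and ev: "eigenvalues_with_multiplicity G q m \<nu>"
  obtains \<phi> where "\<And>i. i \<in> {1..m} \<Longrightarrow> \<phi> i \<in> solution_space G q (\<nu> i)"
    "\<And>i k. i \<in> {1..m} \<Longrightarrow> k \<in> {1..m} \<Longrightarrow> inner_cycles (\<phi> i) (\<phi> k) = (if i = k then 1 else 0)"
proof -
  have "\<exists>\<phi>. (\<forall>i\<in>{1..k}. \<phi> i \<in> solution_space G q (\<nu> i)) \<and>
      (\<forall>i\<in>{1..k}. \<forall>i'\<in>{1..k}. inner_cycles (\<phi> i) (\<phi> i') = (if i = i' then 1 else 0))" if "k \<le> m" for k
    using that
  proof (induction k)
    case 0
    then show ?case by simp
  next
    case (Suc k)
    then obtain \<phi> where \<phi>': "\<forall>i\<in>{1..k}. \<phi> i \<in> solution_space G q (\<nu> i)"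
      "\<forall>i\<in>{1..k}. \<forall>i'\<in>{1..k}. inner_cycles (\<phi> i) (\<phi> i') = (if i = i' then 1 else 0)"
      using Suc_leD by blast
    have \<phi>: "\<And>i. i \<in> {1..k} \<Longrightarrow> \<phi> i \<in> solution_space G q (\<nu> i)"
      "\<And>i i'. i \<in> {1..k} \<Longrightarrow> i' \<in> {1..k} \<Longrightarrow> inner_cycles (\<phi> i) (\<phi> i') = (if i = i' then 1 else 0)"
      using \<phi>' by blast+
    define S where "S = solution_space G q (\<nu> (Suc k))"
    have sub: "family.subspace S" unfolding S_def by (rule subspace_solution_space[OF q])
    define I where "I = {i\<in>{1..k}. \<nu> i = \<nu> (Suc k)}"
    have finI: "finite I" by (simp add: I_def)
    have I: "\<phi> i \<in> S" "i \<in> {1..k}" if "i \<in> I" for i using \<phi>(1)[of i] that by (auto simp: I_def S_def)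
    have "I \<subseteq> {i'\<in>{1..m}. \<nu> i' = \<nu> (Suc k)}" "Suc k \<in> {i'\<in>{1..m}. \<nu> i' = \<nu> (Suc k)}" "Suc k \<notin> I"
      using Suc.prems by (auto simp: I_def)
    then have "I \<subset> {i'\<in>{1..m}. \<nu> i' = \<nu> (Suc k)}" by blast
    then have "card I < card {i'\<in>{1..m}. \<nu> i' = \<nu> (Suc k)}" by (intro psubset_card_mono) auto
    also have "\<dots> \<le> family.dim S"
      using ev Suc.prems unfolding eigenvalues_with_multiplicity_def eigenvalue_multiplicity_def S_def by auto
    finally have "card (\<phi> ` I) < family.dim S" using card_image_le[OF finI, of \<phi>] by linarith
    then have "\<not> S \<subseteq> family.span (\<phi> ` I)"
      using family.dim_le_card[of S "\<phi> ` I"] finI by auto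
    then obtain x where x: "x \<in> S" "x \<notin> family.span (\<phi> ` I)" by blast
    define P where "P = (\<Sum>i\<in>I. scale_family (inner_cycles x (\<phi> i)) (\<phi> i))"
    have PS: "P \<in> S" unfolding P_def
      using sub I by (intro family.subspace_sum family.subspace_scale) auto
    have Psp: "P \<in> family.span (\<phi> ` I)" unfolding P_def
      by (intro family.span_sum family.span_scale family.span_base) auto
    define z where "z = x - P"
    have zS: "z \<in> S" unfolding z_def using sub x(1) PS by (rule family.subspace_diff)
    have "z \<noteq> 0" using x(2) Psp by (auto simp: z_def)
    then have zz: "0 < inner_cycles z z" using inner_cycles_pos[OF r q zS[unfolded S_def]] by blast
    have cf: "continuous_family y" if "y \<in> S" for y
      using solution_continuous_family[OF r q that[unfolded S_def]] .
    have orth: "inner_cycles z (\<phi> i) = 0" if i: "i \<in> {1..k}" for i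
    proof (cases "i \<in> I")
      case True
      have cs: "continuous_family (scale_family (inner_cycles x (\<phi> l)) (\<phi> l))" if "l \<in> I" for l
        by (intro continuous_family_scale cf I that)
      have "inner_cycles P (\<phi> i) = (\<Sum>l\<in>I. inner_cycles (scale_family (inner_cycles x (\<phi> l)) (\<phi> l)) (\<phi> i))"
        unfolding P_def
        by (rule inner_cycles_sum_left[THEN conjunct2]) (use finI cs cf[OF I(1)[OF True]] in auto)
      also have "\<dots> = (\<Sum>l\<in>I. inner_cycles x (\<phi> l) * (if l = i then 1 else 0))"
        using \<phi>(2) I(2) i by (intro sum.cong) (auto simp: inner_cycles_scale_left)
      also have "\<dots> = inner_cycles x (\<phi> i)" using True finI by (simp add: if_distrib cong: if_cong)
      finally have "inner_cycles P (\<phi> i) = inner_cycles x (\<phi> i)" .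
      moreover have "inner_cycles x (\<phi> i) = inner_cycles z (\<phi> i) + inner_cycles P (\<phi> i)"
        using inner_cycles_add_left[OF cf[OF zS] cf[OF PS] cf[OF I(1)[OF True]]] by (simp add: z_def)
      ultimately show ?thesis by simp
    next
      case False
      then have "\<nu> (Suc k) \<noteq> \<nu> i" using i by (auto simp: I_def)
      then show ?thesis using solutions_orthogonal[OF r q zS[unfolded S_def] \<phi>(1)[OF i]] by blast
    qed
    define e where "e = scale_family (1 / sqrt (inner_cycles z z)) z"
    have eS: "e \<in> S" unfolding e_def using sub zS by (rule family.subspace_scale)
    have ee: "inner_cycles e e = 1"
      using zz by (simp add: e_def inner_cycles_scale_left inner_cycles_scale_right)
    have eo: "inner_cycles e (\<phi> i) = 0" "inner_cycles (\<phi> i) e = 0" if "i \<in> {1..k}" for i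
      using orth[OF that] by (simp_all add: e_def inner_cycles_scale_left inner_cycles_scale_right inner_cycles_commute[of "\<phi> i"])
    show ?case
    proof (intro exI[of _ "\<phi>(Suc k := e)"] conjI ballI)
      fix i assume "i \<in> {1..Suc k}"
      then show "(\<phi>(Suc k := e)) i \<in> solution_space G q (\<nu> i)"
        using \<phi>(1)[of i] eS by (cases "i = Suc k") (auto simp: S_def)
    next
      fix i i' assume "i \<in> {1..Suc k}" "i' \<in> {1..Suc k}"
      then show "inner_cycles ((\<phi>(Suc k := e)) i) ((\<phi>(Suc k := e)) i') = (if i = i' then 1 else 0)"
        using \<phi>(2)[of i i'] ee eo[of i] eo[of i'] by (cases "i = Suc k"; cases "i' = Suc k") auto
    qed
  qed
  then show ?thesis using that by blast
qed

end

section \<open>Asymptotics of eigenfunctions\<close>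

lemma perturbation_integral_bound:
  fixes Q u f :: "real \<Rightarrow> real"
  assumes u: "continuous_on {0..L} u" and Q: "Q absolutely_integrable_on {0..L}"
    and f: "continuous_on {0..x} f" "\<And>t. t \<in> {0..x} \<Longrightarrow> \<bar>f t\<bar> \<le> 1"
    and M: "\<And>t. t \<in> {0..L} \<Longrightarrow> \<bar>u t\<bar> \<le> M"
    and D: "integral {0..L} (\<lambda>t. \<bar>Q t\<bar>) + \<bar>\<theta>\<bar> * L \<le> D" and x: "x \<in> {0..L}"
  shows "\<bar>integral {0..x} (\<lambda>t. (Q t + \<theta>) * u t * f t)\<bar> \<le> D * M"
proof -
  have M0: "0 \<le> M" using order_trans[OF abs_ge_zero M[OF x]] .
  have cx: "continuous_on {0..x} u" using u x by (auto intro: continuous_on_subset)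
  have Qx: "Q absolutely_integrable_on {0..x}"
    using Q x by (auto intro: absolutely_integrable_on_subinterval)
  have absQ: "(\<lambda>t. \<bar>Q t\<bar>) integrable_on {0..L}" using Q by (simp add: absolutely_integrable_on_def)
  have absQx: "(\<lambda>t. \<bar>Q t\<bar>) integrable_on {0..x}" using Qx by (simp add: absolutely_integrable_on_def)
  have hi: "((\<lambda>t. (\<bar>Q t\<bar> + \<bar>\<theta>\<bar>) * M) has_integral (integral {0..x} (\<lambda>t. \<bar>Q t\<bar>) + \<bar>\<theta>\<bar> * x) * M) {0..x}"
    using has_integral_const_real[of "\<bar>\<theta>\<bar>" 0 x] x
    by (intro has_integral_mult_left has_integral_add integrable_integral absQx) (auto simp: mult.commute)
  have "norm (integral {0..x} (\<lambda>t. (Q t + \<theta>) * u t * f t)) \<le> integral {0..x} (\<lambda>t. (\<bar>Q t\<bar> + \<bar>\<theta>\<bar>) * M)"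
  proof (rule integral_norm_bound_integral)
    have "(\<lambda>t. Q t + \<theta>) absolutely_integrable_on {0..x}" using Qx by (intro set_integral_add) auto
    then have "(\<lambda>t. (Q t + \<theta>) * (u t * f t)) absolutely_integrable_on {0..x}"
      by (intro absolutely_integrable_mult_continuous continuous_intros cx f)
    then show "(\<lambda>t. (Q t + \<theta>) * u t * f t) integrable_on {0..x}"
      by (auto dest: absolutely_integrable_on_imp_integrable_on simp: mult.assoc)
    show "(\<lambda>t. (\<bar>Q t\<bar> + \<bar>\<theta>\<bar>) * M) integrable_on {0..x}" using hi by (rule has_integral_integrable)
    fix t assume t: "t \<in> {0..x}"
    have "\<bar>(Q t + \<theta>) * u t * f t\<bar> = \<bar>Q t + \<theta>\<bar> * (\<bar>u t\<bar> * \<bar>f t\<bar>)" by (simp add: abs_mult)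
    also have "\<dots> \<le> (\<bar>Q t\<bar> + \<bar>\<theta>\<bar>) * (M * 1)"
      using M[of t] f(2)[OF t] t x M0 by (intro mult_mono) auto
    finally show "norm ((Q t + \<theta>) * u t * f t) \<le> (\<bar>Q t\<bar> + \<bar>\<theta>\<bar>) * M" by simp
  qed
  also have "\<dots> = (integral {0..x} (\<lambda>t. \<bar>Q t\<bar>) + \<bar>\<theta>\<bar> * x) * M" by (rule integral_unique[OF hi])
  also have "\<dots> \<le> D * M"
  proof (rule mult_right_mono[OF _ M0])
    have "integral {0..x} (\<lambda>t. \<bar>Q t\<bar>) \<le> integral {0..L} (\<lambda>t. \<bar>Q t\<bar>)"
      using x by (intro integral_subset_le absQ absQx) auto
    moreover have "\<bar>\<theta>\<bar> * x \<le> \<bar>\<theta>\<bar> * L" using x by (intro mult_left_mono) auto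
    ultimately show "integral {0..x} (\<lambda>t. \<bar>Q t\<bar>) + \<bar>\<theta>\<bar> * x \<le> D" using D by linarith
  qed
  finally show ?thesis by simp
qed

text \<open>Variation of constants: the equation is the free one at \<open>\<omega>\<^sup>2\<close>
  with the perturbation \<open>(Q + (\<omega>\<^sup>2 - lam)) u\<close>, whose integral norm is at
  most \<open>D * M\<close>. The bound on \<open>u\<close> gains the factor
  \<open>1 / \<omega>\<close> of the sine kernel, the one on \<open>w\<close> does not.\<close>

lemma volterra_estimate:
  assumes sol: "sl_solution 0 L (\<lambda>x. Q x - lam) u w" and Q: "Q absolutely_integrable_on {0..L}"
    and om: "0 < \<omega>" and M: "\<And>t. t \<in> {0..L} \<Longrightarrow> \<bar>u t\<bar> \<le> M"
    and D: "integral {0..L} (\<lambda>t. \<bar>Q t\<bar>) + \<bar>\<omega>\<^sup>2 - lam\<bar> * L \<le> D" and x: "x \<in> {0..L}"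
  shows "\<bar>u x - (u 0 * cos (\<omega> * x) + w 0 / \<omega> * sin (\<omega> * x))\<bar> \<le> D * M / \<omega>"
    and "\<bar>w x - (w 0 * cos (\<omega> * x) - u 0 * \<omega> * sin (\<omega> * x))\<bar> \<le> D * M"
proof -
  have p: "primitive 0 x u w" "primitive 0 x w (\<lambda>x. (Q x - lam) * u x)"
    using sol x primitive_subinterval[of 0 L _ _ 0 x] by (auto simp: sl_solution_def)
  have uc: "continuous_on {0..L} u" using sol primitive_continuous_on by (auto simp: sl_solution_def)
  have s: "primitive 0 x (\<lambda>t. sin (\<omega> * (x - t))) (\<lambda>t. - \<omega> * cos (\<omega> * (x - t)))"
    and c: "primitive 0 x (\<lambda>t. cos (\<omega> * (x - t))) (\<lambda>t. \<omega> * sin (\<omega> * (x - t)))"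
    by (rule derivative_primitive; auto intro!: derivative_eq_intros continuous_intros)+
  have b: "\<bar>integral {0..x} (\<lambda>t. (Q t + (\<omega>\<^sup>2 - lam)) * u t * sin (\<omega> * (x - t)))\<bar> \<le> D * M"
    "\<bar>integral {0..x} (\<lambda>t. (Q t + (\<omega>\<^sup>2 - lam)) * u t * cos (\<omega> * (x - t)))\<bar> \<le> D * M"
    by (rule perturbation_integral_bound[OF uc Q _ _ M D x]; auto intro!: continuous_intros)+
  have "primitive 0 x (\<lambda>t. w t * sin (\<omega> * (x - t)) + \<omega> * (u t * cos (\<omega> * (x - t))))
      (\<lambda>t. ((Q t - lam) * u t * sin (\<omega> * (x - t)) + w t * (- \<omega> * cos (\<omega> * (x - t))))
         + \<omega> * (w t * cos (\<omega> * (x - t)) + u t * (\<omega> * sin (\<omega> * (x - t)))))"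
    by (intro primitive_add primitive_mult primitive_cmult p s c)
  then have "primitive 0 x (\<lambda>t. w t * sin (\<omega> * (x - t)) + \<omega> * (u t * cos (\<omega> * (x - t))))
      (\<lambda>t. (Q t + (\<omega>\<^sup>2 - lam)) * u t * sin (\<omega> * (x - t)))"
    by (rule primitive_cong) (simp_all add: algebra_simps power2_eq_square)
  from integral_unique[OF primitive_has_integral[OF this]] x
  have "integral {0..x} (\<lambda>t. (Q t + (\<omega>\<^sup>2 - lam)) * u t * sin (\<omega> * (x - t))) =
      \<omega> * (u x - (u 0 * cos (\<omega> * x) + w 0 / \<omega> * sin (\<omega> * x)))" using om by (simp add: algebra_simps)
  then have "\<omega> * \<bar>u x - (u 0 * cos (\<omega> * x) + w 0 / \<omega> * sin (\<omega> * x))\<bar> \<le> D * M"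
    using b(1) om by (simp add: abs_mult)
  then show "\<bar>u x - (u 0 * cos (\<omega> * x) + w 0 / \<omega> * sin (\<omega> * x))\<bar> \<le> D * M / \<omega>"
    using om by (simp add: field_simps)
  have "primitive 0 x (\<lambda>t. w t * cos (\<omega> * (x - t)) - \<omega> * (u t * sin (\<omega> * (x - t))))
      (\<lambda>t. ((Q t - lam) * u t * cos (\<omega> * (x - t)) + w t * (\<omega> * sin (\<omega> * (x - t))))
         - \<omega> * (w t * sin (\<omega> * (x - t)) + u t * (- \<omega> * cos (\<omega> * (x - t)))))"
    by (intro primitive_diff primitive_mult primitive_cmult p s c)
  then have "primitive 0 x (\<lambda>t. w t * cos (\<omega> * (x - t)) - \<omega> * (u t * sin (\<omega> * (x - t))))
      (\<lambda>t. (Q t + (\<omega>\<^sup>2 - lam)) * u t * cos (\<omega> * (x - t)))"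
    by (rule primitive_cong) (simp_all add: algebra_simps power2_eq_square)
  from integral_unique[OF primitive_has_integral[OF this]] x
  have "integral {0..x} (\<lambda>t. (Q t + (\<omega>\<^sup>2 - lam)) * u t * cos (\<omega> * (x - t))) =
      w x - (w 0 * cos (\<omega> * x) - u 0 * \<omega> * sin (\<omega> * x))" by (simp add: algebra_simps)
  then show "\<bar>w x - (w 0 * cos (\<omega> * x) - u 0 * \<omega> * sin (\<omega> * x))\<bar> \<le> D * M" using b(2) by simp
qed

text \<open>Lagrange's identity against \<open>sin (\<omega> * t)\<close>. For odd \<open>L\<close>
  and \<open>\<omega>\<close> an odd multiple of \<open>\<pi>\<close> only the end values of
  \<open>u\<close> survive, and these are common to all cycles.\<close>

lemma sine_test_integral:
  assumes sol: "sl_solution 0 L (\<lambda>x. Q x - lam) u w" and L: "0 \<le> L"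
  shows "((\<lambda>t. (Q t + (\<omega>\<^sup>2 - lam)) * u t * sin (\<omega> * t)) has_integral
    (w L * sin (\<omega> * L) - \<omega> * (u L * cos (\<omega> * L)) + \<omega> * u 0)) {0..L}"
proof -
  have p: "primitive 0 L u w" "primitive 0 L w (\<lambda>x. (Q x - lam) * u x)"
    using sol by (auto simp: sl_solution_def)
  have s: "primitive 0 L (\<lambda>t. sin (\<omega> * t)) (\<lambda>t. \<omega> * cos (\<omega> * t))"
    and c: "primitive 0 L (\<lambda>t. cos (\<omega> * t)) (\<lambda>t. - \<omega> * sin (\<omega> * t))"
    by (rule derivative_primitive; auto intro!: derivative_eq_intros continuous_intros)+
  have "primitive 0 L (\<lambda>t. w t * sin (\<omega> * t) - \<omega> * (u t * cos (\<omega> * t)))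
      (\<lambda>t. ((Q t - lam) * u t * sin (\<omega> * t) + w t * (\<omega> * cos (\<omega> * t)))
         - \<omega> * (w t * cos (\<omega> * t) + u t * (- \<omega> * sin (\<omega> * t))))"
    by (intro primitive_diff primitive_mult primitive_cmult p s c)
  then have "primitive 0 L (\<lambda>t. w t * sin (\<omega> * t) - \<omega> * (u t * cos (\<omega> * t)))
      (\<lambda>t. (Q t + (\<omega>\<^sup>2 - lam)) * u t * sin (\<omega> * t))"
    by (rule primitive_cong) (simp_all add: algebra_simps power2_eq_square)
  from primitive_has_integral[OF this L] show ?thesis by simp
qed

text \<open>The value \<open>- 1\<close> is where odd lengths matter for the asymptotics: a free
  solution changes sign along a cycle, so the equal values at the two ends of a cycle must be
  small.\<close>

lemma trig_at_odd_multiple: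
  assumes "odd n" "\<omega> = (2 * real k + 1) * pi"
  shows "cos (\<omega> * real n) = - 1" "sin (\<omega> * real n) = 0"
proof -
  have e: "\<omega> * real n = real ((2 * k + 1) * n) * pi" by (simp add: assms(2) algebra_simps)
  show "cos (\<omega> * real n) = - 1" unfolding e cos_npi using assms(1) by simp
  show "sin (\<omega> * real n) = 0" unfolding e by (rule sin_npi)
qed

lemma sin_squared_half_angle:
  assumes "\<omega> = (2 * real k + 1) * pi"
  shows "(sin (\<omega> * x))\<^sup>2 = 1 / 2 - cos (2 * (2 * real k + 1) * pi * x) / 2"
proof -
  have "cos (2 * (2 * real k + 1) * pi * x) = 1 - 2 * (sin (\<omega> * x))\<^sup>2"
    using cos_double_sin[of "\<omega> * x"] by (simp add: assms mult_ac)
  then show ?thesis by (simp add: field_simps)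
qed

lemma sin_squared_has_integral:
  assumes "\<omega> = (2 * real k + 1) * pi"
  shows "((\<lambda>x. (sin (\<omega> * x))\<^sup>2) has_integral real n / 2) {0..real n}"
proof -
  have c: "((\<lambda>x. cos (2 * (2 * real k + 1) * pi * x)) has_integral 0) {0..real n}"
    using cos_even_multiple_has_integral[of "int (2 * k + 1)" n] by (simp add: algebra_simps)
  have "((\<lambda>x. 1 / 2 - 1 / 2 * cos (2 * (2 * real k + 1) * pi * x)) has_integral (real n / 2 - 1 / 2 * 0)) {0..real n}"
    using has_integral_const_real[of "1 / 2 :: real" 0 "real n"]
    by (intro has_integral_diff has_integral_mult_right c) auto
  then show ?thesis by (simp add: sin_squared_half_angle[OF assms])
qed

section \<open>Eigenfunctions of the graph for eigenvalues near
  \<open>\<omega>\<^sup>2\<close>\<close>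

context cycles_at_vertex
begin

text \<open>One bound \<open>D\<close> in the Volterra estimates for all cycles as soon as
  \<open>\<bar>lam - \<omega>\<^sup>2\<bar> \<le> 1\<close>; the summand \<open>n j\<close> pays for
  the shift of the parameter.\<close>

definition total_size :: "('e \<Rightarrow> real \<Rightarrow> real) \<Rightarrow> real" where
  "total_size q = (\<Sum>j=1..r. integral {0..real (n j)} (\<lambda>x. \<bar>along_cycle q j x\<bar>) + real (n j))"

lemma total_size_ge:
  assumes q: "\<And>e. e \<in> arcs G \<Longrightarrow> q e absolutely_integrable_on {0..1}" and j: "j \<in> {1..r}"
  shows "integral {0..real (n j)} (\<lambda>x. \<bar>along_cycle q j x\<bar>) + real (n j) \<le> total_size q" "0 < total_size q"
    "0 \<le> integral {0..real (n j)} (\<lambda>x. \<bar>along_cycle q j x\<bar>)"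
proof -
  have nn: "0 \<le> integral {0..real (n i)} (\<lambda>x. \<bar>along_cycle q i x\<bar>)" if "i \<in> {1..r}" for i
    using along_cycle_absolutely_integrable[OF q that] by (intro integral_nonneg) (auto simp: absolutely_integrable_on_def)
  show "0 \<le> integral {0..real (n j)} (\<lambda>x. \<bar>along_cycle q j x\<bar>)" by (rule nn[OF j])
  show ge: "integral {0..real (n j)} (\<lambda>x. \<bar>along_cycle q j x\<bar>) + real (n j) \<le> total_size q"
    unfolding total_size_def
    by (rule member_le_sum[of j "{1..r}" "\<lambda>j. integral {0..real (n j)} (\<lambda>x. \<bar>along_cycle q j x\<bar>) + real (n j)"])
      (use j nn in auto)
  have "0 < real (n j)" using length_pos[OF j] by simp
  then show "0 < total_size q" using ge nn[OF j] by linarith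
qed

text \<open>All errors are measured by \<open>\<eta> = K * M / \<omega>\<close> with
  \<open>M\<close> the maximum of the eigenfunction. The normalization bounds the sine amplitudes
  \<open>\<alpha> j\<close> by \<open>2 + 4 * \<eta>\<close>, and this in turn bounds
  \<open>M\<close> itself.\<close>

lemma eigenfunction_estimates:
  assumes r: "1 \<le> r" and q: "\<And>e. e \<in> arcs G \<Longrightarrow> q e absolutely_integrable_on {0..1}"
    and om: "\<omega> = (2 * real k + 1) * pi" and large: "12 * total_size q \<le> \<omega>" and close: "\<bar>lam - \<omega>\<^sup>2\<bar> \<le> 1"
    and y: "y \<in> solution_space G q lam" and normed: "inner_cycles y y = 1"
  defines "\<alpha> \<equiv> \<lambda>j. deriv_along_cycle y j 0 / \<omega>"
  shows "\<And>j x. j \<in> {1..r} \<Longrightarrow> x \<in> {0..real (n j)} \<Longrightarrow> \<bar>along_cycle y j x\<bar> \<le> 4"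
    and "\<And>j x. j \<in> {1..r} \<Longrightarrow> x \<in> {0..real (n j)} \<Longrightarrow> \<bar>along_cycle y j x - \<alpha> j * sin (\<omega> * x)\<bar> \<le> 8 * total_size q / \<omega>"
    and "\<And>j. j \<in> {1..r} \<Longrightarrow> \<bar>\<alpha> j\<bar> \<le> 4"
    and "\<bar>\<Sum>j=1..r. \<alpha> j\<bar> \<le> 4 * real r * total_size q / \<omega>"
    and "\<exists>s. \<forall>j\<in>{1..r}. ((\<lambda>t. (along_cycle q j t + (\<omega>\<^sup>2 - lam)) * along_cycle y j t * sin (\<omega> * t)) has_integral s) {0..real (n j)}"
proof -
  define K where "K = total_size q"
  define U where "U = along_cycle y"
  define W where "W = deriv_along_cycle y"
  have om0: "0 < \<omega>" by (simp add: om add_nonneg_pos)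
  have K0: "0 < K" unfolding K_def using total_size_ge(2)[where j = 1 and q = q, OF q] r by simp
  have sl: "sl_solution 0 (real (n j)) (\<lambda>x. along_cycle q j x - lam) (U j) (W j)" if "j \<in> {1..r}" for j
    unfolding U_def W_def using solution_along_cycles(1)[OF r q y that] by simp
  obtain c where c: "U j 0 = c" "U j (real (n j)) = c" if "j \<in> {1..r}" for j
  proof -
    have "\<exists>c0. \<forall>j\<in>{1..r}. U j 0 = c0 \<and> U j (real (n j)) = c0"
      unfolding U_def using solution_along_cycles(2)[OF r q y] by simp
    then show ?thesis using that by blast
  qed
  have kir: "(\<Sum>j=1..r. W j (real (n j)) - W j 0) = 0"
    unfolding W_def using solution_along_cycles(3)[OF r q y] by simp
  have Q: "along_cycle q j absolutely_integrable_on {0..real (n j)}" if "j \<in> {1..r}" for j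
    by (rule along_cycle_absolutely_integrable[OF q that])
  have Uc: "continuous_on {0..real (n j)} (U j)" if "j \<in> {1..r}" for j
    using sl[OF that] primitive_continuous_on by (auto simp: sl_solution_def)
  have D: "integral {0..real (n j)} (\<lambda>t. \<bar>along_cycle q j t\<bar>) + \<bar>\<omega>\<^sup>2 - lam\<bar> * real (n j) \<le> K" if "j \<in> {1..r}" for j
  proof -
    have "\<bar>\<omega>\<^sup>2 - lam\<bar> * real (n j) \<le> 1 * real (n j)" using close by (intro mult_right_mono) auto
    then show ?thesis using total_size_ge(1)[where q = q, OF q that] by (simp add: K_def)
  qed
  obtain j0 x0 M where j0: "j0 \<in> {1..r}" "x0 \<in> {0..real (n j0)}" "\<bar>U j0 x0\<bar> = M"
    and M: "\<And>j x. j \<in> {1..r} \<Longrightarrow> x \<in> {0..real (n j)} \<Longrightarrow> \<bar>U j x\<bar> \<le> M"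
  proof -
    have "\<exists>x\<in>{0..real (n j)}. \<forall>t\<in>{0..real (n j)}. \<bar>U j t\<bar> \<le> \<bar>U j x\<bar>" if "j \<in> {1..r}" for j
      using Uc[OF that] by (intro continuous_attains_sup continuous_intros) auto
    then obtain m where m: "\<And>j. j \<in> {1..r} \<Longrightarrow> m j \<in> {0..real (n j)} \<and> (\<forall>t\<in>{0..real (n j)}. \<bar>U j t\<bar> \<le> \<bar>U j (m j)\<bar>)"
      by metis
    let ?S = "(\<lambda>j. \<bar>U j (m j)\<bar>) ` {1..r}"
    have S: "finite ?S" "?S \<noteq> {}" using r by auto
    from Max_in[OF S] obtain i where i: "i \<in> {1..r}" "\<bar>U i (m i)\<bar> = Max ?S" by force
    show ?thesis
    proof (rule that[OF i(1) _ i(2)])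
      show "m i \<in> {0..real (n i)}" using m[OF i(1)] by blast
      fix j x assume j: "j \<in> {1..r}" and x: "x \<in> {0..real (n j)}"
      have "\<bar>U j x\<bar> \<le> \<bar>U j (m j)\<bar>" using m[OF j] x by blast
      also have "\<dots> \<le> Max ?S" using S j by (intro Max_ge) auto
      finally show "\<bar>U j x\<bar> \<le> Max ?S" .
    qed
  qed
  have M0: "0 \<le> M" using j0(3) by simp
  define \<eta> where "\<eta> = K * M / \<omega>"
  have \<eta>0: "0 \<le> \<eta>" using K0 M0 om0 by (simp add: \<eta>_def)
  \<comment> \<open>With \<open>M \<le> 2 + 6 * \<eta>\<close> below, the factor 12 gives
    \<open>M \<le> 2 + M / 2\<close>, hence \<open>M \<le> 4\<close>.\<close>
  have small: "12 * \<eta> \<le> M"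
  proof -
    have "12 * K * M \<le> \<omega> * M" using large M0 by (intro mult_right_mono) (auto simp: K_def)
    then show ?thesis using om0 by (simp add: \<eta>_def field_simps)
  qed
  have v1: "\<bar>U j x - (c * cos (\<omega> * x) + \<alpha> j * sin (\<omega> * x))\<bar> \<le> \<eta>" if "j \<in> {1..r}" "x \<in> {0..real (n j)}" for j x
    using volterra_estimate(1)[OF sl[OF that(1)] Q[OF that(1)] om0 M[OF that(1)] D[OF that(1)] that(2)] c(1)[OF that(1)]
    by (simp add: \<alpha>_def W_def \<eta>_def)
  have v2: "\<bar>W j x - (W j 0 * cos (\<omega> * x) - c * \<omega> * sin (\<omega> * x))\<bar> \<le> K * M" if "j \<in> {1..r}" "x \<in> {0..real (n j)}" for j x
    using volterra_estimate(2)[OF sl[OF that(1)] Q[OF that(1)] om0 M[OF that(1)] D[OF that(1)] that(2)] c(1)[OF that(1)]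
    by simp
  note trig = trig_at_odd_multiple[OF odd_length om]
  \<comment> \<open>At \<open>x = n j0\<close> the cosine is \<open>- 1\<close> and the sine is 0,
    while \<open>U\<close> takes the value \<open>c\<close> again; so the Volterra estimate reads
    \<open>\<bar>c + c\<bar> \<le> \<eta>\<close>.\<close>
  have c_small: "2 * \<bar>c\<bar> \<le> \<eta>"
    using v1[OF j0(1), of "real (n j0)"] c(2)[OF j0(1)] trig[OF j0(1)] by (simp add: abs_mult[symmetric])
  have near: "\<bar>U j x - \<alpha> j * sin (\<omega> * x)\<bar> \<le> 2 * \<eta>" if "j \<in> {1..r}" "x \<in> {0..real (n j)}" for j x
  proof -
    have "\<bar>c * cos (\<omega> * x)\<bar> \<le> \<bar>c\<bar> * 1" unfolding abs_mult by (intro mult_left_mono) auto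
    then show ?thesis using v1[OF that] c_small \<eta>0 by linarith
  qed
  have W_end: "\<bar>W j (real (n j)) + W j 0\<bar> \<le> K * M" if "j \<in> {1..r}" for j
    using v2[OF that, of "real (n j)"] trig[OF that] by simp
  \<comment> \<open>Up to \<open>K * M\<close> the derivative changes sign along each cycle, so its
    jump is about \<open>- 2 * W j 0\<close>; the Kirchhoff condition makes the jumps sum to
    0.\<close>
  have sum_a: "\<bar>\<Sum>j=1..r. \<alpha> j\<bar> \<le> real r * \<eta>"
  proof -
    have "2 * (\<Sum>j=1..r. W j 0) = (\<Sum>j=1..r. W j (real (n j)) + W j 0) - (\<Sum>j=1..r. W j (real (n j)) - W j 0)"
      by (simp add: sum.distrib sum_subtractf)
    then have "2 * (\<Sum>j=1..r. W j 0) = (\<Sum>j=1..r. W j (real (n j)) + W j 0)" using kir by simp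
    moreover have "\<bar>\<Sum>j=1..r. W j (real (n j)) + W j 0\<bar> \<le> (\<Sum>j=1..r. K * M)"
      by (rule order_trans[OF sum_abs sum_mono[OF W_end]])
    ultimately have "\<bar>2 * (\<Sum>j=1..r. W j 0)\<bar> \<le> (\<Sum>j=1..r. K * M)" by simp
    then have "2 * \<bar>\<Sum>j=1..r. W j 0\<bar> \<le> real r * (K * M)" by (simp add: abs_mult)
    moreover have "0 \<le> real r * (K * M)" using K0 M0 by simp
    ultimately have "\<bar>\<Sum>j=1..r. W j 0\<bar> \<le> real r * (K * M)" by linarith
    then have "\<bar>\<Sum>j=1..r. W j 0\<bar> / \<omega> \<le> real r * (K * M) / \<omega>" using om0 by (intro divide_right_mono) auto
    moreover have "(\<Sum>j=1..r. \<alpha> j) = (\<Sum>j=1..r. W j 0) / \<omega>" by (simp add: \<alpha>_def W_def sum_divide_distrib)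
    ultimately show ?thesis using om0 by (simp add: \<eta>_def)
  qed
  have a_bound: "\<bar>\<alpha> j\<bar> \<le> 2 + 4 * \<eta>" if j: "j \<in> {1..r}" for j
  proof -
    have n1: "1 \<le> real (n j)" using length_pos[OF j] by simp
    have U2c: "continuous_on {0..real (n i)} (\<lambda>x. U i x * U i x)" if "i \<in> {1..r}" for i
      using Uc[OF that] by (intro continuous_intros)
    have "integral {0..real (n j)} (\<lambda>x. U j x * U j x) \<le> inner_cycles y y"
      unfolding inner_cycles_def U_def[symmetric]
      by (rule member_le_sum[of j "{1..r}" "\<lambda>j. integral {0..real (n j)} (\<lambda>x. U j x * U j x)"])
        (use j U2c in \<open>auto intro!: integral_nonneg integrable_continuous_real\<close>)
    then have U2: "integral {0..real (n j)} (\<lambda>x. U j x * U j x) \<le> 1" using normed by simp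
    \<comment> \<open>From \<open>(U + d)\<^sup>2 \<le> 2 U\<^sup>2 + 2 d\<^sup>2\<close> with
      \<open>\<bar>d\<bar> \<le> 2 * \<eta>\<close>. Cancelling \<open>n j / 2\<close> afterwards
      relies on \<open>\<integral>U\<^sup>2 \<le> 1 \<le> n j\<close>.\<close>
    have "(\<alpha> j)\<^sup>2 * (real (n j) / 2) \<le> 2 * integral {0..real (n j)} (\<lambda>x. U j x * U j x) + 8 * \<eta>\<^sup>2 * real (n j)"
    proof (rule has_integral_le)
      show "((\<lambda>x. (\<alpha> j)\<^sup>2 * (sin (\<omega> * x))\<^sup>2) has_integral (\<alpha> j)\<^sup>2 * (real (n j) / 2)) {0..real (n j)}"
        by (intro has_integral_mult_right sin_squared_has_integral[OF om])
      show "((\<lambda>x. 2 * (U j x * U j x) + 8 * \<eta>\<^sup>2) has_integral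
          2 * integral {0..real (n j)} (\<lambda>x. U j x * U j x) + 8 * \<eta>\<^sup>2 * real (n j)) {0..real (n j)}"
        using has_integral_const_real[of "8 * \<eta>\<^sup>2" 0 "real (n j)"]
        by (intro has_integral_add has_integral_mult_right integrable_integral integrable_continuous_real U2c j)
          (auto simp: mult.commute)
      fix x assume x: "x \<in> {0..real (n j)}"
      define d where "d = \<alpha> j * sin (\<omega> * x) - U j x"
      have "\<bar>d\<bar> \<le> 2 * \<eta>" using near[OF j x] by (simp add: d_def abs_minus_commute)
      then have "d\<^sup>2 \<le> (2 * \<eta>)\<^sup>2" using abs_le_square_iff[of d "2 * \<eta>"] \<eta>0 by simp
      moreover have "(U j x + d)\<^sup>2 \<le> 2 * (U j x)\<^sup>2 + 2 * d\<^sup>2"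
        using zero_le_power2[of "U j x - d"] by (simp add: power2_diff power2_sum)
      moreover have "(\<alpha> j)\<^sup>2 * (sin (\<omega> * x))\<^sup>2 = (U j x + d)\<^sup>2" by (simp add: d_def power_mult_distrib)
      ultimately show "(\<alpha> j)\<^sup>2 * (sin (\<omega> * x))\<^sup>2 \<le> 2 * (U j x * U j x) + 8 * \<eta>\<^sup>2"
        by (simp add: power_mult_distrib power2_eq_square)
    qed
    also have "\<dots> \<le> 2 * real (n j) + 8 * \<eta>\<^sup>2 * real (n j)" using U2 n1 by linarith
    also have "\<dots> = (4 + 16 * \<eta>\<^sup>2) * (real (n j) / 2)" by (simp add: algebra_simps)
    finally have "(\<alpha> j)\<^sup>2 \<le> 4 + 16 * \<eta>\<^sup>2" using n1 by (simp add: mult_le_cancel_right)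
    also have "\<dots> \<le> (2 + 4 * \<eta>)\<^sup>2" using \<eta>0 by (simp add: power2_sum power_mult_distrib)
    finally show ?thesis using abs_le_square_iff[of "\<alpha> j" "2 + 4 * \<eta>"] \<eta>0 by simp
  qed
  have M4: "M \<le> 4"
  proof -
    have "\<bar>\<alpha> j0 * sin (\<omega> * x0)\<bar> \<le> \<bar>\<alpha> j0\<bar> * 1" unfolding abs_mult by (intro mult_left_mono) auto
    then have "M \<le> 2 + 6 * \<eta>" using near[OF j0(1,2)] a_bound[OF j0(1)] j0(3) by linarith
    then show ?thesis using small by linarith
  qed
  have \<eta>4: "\<eta> \<le> 4 * K / \<omega>" unfolding \<eta>_def using M4 K0 om0 by (intro divide_right_mono) auto
  show "\<bar>along_cycle y j x\<bar> \<le> 4" if "j \<in> {1..r}" "x \<in> {0..real (n j)}" for j x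
    using M[OF that] M4 by (simp add: U_def)
  show "\<bar>along_cycle y j x - \<alpha> j * sin (\<omega> * x)\<bar> \<le> 8 * total_size q / \<omega>" if "j \<in> {1..r}" "x \<in> {0..real (n j)}" for j x
    using near[OF that] \<eta>4 by (simp add: U_def K_def)
  show "\<bar>\<alpha> j\<bar> \<le> 4" if "j \<in> {1..r}" for j using a_bound[OF that] small M4 by linarith
  have "real r * \<eta> \<le> real r * (4 * K / \<omega>)" using \<eta>4 by (intro mult_left_mono) auto
  then show "\<bar>\<Sum>j=1..r. \<alpha> j\<bar> \<le> 4 * real r * total_size q / \<omega>" using sum_a by (simp add: K_def mult_ac)
  show "\<exists>s. \<forall>j\<in>{1..r}. ((\<lambda>t. (along_cycle q j t + (\<omega>\<^sup>2 - lam)) * along_cycle y j t * sin (\<omega> * t)) has_integral s) {0..real (n j)}"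
  \<comment> \<open>The boundary term of the sine test; it depends on the common end value
    \<open>c\<close> but not on \<open>j\<close>.\<close>
  proof (intro exI[of _ "2 * (\<omega> * c)"] ballI)
    fix j assume j: "j \<in> {1..r}"
    show "((\<lambda>t. (along_cycle q j t + (\<omega>\<^sup>2 - lam)) * along_cycle y j t * sin (\<omega> * t)) has_integral 2 * (\<omega> * c)) {0..real (n j)}"
      using sine_test_integral[OF sl[OF j], of \<omega>] trig[OF j] c[OF j] by (simp add: U_def)
  qed
qed

text \<open>The error is split as
  \<open>y (z - \<beta> sin) + \<beta> sin (y - \<alpha> sin)\<close>, each part at most
  \<open>4 * \<epsilon>\<close>. The integral \<open>n j / 2\<close> of the squared sine is the
  weight in the limiting orthogonality relation.\<close>

lemma inner_cycles_asymptotics: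
  assumes C: "0 \<le> \<epsilon>" and om: "\<omega> = (2 * real k + 1) * pi"
    and c: "continuous_family y" "continuous_family z"
    and y: "\<And>j x. j \<in> {1..r} \<Longrightarrow> x \<in> {0..real (n j)} \<Longrightarrow> \<bar>along_cycle y j x - \<alpha> j * sin (\<omega> * x)\<bar> \<le> \<epsilon>"
    and z: "\<And>j x. j \<in> {1..r} \<Longrightarrow> x \<in> {0..real (n j)} \<Longrightarrow> \<bar>along_cycle z j x - \<beta> j * sin (\<omega> * x)\<bar> \<le> \<epsilon>"
    and bounds: "\<And>j x. j \<in> {1..r} \<Longrightarrow> x \<in> {0..real (n j)} \<Longrightarrow> \<bar>along_cycle y j x\<bar> \<le> 4" "\<And>j. j \<in> {1..r} \<Longrightarrow> \<bar>\<beta> j\<bar> \<le> 4"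
  shows "\<bar>inner_cycles y z - (\<Sum>j=1..r. real (n j) / 2 * (\<alpha> j * \<beta> j))\<bar> \<le> (\<Sum>j=1..r. 8 * \<epsilon> * real (n j))"
proof -
  have "inner_cycles y z - (\<Sum>j=1..r. real (n j) / 2 * (\<alpha> j * \<beta> j)) =
     (\<Sum>j=1..r. integral {0..real (n j)} (\<lambda>x. along_cycle y j x * along_cycle z j x) - real (n j) / 2 * (\<alpha> j * \<beta> j))"
    by (simp add: inner_cycles_def sum_subtractf)
  also have "\<bar>\<dots>\<bar> \<le> (\<Sum>j=1..r. 8 * \<epsilon> * real (n j))"
  proof (rule order_trans[OF sum_abs sum_mono])
    fix j assume j: "j \<in> {1..r}"
    have cj: "continuous_on {0..real (n j)} (\<lambda>x. along_cycle y j x * along_cycle z j x)"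
      using c j unfolding continuous_family_def by (intro continuous_intros) auto
    have H: "((\<lambda>x. along_cycle y j x * along_cycle z j x - \<alpha> j * \<beta> j * (sin (\<omega> * x))\<^sup>2) has_integral
        (integral {0..real (n j)} (\<lambda>x. along_cycle y j x * along_cycle z j x) - \<alpha> j * \<beta> j * (real (n j) / 2))) {0..real (n j)}"
      by (intro has_integral_diff has_integral_mult_right sin_squared_has_integral[OF om] integrable_integral integrable_continuous_real cj)
    have "norm (integral {0..real (n j)} (\<lambda>x. along_cycle y j x * along_cycle z j x) - \<alpha> j * \<beta> j * (real (n j) / 2))
        \<le> 8 * \<epsilon> * content {0..real (n j)}"
    proof (rule has_integral_bound_real[OF _ finite.emptyI H])
      fix x assume "x \<in> {0..real (n j)} - {}"
      then have x: "x \<in> {0..real (n j)}" by simp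
      have t1: "\<bar>along_cycle y j x\<bar> * \<bar>along_cycle z j x - \<beta> j * sin (\<omega> * x)\<bar> \<le> 4 * \<epsilon>"
        by (rule mult_mono[OF bounds(1)[OF j x] z[OF j x]]) auto
      have "\<bar>\<beta> j\<bar> * \<bar>sin (\<omega> * x)\<bar> \<le> 4 * 1"
        by (rule mult_mono[OF bounds(2)[OF j]]) auto
      then have t2: "(\<bar>\<beta> j\<bar> * \<bar>sin (\<omega> * x)\<bar>) * \<bar>along_cycle y j x - \<alpha> j * sin (\<omega> * x)\<bar> \<le> (4 * 1) * \<epsilon>"
        by (rule mult_mono[OF _ y[OF j x]]) auto
      let ?A = "along_cycle y j x * (along_cycle z j x - \<beta> j * sin (\<omega> * x))"
      let ?B = "\<beta> j * sin (\<omega> * x) * (along_cycle y j x - \<alpha> j * sin (\<omega> * x))"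
      have eq: "along_cycle y j x * along_cycle z j x - \<alpha> j * \<beta> j * (sin (\<omega> * x))\<^sup>2 = ?A + ?B"
        by (simp add: algebra_simps power2_eq_square)
      have "\<bar>?A\<bar> \<le> 4 * \<epsilon>" "\<bar>?B\<bar> \<le> (4 * 1) * \<epsilon>"
        using t1 t2 by (simp_all only: abs_mult)
      then have "\<bar>?A + ?B\<bar> \<le> 8 * \<epsilon>" using abs_triangle_ineq[of ?A ?B] by linarith
      then show "norm (along_cycle y j x * along_cycle z j x - \<alpha> j * \<beta> j * (sin (\<omega> * x))\<^sup>2) \<le> 8 * \<epsilon>"
        unfolding eq real_norm_def .
    qed (use C in auto)
    then show "\<bar>integral {0..real (n j)} (\<lambda>x. along_cycle y j x * along_cycle z j x) - real (n j) / 2 * (\<alpha> j * \<beta> j)\<bar> \<le> 8 * \<epsilon> * real (n j)"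
      by (simp add: mult_ac)
  qed
  finally show ?thesis .
qed

text \<open>Two errors: \<open>Q\<close> against the deviation of \<open>U\<close> from its sine,
  and \<open>\<theta>\<close> against \<open>U\<close> itself. The second carries no factor
  \<open>1 / \<omega>\<close>; with \<open>\<theta> = \<omega>\<^sup>2 - lam\<close> it is the place
  where the offsets of the eigenvalues must tend to 0 and not merely stay bounded.\<close>

lemma sine_test_asymptotics:
  fixes Q U :: "real \<Rightarrow> real"
  assumes Q: "Q absolutely_integrable_on {0..L}" and U: "continuous_on {0..L} U" and L: "0 \<le> L"
    and e: "0 \<le> \<epsilon>" "\<And>x. x \<in> {0..L} \<Longrightarrow> \<bar>U x - \<alpha> * sin (\<omega> * x)\<bar> \<le> \<epsilon>" "\<And>x. x \<in> {0..L} \<Longrightarrow> \<bar>U x\<bar> \<le> 4"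
    and s: "((\<lambda>t. (Q t + \<theta>) * U t * sin (\<omega> * t)) has_integral s) {0..L}"
  shows "\<bar>s - \<alpha> * integral {0..L} (\<lambda>x. Q x * (sin (\<omega> * x))\<^sup>2)\<bar> \<le> integral {0..L} (\<lambda>x. \<bar>Q x\<bar>) * \<epsilon> + 4 * \<bar>\<theta>\<bar> * L"
proof -
  have aQ: "(\<lambda>x. \<bar>Q x\<bar>) integrable_on {0..L}" using Q by (simp add: absolutely_integrable_on_def)
  have "(\<lambda>x. Q x * (sin (\<omega> * x))\<^sup>2) absolutely_integrable_on {0..L}"
    by (intro absolutely_integrable_mult_continuous(2)[OF _ Q] continuous_intros)
  then have "((\<lambda>x. Q x * (sin (\<omega> * x))\<^sup>2) has_integral integral {0..L} (\<lambda>x. Q x * (sin (\<omega> * x))\<^sup>2)) {0..L}"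
    by (intro integrable_integral absolutely_integrable_on_imp_integrable_on)
  then have d: "((\<lambda>t. (Q t + \<theta>) * U t * sin (\<omega> * t) - \<alpha> * (Q t * (sin (\<omega> * t))\<^sup>2)) has_integral
      (s - \<alpha> * integral {0..L} (\<lambda>x. Q x * (sin (\<omega> * x))\<^sup>2))) {0..L}"
    by (intro has_integral_diff has_integral_mult_right s)
  have h: "((\<lambda>x. \<bar>Q x\<bar> * \<epsilon> + 4 * \<bar>\<theta>\<bar>) has_integral (integral {0..L} (\<lambda>x. \<bar>Q x\<bar>) * \<epsilon> + 4 * \<bar>\<theta>\<bar> * L)) {0..L}"
    using has_integral_const_real[of "4 * \<bar>\<theta>\<bar>" 0 L] L
    by (intro has_integral_add has_integral_mult_left integrable_integral aQ) (auto simp: mult.commute)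
  have "norm (integral {0..L} (\<lambda>t. (Q t + \<theta>) * U t * sin (\<omega> * t) - \<alpha> * (Q t * (sin (\<omega> * t))\<^sup>2)))
      \<le> integral {0..L} (\<lambda>x. \<bar>Q x\<bar> * \<epsilon> + 4 * \<bar>\<theta>\<bar>)"
  proof (rule integral_norm_bound_integral[OF has_integral_integrable[OF d] has_integral_integrable[OF h]])
    fix t assume t: "t \<in> {0..L}"
    have "(Q t + \<theta>) * U t * sin (\<omega> * t) - \<alpha> * (Q t * (sin (\<omega> * t))\<^sup>2) =
        Q t * ((U t - \<alpha> * sin (\<omega> * t)) * sin (\<omega> * t)) + \<theta> * (U t * sin (\<omega> * t))"
      by (simp add: algebra_simps power2_eq_square)
    also have "\<bar>\<dots>\<bar> \<le> \<bar>Q t\<bar> * (\<bar>U t - \<alpha> * sin (\<omega> * t)\<bar> * \<bar>sin (\<omega> * t)\<bar>) + \<bar>\<theta>\<bar> * (\<bar>U t\<bar> * \<bar>sin (\<omega> * t)\<bar>)"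
      unfolding abs_mult[symmetric] by (rule abs_triangle_ineq)
    also have "\<dots> \<le> \<bar>Q t\<bar> * (\<epsilon> * 1) + \<bar>\<theta>\<bar> * (4 * 1)"
      using e(1) e(2)[OF t] e(3)[OF t] by (intro add_mono mult_left_mono mult_mono) auto
    finally show "norm ((Q t + \<theta>) * U t * sin (\<omega> * t) - \<alpha> * (Q t * (sin (\<omega> * t))\<^sup>2)) \<le> \<bar>Q t\<bar> * \<epsilon> + 4 * \<bar>\<theta>\<bar>" by simp
  qed
  then show ?thesis unfolding integral_unique[OF d] integral_unique[OF h] by simp
qed

end

lemma inverse_odd_multiple_pi_tendsto_zero: "(\<lambda>k. 1 / ((2 * real k + 1) * pi)) \<longlonglongrightarrow> 0"
proof (rule Lim_null_comparison[OF always_eventually LIMSEQ_inverse_real_of_nat], rule allI)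
  fix k
  define X where "X = (2 * real k + 1) * pi"
  have "real (Suc k) * 1 \<le> X" unfolding X_def using pi_ge_two by (intro mult_mono) auto
  then have "real (Suc k) \<le> X" "0 < X" by auto
  then have "norm (1 / X) \<le> inverse (real (Suc k))"
    using le_imp_inverse_le[of "real (Suc k)" X] by (simp add: divide_inverse)
  then show "norm (1 / ((2 * real k + 1) * pi)) \<le> inverse (real (Suc k))" by (simp only: X_def)
qed

section \<open>Passage to the limit along \<open>K\<close>\<close>

context cycles_at_vertex
begin

text \<open>The matrix of amplitudes has finitely many bounded entries, so it converges along a
  subsequence. The rows of the limit \<open>A\<close> are orthonormal for the weights
  \<open>n j / 2\<close>, have coordinate sum 0, and make \<open>A i j * T j\<close> independent of
  \<open>j\<close>, as \<open>form_vanishing_on_hyperplane_trace_zero\<close> requires.\<close>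

theorem asymptotics_imp_zero_mean:
  assumes r: "2 \<le> r" and q: "\<And>e. e \<in> arcs G \<Longrightarrow> q e absolutely_integrable_on {0..1}"
    and K: "infinite K" and ev: "\<And>k. k \<in> K \<Longrightarrow> eigenvalues_with_multiplicity G q (r - 1) (ev k)"
    and lim: "((\<lambda>k. MAX i\<in>{1..r - 1}. \<bar>ev k i - (2 * real k + 1)\<^sup>2 * pi\<^sup>2\<bar>) \<longlongrightarrow> 0)
           (inf sequentially (principal K))"
  shows "(\<Sum>j=1..r. integral {0..real (n j)} (along_cycle q j)) = 0"
proof -
  have r1: "1 \<le> r" using r by simp
  define \<omega> where "\<omega> k = (2 * real k + 1) * pi" for k
  define d where "d k = (MAX i\<in>{1..r - 1}. \<bar>ev k i - (\<omega> k)\<^sup>2\<bar>)" for k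
  define C where "C = total_size q"
  have om0: "0 < \<omega> k" for k by (simp add: \<omega>_def add_nonneg_pos)
  have C0: "0 < C" unfolding C_def using total_size_ge(2)[where j = 1 and q = q, OF q] r1 by simp
  have e_mono: "strict_mono (enumerate K)" using strict_mono_enumerate[OF K] .
  \<comment> \<open>The enumeration tends to infinity inside \<open>K\<close>, so the hypothesis
    becomes a limit of an ordinary sequence.\<close>
  have "filterlim (enumerate K) (inf sequentially (principal K)) sequentially"
    using filterlim_subseq[OF e_mono] enumerate_in_set[OF K] by (simp add: filterlim_inf filterlim_principal)
  from filterlim_compose[OF lim this] have dlim: "(\<lambda>N. d (enumerate K N)) \<longlonglongrightarrow> 0"
    by (simp add: d_def \<omega>_def power_mult_distrib)
  have olim: "(\<lambda>N. 1 / \<omega> (enumerate K N)) \<longlonglongrightarrow> 0"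
    using LIMSEQ_subseq_LIMSEQ[OF inverse_odd_multiple_pi_tendsto_zero e_mono] by (simp add: o_def \<omega>_def)
  have "\<forall>\<^sub>F N in sequentially. d (enumerate K N) < 1" using order_tendstoD(2)[OF dlim] by simp
  moreover have "\<forall>\<^sub>F N in sequentially. 1 / \<omega> (enumerate K N) < 1 / (12 * C)"
    using order_tendstoD(2)[OF olim] C0 by simp
  ultimately have "\<forall>\<^sub>F N in sequentially. d (enumerate K N) < 1 \<and> 1 / \<omega> (enumerate K N) < 1 / (12 * C)"
    by (rule eventually_conj)
  then obtain N0 where N0: "\<And>N. N0 \<le> N \<Longrightarrow> d (enumerate K N) < 1 \<and> 1 / \<omega> (enumerate K N) < 1 / (12 * C)"
    unfolding eventually_sequentially by blast
  \<comment> \<open>Dropping the first \<open>N0\<close> members makes the eigenfunction estimates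
    valid for every \<open>N\<close>.\<close>
  define k where "k N = enumerate K (N + N0)" for N
  have kK: "k N \<in> K" for N unfolding k_def by (rule enumerate_in_set[OF K])
  have large: "12 * C \<le> \<omega> (k N)" for N
    using N0[of "N + N0"] C0 om0[of "k N"] by (simp add: k_def field_simps)
  have dk: "\<bar>ev (k N) i - (\<omega> (k N))\<^sup>2\<bar> \<le> d (k N)" if "i \<in> {1..r - 1}" for N i
    unfolding d_def using that by (intro Max_ge) auto
  have close: "\<bar>ev (k N) i - (\<omega> (k N))\<^sup>2\<bar> \<le> 1" if "i \<in> {1..r - 1}" for N i
    using dk[OF that, of N] N0[of "N + N0"] by (simp add: k_def)
  have "\<exists>\<phi>. (\<forall>i\<in>{1..r - 1}. \<phi> i \<in> solution_space G q (ev (k N) i)) \<and>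
      (\<forall>i\<in>{1..r - 1}. \<forall>i'\<in>{1..r - 1}. inner_cycles (\<phi> i) (\<phi> i') = (if i = i' then 1 else 0))" for N
    by (rule orthonormal_eigenfunctions[OF r1 q ev[OF kK]]) blast+
  then obtain \<phi> where "\<forall>N. (\<forall>i\<in>{1..r - 1}. \<phi> N i \<in> solution_space G q (ev (k N) i)) \<and>
      (\<forall>i\<in>{1..r - 1}. \<forall>i'\<in>{1..r - 1}. inner_cycles (\<phi> N i) (\<phi> N i') = (if i = i' then 1 else 0))"
    using choice[of "\<lambda>N \<phi>. (\<forall>i\<in>{1..r - 1}. \<phi> i \<in> solution_space G q (ev (k N) i)) \<and>
      (\<forall>i\<in>{1..r - 1}. \<forall>i'\<in>{1..r - 1}. inner_cycles (\<phi> i) (\<phi> i') = (if i = i' then 1 else 0))"] by blast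
  then have sol: "\<phi> N i \<in> solution_space G q (ev (k N) i)"
    and ortho: "i' \<in> {1..r - 1} \<Longrightarrow> inner_cycles (\<phi> N i) (\<phi> N i') = (if i = i' then 1 else 0)"
    if "i \<in> {1..r - 1}" for N i i' using that by blast+
  define \<alpha> where "\<alpha> N i j = deriv_along_cycle (\<phi> N i) j 0 / \<omega> (k N)" for N i j
  have normed: "inner_cycles (\<phi> N i) (\<phi> N i) = 1" if "i \<in> {1..r - 1}" for N i using ortho[OF that that] by simp
  note est = eigenfunction_estimates[where q = q, OF r1 q \<omega>_def large[unfolded C_def] close sol normed]
  have e1: "\<bar>along_cycle (\<phi> N i) j x\<bar> \<le> 4"
    and e2: "\<bar>along_cycle (\<phi> N i) j x - \<alpha> N i j * sin (\<omega> (k N) * x)\<bar> \<le> 8 * C / \<omega> (k N)"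
    if "i \<in> {1..r - 1}" "j \<in> {1..r}" "x \<in> {0..real (n j)}" for N i j x
    unfolding \<alpha>_def C_def by (rule est(1,2); use that in simp)+
  have e3: "\<bar>\<alpha> N i j\<bar> \<le> 4" if "i \<in> {1..r - 1}" "j \<in> {1..r}" for N i j
    unfolding \<alpha>_def by (rule est(3); use that in simp)
  have e4: "\<bar>\<Sum>j=1..r. \<alpha> N i j\<bar> \<le> 4 * real r * C / \<omega> (k N)" if "i \<in> {1..r - 1}" for N i
    unfolding \<alpha>_def C_def by (rule est(4); use that in simp)
  have e5: "\<exists>s. \<forall>j\<in>{1..r}. ((\<lambda>t. (along_cycle q j t + ((\<omega> (k N))\<^sup>2 - ev (k N) i)) * along_cycle (\<phi> N i) j t * sin (\<omega> (k N) * t))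
      has_integral s) {0..real (n j)}" if "i \<in> {1..r - 1}" for N i
    by (rule est(5); use that in simp)
  have cf: "continuous_family (\<phi> N i)" if "i \<in> {1..r - 1}" for N i
    using solution_continuous_family[OF r1 _ sol[OF that]] q by blast
  have "\<exists>s l. strict_mono (s :: nat \<Rightarrow> nat) \<and> (\<forall>p\<in>{1..r - 1} \<times> {1..r}. (\<lambda>N. (\<lambda>N p. \<alpha> N (fst p) (snd p)) (s N) p) \<longlonglongrightarrow> l p)"
  proof (rule bounded_families_convergent_subsequence)
    fix p assume "p \<in> {1..r - 1} \<times> {1..r}"
    then show "bounded (range (\<lambda>N. \<alpha> N (fst p) (snd p)))"
      unfolding bounded_iff using e3 by (intro exI[of _ 4]) auto
  qed simp
  then obtain s l where s: "strict_mono (s :: nat \<Rightarrow> nat)"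
    and l: "\<forall>p\<in>{1..r - 1} \<times> {1..r}. (\<lambda>N. \<alpha> (s N) (fst p) (snd p)) \<longlonglongrightarrow> l p" by auto
  define A where "A i j = l (i, j)" for i j
  have A: "(\<lambda>N. \<alpha> (s N) i j) \<longlonglongrightarrow> A i j" if "i \<in> {1..r - 1}" "j \<in> {1..r}" for i j
    using bspec[OF l, of "(i, j)"] that by (simp add: A_def)
  have ks: "strict_mono (\<lambda>N. k (s N))"
    using e_mono s by (auto simp: strict_mono_def k_def)
  have olim': "(\<lambda>N. 1 / \<omega> (k (s N))) \<longlonglongrightarrow> 0"
    using LIMSEQ_subseq_LIMSEQ[OF inverse_odd_multiple_pi_tendsto_zero ks] by (simp add: o_def \<omega>_def)
  \<comment> \<open>\<open>dlim\<close> is indexed by \<open>enumerate K\<close>, so the subsequence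
    of \<open>k\<close> corresponds to the indices \<open>s N + N0\<close>.\<close>
  have shift_mono: "strict_mono (\<lambda>N. s N + N0)" using s by (auto simp: strict_mono_def)
  have dlim': "(\<lambda>N. d (k (s N))) \<longlonglongrightarrow> 0"
    using LIMSEQ_subseq_LIMSEQ[OF dlim shift_mono] by (simp add: o_def k_def)
  define T where "T j = integral {0..real (n j)} (along_cycle q j)" for j
  have Q: "along_cycle q j absolutely_integrable_on {0..real (n j)}" if "j \<in> {1..r}" for j
    by (rule along_cycle_absolutely_integrable[OF q that])
  have "(\<Sum>j=1..r. T j) = 0"
  proof (rule form_vanishing_on_hyperplane_trace_zero[OF r])
    fix i i' assume i: "i \<in> {1..r - 1}" and i': "i' \<in> {1..r - 1}"
    let ?S = "\<lambda>N. \<Sum>j=1..r. real (n j) / 2 * (\<alpha> (s N) i j * \<alpha> (s N) i' j)"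
    have "(\<lambda>N. (if i = i' then 1 else 0) - ?S N) \<longlonglongrightarrow> 0"
    proof (rule Lim_null_comparison[OF always_eventually], rule allI)
      fix N
      have nn: "0 \<le> 8 * C / \<omega> (k (s N))" using C0 om0[of "k (s N)"] by simp
      have "\<bar>inner_cycles (\<phi> (s N) i) (\<phi> (s N) i') - ?S N\<bar> \<le> (\<Sum>j=1..r. 8 * (8 * C / \<omega> (k (s N))) * real (n j))"
        by (rule inner_cycles_asymptotics[OF nn \<omega>_def cf[OF i] cf[OF i'] e2[OF i] e2[OF i'] e1[OF i] e3[OF i']])
      then show "norm ((if i = i' then 1 else 0) - ?S N) \<le> (\<Sum>j=1..r. 8 * (8 * C * (1 / \<omega> (k (s N)))) * real (n j))"
        unfolding ortho[OF i i'] real_norm_def mult_1_right times_divide_eq_right .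
    next
      have "(\<lambda>N. \<Sum>j=1..r. 8 * (8 * C * (1 / \<omega> (k (s N)))) * real (n j)) \<longlonglongrightarrow> (\<Sum>j=1..r. 8 * (8 * C * 0) * real (n j))"
        by (intro tendsto_intros olim')
      then show "(\<lambda>N. \<Sum>j=1..r. 8 * (8 * C * (1 / \<omega> (k (s N)))) * real (n j)) \<longlonglongrightarrow> 0" by simp
    qed
    moreover have "(\<lambda>N. (if i = i' then 1 else 0) - ?S N) \<longlonglongrightarrow> (if i = i' then 1 else 0) - (\<Sum>j=1..r. real (n j) / 2 * (A i j * A i' j))"
      by (intro tendsto_intros A i i')
    ultimately show "(\<Sum>j=1..r. real (n j) / 2 * (A i j * A i' j)) = (if i = i' then 1 else 0)"
      using LIMSEQ_unique by fastforce
  next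
    fix i assume i: "i \<in> {1..r - 1}"
    have "(\<lambda>N. \<Sum>j=1..r. \<alpha> (s N) i j) \<longlonglongrightarrow> 0"
    proof (rule Lim_null_comparison[OF always_eventually], rule allI)
      show "norm (\<Sum>j=1..r. \<alpha> (s N) i j) \<le> 4 * real r * C * (1 / \<omega> (k (s N)))" for N
        using e4[OF i, of "s N"] by simp
      have "(\<lambda>N. 4 * real r * C * (1 / \<omega> (k (s N)))) \<longlonglongrightarrow> 4 * real r * C * 0"
        by (intro tendsto_intros olim')
      then show "(\<lambda>N. 4 * real r * C * (1 / \<omega> (k (s N)))) \<longlonglongrightarrow> 0" by simp
    qed
    moreover have "(\<lambda>N. \<Sum>j=1..r. \<alpha> (s N) i j) \<longlonglongrightarrow> (\<Sum>j=1..r. A i j)"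
      by (intro tendsto_sum A i)
    ultimately show "(\<Sum>j=1..r. A i j) = 0" using LIMSEQ_unique by blast
  next
    fix i j j' assume i: "i \<in> {1..r - 1}" and j: "j \<in> {1..r}" and j': "j' \<in> {1..r}"
    define S where "S N j = integral {0..real (n j)} (\<lambda>t. (along_cycle q j t + ((\<omega> (k (s N)))\<^sup>2 - ev (k (s N)) i)) *
        along_cycle (\<phi> (s N) i) j t * sin (\<omega> (k (s N)) * t))" for N j
    have Seq: "S N j = S N j'" for N
    proof -
      obtain \<sigma> where \<sigma>: "\<forall>j\<in>{1..r}. ((\<lambda>t. (along_cycle q j t + ((\<omega> (k (s N)))\<^sup>2 - ev (k (s N)) i)) *
        along_cycle (\<phi> (s N) i) j t * sin (\<omega> (k (s N)) * t)) has_integral \<sigma>) {0..real (n j)}"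
        using e5[OF i, of "s N"] by blast
      show ?thesis unfolding S_def
        using integral_unique[OF bspec[OF \<sigma> j]] integral_unique[OF bspec[OF \<sigma> j']] by simp
    qed
    \<comment> \<open>The factor 1/2 is the mean of the squared sine; its oscillating part vanishes
      in the limit by the Riemann-Lebesgue lemma.\<close>
    have Slim: "(\<lambda>N. S N m) \<longlonglongrightarrow> A i m * (T m / 2)" if m: "m \<in> {1..r}" for m
    proof -
      let ?I = "\<lambda>N. integral {0..real (n m)} (\<lambda>x. along_cycle q m x * (sin (\<omega> (k (s N)) * x))\<^sup>2)"
      let ?P = "integral {0..real (n m)} (\<lambda>x. \<bar>along_cycle q m x\<bar>)"
      have Iq: "?I N = T m / 2 - integral {0..real (n m)} (\<lambda>x. along_cycle q m x * cos (2 * (2 * real (k (s N)) + 1) * pi * x)) / 2" for N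
      proof -
        have ci: "(\<lambda>x. along_cycle q m x * cos (2 * (2 * real (k (s N)) + 1) * pi * x)) integrable_on {0..real (n m)}"
          by (intro absolutely_integrable_on_imp_integrable_on absolutely_integrable_mult_continuous(2)[OF _ Q[OF m]] continuous_intros)
        have "?I N = integral {0..real (n m)} (\<lambda>x. 1 / 2 * along_cycle q m x - 1 / 2 * (along_cycle q m x * cos (2 * (2 * real (k (s N)) + 1) * pi * x)))"
          unfolding sin_squared_half_angle[OF \<omega>_def] by (simp add: algebra_simps)
        also have "\<dots> = 1 / 2 * T m - 1 / 2 * integral {0..real (n m)} (\<lambda>x. along_cycle q m x * cos (2 * (2 * real (k (s N)) + 1) * pi * x))"
          unfolding T_def
          by (intro integral_unique has_integral_diff has_integral_mult_right integrable_integral ci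
              absolutely_integrable_on_imp_integrable_on Q[OF m])
        finally show ?thesis by simp
      qed
      have "(\<lambda>N. integral {0..real (n m)} (\<lambda>x. along_cycle q m x * cos (2 * (2 * real (k (s N)) + 1) * pi * x))) \<longlonglongrightarrow> 0"
        using LIMSEQ_subseq_LIMSEQ[OF riemann_lebesgue_cos[OF length_pos[OF m] Q[OF m]] ks] by (simp add: o_def)
      then have "?I \<longlonglongrightarrow> T m / 2 - 0 / 2" unfolding Iq by (intro tendsto_intros) auto
      then have main: "(\<lambda>N. \<alpha> (s N) i m * ?I N) \<longlonglongrightarrow> A i m * (T m / 2)" by (intro tendsto_mult A i m) simp
      have "(\<lambda>N. S N m - \<alpha> (s N) i m * ?I N) \<longlonglongrightarrow> 0"
      proof (rule Lim_null_comparison[OF always_eventually], rule allI)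
        fix N
        obtain \<sigma> where \<sigma>: "\<forall>j\<in>{1..r}. ((\<lambda>t. (along_cycle q j t + ((\<omega> (k (s N)))\<^sup>2 - ev (k (s N)) i)) *
          along_cycle (\<phi> (s N) i) j t * sin (\<omega> (k (s N)) * t)) has_integral \<sigma>) {0..real (n j)}"
          using e5[OF i, of "s N"] by blast
        have S: "S N m = \<sigma>" unfolding S_def by (rule integral_unique[OF bspec[OF \<sigma> m]])
        have cm: "continuous_on {0..real (n m)} (along_cycle (\<phi> (s N) i) m)"
          using cf[OF i, of "s N"] m by (simp add: continuous_family_def)
        have "0 \<le> 8 * C / \<omega> (k (s N))" using C0 om0[of "k (s N)"] by simp
        from sine_test_asymptotics[OF Q[OF m] cm _ this e2[OF i m] e1[OF i m] bspec[OF \<sigma> m]]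
        have "\<bar>S N m - \<alpha> (s N) i m * ?I N\<bar> \<le> ?P * (8 * C / \<omega> (k (s N))) + 4 * \<bar>(\<omega> (k (s N)))\<^sup>2 - ev (k (s N)) i\<bar> * real (n m)"
          unfolding S by simp
        also have "\<dots> \<le> ?P * (8 * C * (1 / \<omega> (k (s N)))) + 4 * d (k (s N)) * real (n m)"
          using dk[OF i, of "s N"] by (intro add_mono mult_right_mono) (auto simp: abs_minus_commute)
        finally show "norm (S N m - \<alpha> (s N) i m * ?I N) \<le> ?P * (8 * C * (1 / \<omega> (k (s N)))) + 4 * d (k (s N)) * real (n m)"
          by simp
      next
        have "(\<lambda>N. ?P * (8 * C * (1 / \<omega> (k (s N)))) + 4 * d (k (s N)) * real (n m)) \<longlonglongrightarrow> ?P * (8 * C * 0) + 4 * 0 * real (n m)"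
          by (intro tendsto_intros olim' dlim')
        then show "(\<lambda>N. ?P * (8 * C * (1 / \<omega> (k (s N)))) + 4 * d (k (s N)) * real (n m)) \<longlonglongrightarrow> 0" by simp
      qed
      from tendsto_add[OF this main] show ?thesis by simp
    qed
    have "A i j * (T j / 2) = A i j' * (T j' / 2)"
      using LIMSEQ_unique[OF Slim[OF j]] Slim[OF j'] unfolding Seq by blast
    then show "A i j * T j = A i j' * T j'" by simp
  qed
  then show ?thesis by (simp add: T_def)
qed

end

theorem theorem2p1:
  fixes r :: nat
    and G :: "('v, 'e) pre_digraph"
    and q :: "'e \<Rightarrow> real \<Rightarrow> real"
    and K :: "nat set"
    and ev :: "nat \<Rightarrow> nat \<Rightarrow> real"
  assumes "r \<ge> 2"
    and "odd_cycles_glued r G"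
    and "\<And>e. e \<in> arcs G \<Longrightarrow> q e absolutely_integrable_on {0..1}"
    and "eigenvalue G q 0"
    and "\<And>l. eigenvalue G q l \<Longrightarrow> 0 \<le> l"
    and "infinite K" and "K \<subseteq> {1..}"
    and "\<And>k. k \<in> K \<Longrightarrow> eigenvalues_with_multiplicity G q (r - 1) (ev k)"
    and "((\<lambda>k. MAX i\<in>{1..r - 1}. \<bar>ev k i - (2 * real k + 1)\<^sup>2 * pi\<^sup>2\<bar>) \<longlongrightarrow> 0)
           (inf sequentially (principal K))"
  shows "\<forall>e\<in>arcs G. AE x\<in>{0..1} in lebesgue. q e x = 0"
proof
  fix e assume e: "e \<in> arcs G"
  obtain n :: "nat \<Rightarrow> nat" and v :: "nat \<Rightarrow> nat \<Rightarrow> 'v" and a :: "nat \<Rightarrow> nat \<Rightarrow> 'e" and c :: 'v where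
    *: "\<forall>j\<in>{1..r}. odd (n j) \<and> v j 0 = c \<and> v j (n j) = c"
      "\<forall>j\<in>{1..r}. \<forall>i\<in>{1..<n j}. v j i \<noteq> c"
      "inj_on (\<lambda>(j, i). v j i) (SIGMA j:{1..r}. {1..<n j})"
      "verts G = (\<Union>j\<in>{1..r}. v j ` {0..n j})"
      "bij_betw (\<lambda>(j, i). a j i) (SIGMA j:{1..r}. {0..<n j}) (arcs G)"
      "\<forall>j\<in>{1..r}. \<forall>i\<in>{0..<n j}. {tail G (a j i), head G (a j i)} = {v j i, v j (Suc i)}"
    using assms(2) unfolding odd_cycles_glued_def by (elim exE conjE)
  interpret cycles_at_vertex r G n v a c
  proof
    show "odd (n j)" "v j 0 = c" "v j (n j) = c" if "j \<in> {1..r}" for j using bspec[OF *(1) that] by auto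
    show "v j i \<noteq> c" if "j \<in> {1..r}" "i \<in> {1..<n j}" for j i using *(2) that by blast
    show "{tail G (a j i), head G (a j i)} = {v j i, v j (Suc i)}" if "j \<in> {1..r}" "i < n j" for j i
      using bspec[OF bspec[OF *(6) that(1)], of i] that(2) by simp
  qed (rule *)+
  have "(\<Sum>j=1..r. integral {0..real (n j)} (along_cycle q j)) = 0"
    by (rule asymptotics_imp_zero_mean[OF assms(1,3,6,8,9)])
  then show "AE x\<in>{0..1} in lebesgue. q e x = 0"
    using nonneg_spectrum_zero_mean_imp_AE_zero[OF _ assms(3,5) _ e] assms(1) by simp
qed

end
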